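(* Let $E/\mathbb{Q}$ be the elliptic curve $y^2 = x^3 + x$ and let $X = \mathrm{Km}(E \times E)$. Then $X(\mathbb{Q})$ is dense in $X(\mathbb{Q}_p)$ (with the $p$-adic topology) for all primes $p$ with $p \equiv 3 \pmod 4$ and $p > 7$.
   Context: For an abelian variety $A$ over a field of characteristic different from $2$, $\mathrm{Km}(A)$ denotes the Kummer variety of $A$: the blow-up of the quotient $A/\langle -1\rangle$ in the image of the $2$-torsion subgroup $A[2]$. *)

theory Defs
  imports
    "HOL-Analysis.Analysis"
    "HOL-Library.Poly_Mapping"
    "HOL-Number_Theory.Number_Theory"
begin

section \<open>The field of p-adic numbers\<close>

text \<open>The \<open>p\<close>-adic absolute value on the rationals, normalised by \<open>|p| = 1/p\<close>.\<close>

definition padic_abs :: "nat \<Rightarrow> rat \<Rightarrow> real" where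
  "padic_abs p r =
     (if r = 0 then 0
      else real p powi (int (multiplicity (int p) (snd (quotient_of r)))
                        - int (multiplicity (int p) (fst (quotient_of r)))))"

definition abs_dist :: "('k::ab_group_add \<Rightarrow> real) \<Rightarrow> 'k \<Rightarrow> 'k \<Rightarrow> real" where
  "abs_dist v x y = v (x - y)"

text \<open>\<open>padic_field p v\<close>: the field \<open>'k\<close> with the absolute value \<open>v\<close> is the completion of the
  rationals with respect to the \<open>p\<close>-adic absolute value.  This determines \<open>('k, v)\<close> up to a
  unique isometric field isomorphism.  A type cannot depend on the number \<open>p\<close>, which is why the
  field of \<open>p\<close>-adic numbers is given by this predicate and not by a type constructor.\<close>

locale padic_field =
  fixes p :: nat and v :: "'k::field_char_0 \<Rightarrow> real"
  assumes prime_p: "prime p"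
    and v_nonneg: "0 \<le> v x"
    and v_eq_0_iff: "v x = 0 \<longleftrightarrow> x = 0"
    and v_mult: "v (x * y) = v x * v y"
    and v_add: "v (x + y) \<le> max (v x) (v y)"
    and v_of_rat: "v (of_rat r) = padic_abs p r"
    and complete: "Metric_space.mcomplete UNIV (abs_dist v)"
    and dense: "Metric_space.mtopology UNIV (abs_dist v) closure_of (range of_rat) = UNIV"
begin

lemma v_minus: "v (- x) = v x"
proof -
  have "v (-1) * v (-1) = 1 * v 1" "v 1 = v 1 * v 1"
    using v_mult[of "-1" "-1"] v_mult[of 1 1] by simp_all
  moreover have "v 1 \<noteq> 0" by (simp add: v_eq_0_iff)
  ultimately have "v 1 = 1" and "(v (-1))\<^sup>2 = 1"
    by (auto simp: power2_eq_square)
  hence "v (-1) = 1" using v_nonneg[of "-1"] by (simp add: power2_eq_1_iff)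
  thus ?thesis using v_mult[of "-1" x] by simp
qed

sublocale Metric_space UNIV "abs_dist v"
proof
  fix x y z :: 'k
  show "0 \<le> abs_dist v x y" by (simp add: abs_dist_def v_nonneg)
  show "abs_dist v x y = abs_dist v y x"
    unfolding abs_dist_def by (metis minus_diff_eq v_minus)
  show "abs_dist v x y = 0 \<longleftrightarrow> x = y" by (simp add: abs_dist_def v_eq_0_iff)
  have "v ((x - y) + (y - z)) \<le> max (v (x - y)) (v (y - z))" by (rule v_add)
  also have "\<dots> \<le> v (x - y) + v (y - z)" using v_nonneg by (simp add: max_def)
  finally show "abs_dist v x z \<le> abs_dist v x y + abs_dist v y z"
    by (simp add: abs_dist_def)
qed

end


section \<open>Polynomials over the rationals and Zariski closures\<close>

text \<open>Polynomials with rational coefficients in variables indexed by \<open>'i\<close>.\<close>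

type_synonym 'i qpoly = "('i \<Rightarrow>\<^sub>0 nat) \<Rightarrow>\<^sub>0 rat"

definition evalp :: "'i qpoly \<Rightarrow> ('i \<Rightarrow> 'k::field_char_0) \<Rightarrow> 'k" where
  "evalp P x = (\<Sum>m\<in>Poly_Mapping.keys P. of_rat (Poly_Mapping.lookup P m) *
                  (\<Prod>i\<in>Poly_Mapping.keys m. x i ^ Poly_Mapping.lookup m i))"

definition hforms :: "nat \<Rightarrow> 'i qpoly set" where
  "hforms e = {P. \<forall>m\<in>Poly_Mapping.keys P.
                    (\<Sum>i\<in>Poly_Mapping.keys m. Poly_Mapping.lookup m i) = e}"

text \<open>The points with coordinates in \<open>'k\<close> of the Zariski closure, over the field of rational
  numbers, of a set of complex points.

  Projective varieties are represented by their cones: a point of a projective space is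
  represented by all of its nonzero coordinate vectors, and a point of a product of two projective
  spaces by a vector indexed by a sum type both of whose halves are nonzero.  A polynomial that
  vanishes on a cone (stable under scaling, separately in each factor) has all its (bi)homogeneous
  components vanishing there, so that homogeneity need not be required.  The set of coordinates may
  be an infinite spanning set of a finite-dimensional space of sections: the linear relations among
  the coordinates are among the polynomials \<open>P\<close> below.\<close>

definition rat_closure :: "('i \<Rightarrow> complex) set \<Rightarrow> ('i \<Rightarrow> 'k::field_char_0) set" where
  "rat_closure C = {x. \<forall>P. (\<forall>z\<in>C. evalp P z = 0) \<longrightarrow> evalp P x = 0}"


section \<open>Blow-ups\<close>

text \<open>\<open>V\<close> is the set of complex points of (the cone of) a projective variety defined over the
  rationals, and \<open>Z\<close> a closed subset, also defined over the rationals.  Let \<open>f\<^sub>H\<close> range over the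
  forms \<open>H\<close> of degree \<open>e\<close> with rational coefficients that vanish on \<open>Z\<close>.  If these generate the
  ideal sheaf of \<open>Z\<close> (with its reduced structure) on \<open>V\<close>, then the blow-up of \<open>V\<close> in \<open>Z\<close> is the
  Zariski closure of the graph of the rational map \<open>(f\<^sub>H)\<^sub>H\<close> on \<open>V - Z\<close>, and it does not depend on
  \<open>e\<close>.\<close>

definition vanishing_forms :: "nat \<Rightarrow> ('i \<Rightarrow> complex) set \<Rightarrow> 'i qpoly set" where
  "vanishing_forms e Z = {H \<in> hforms e. \<forall>z\<in>Z. evalp H z = 0}"

definition blowup_graph ::
  "nat \<Rightarrow> ('i \<Rightarrow> complex) set \<Rightarrow> ('i \<Rightarrow> complex) set \<Rightarrow> ('i + 'i qpoly \<Rightarrow> complex) set" where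
  "blowup_graph e V Z =
     {case_sum u (\<lambda>H. if H \<in> vanishing_forms e Z then s * evalp H u else 0) | u s.
        u \<in> V - Z \<and> s \<noteq> 0}"

definition blowup_cone ::
  "nat \<Rightarrow> ('i \<Rightarrow> complex) set \<Rightarrow> ('i \<Rightarrow> complex) set \<Rightarrow> ('i + 'i qpoly \<Rightarrow> 'k::field_char_0) set" where
  "blowup_cone e V Z =
     {w \<in> rat_closure (blowup_graph e V Z). w \<circ> Inl \<noteq> (\<lambda>_. 0) \<and> w \<circ> Inr \<noteq> (\<lambda>_. 0)}"


section \<open>The Kummer surface of the square of an elliptic curve\<close>

datatype coord = CX | CY | CZ

text \<open>The Weierstrass curve \<open>y\<^sup>2 = x\<^sup>3 + a x + b\<close> in the projective plane; the neutral element is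
  \<open>[0 : 1 : 0]\<close> and the inverse of \<open>[x : y : z]\<close> is \<open>[x : -y : z]\<close>.\<close>

definition curve_cone :: "rat \<Rightarrow> rat \<Rightarrow> (coord \<Rightarrow> 'k::field_char_0) set" where
  "curve_cone a b =
     {c. c \<noteq> (\<lambda>_. 0) \<and>
         (c CY)\<^sup>2 * c CZ = (c CX) ^ 3 + of_rat a * c CX * (c CZ)\<^sup>2 + of_rat b * (c CZ) ^ 3}"

definition curve_neg :: "(coord \<Rightarrow> 'k::field_char_0) \<Rightarrow> coord \<Rightarrow> 'k" where
  "curve_neg c = c(CY := - c CY)"

definition same_point :: "('i \<Rightarrow> 'k::field) \<Rightarrow> ('i \<Rightarrow> 'k) \<Rightarrow> bool" where
  "same_point c d \<longleftrightarrow> (\<exists>s. s \<noteq> 0 \<and> d = (\<lambda>i. s * c i))"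

text \<open>The abelian surface \<open>A = E \<times> E\<close> in the product of two projective planes, and the subgroup
  \<open>A[2]\<close> of the points \<open>P\<close> with \<open>P = -P\<close>.\<close>

definition surface_cone :: "rat \<Rightarrow> rat \<Rightarrow> (coord + coord \<Rightarrow> 'k::field_char_0) set" where
  "surface_cone a b = {c. c \<circ> Inl \<in> curve_cone a b \<and> c \<circ> Inr \<in> curve_cone a b}"

definition surface_neg :: "(coord + coord \<Rightarrow> 'k::field_char_0) \<Rightarrow> coord + coord \<Rightarrow> 'k" where
  "surface_neg c = case_sum (curve_neg (c \<circ> Inl)) (curve_neg (c \<circ> Inr))"

definition two_torsion_cone :: "rat \<Rightarrow> rat \<Rightarrow> (coord + coord \<Rightarrow> 'k::field_char_0) set" where
  "two_torsion_cone a b =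
     {c \<in> surface_cone a b.
        same_point (c \<circ> Inl) (surface_neg c \<circ> Inl) \<and> same_point (c \<circ> Inr) (surface_neg c \<circ> Inr)}"

text \<open>The quotient of \<open>A\<close> by \<open>-1\<close> is \<open>Proj\<close> of the ring of \<open>-1\<close>-invariants in the homogeneous
  coordinate ring of \<open>A\<close>, graded by the forms of bidegree \<open>(d, d)\<close>.  For even \<open>d\<close> the invariant
  forms of bidegree \<open>(d, d)\<close> generate the invariants of bidegrees \<open>(k d, k d)\<close>, so that they embed
  the quotient in a projective space; its coordinates are indexed by the set \<open>invariant_forms d\<close>
  of all these forms.\<close>

definition invariant_forms :: "nat \<Rightarrow> (coord + coord) qpoly set" where
  "invariant_forms d =
     {P. (\<forall>m\<in>Poly_Mapping.keys P.
            Poly_Mapping.lookup m (Inl CX) + Poly_Mapping.lookup m (Inl CY)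
              + Poly_Mapping.lookup m (Inl CZ) = d \<and>
            Poly_Mapping.lookup m (Inr CX) + Poly_Mapping.lookup m (Inr CY)
              + Poly_Mapping.lookup m (Inr CZ) = d) \<and>
         (\<forall>c :: coord + coord \<Rightarrow> complex. evalp P (surface_neg c) = evalp P c)}"

definition quotient_map_coords ::
  "nat \<Rightarrow> (coord + coord \<Rightarrow> 'k::field_char_0) \<Rightarrow> (coord + coord) qpoly \<Rightarrow> 'k" where
  "quotient_map_coords d c = (\<lambda>P. if P \<in> invariant_forms d then evalp P c else 0)"

text \<open>The blow-up of \<open>A/\<langle>-1\<rangle>\<close> in the image of \<open>A[2]\<close>, with \<open>A/\<langle>-1\<rangle>\<close> embedded by the invariant forms
  of bidegree \<open>(4, 4)\<close>.  In this embedding forms of degree \<open>e = 1\<close> suffice for the blow-up: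
  write \<open>f x = x\<^sup>3 + a x + b\<close> and \<open>w = y\<^sub>1 y\<^sub>2\<close>.  In affine terms the invariant forms are the
  \<open>g x\<^sub>1 x\<^sub>2 + w h x\<^sub>1 x\<^sub>2\<close> with \<open>g\<close> of degree at most 6 and \<open>h\<close> of degree at most 4 in each variable.
  Those vanishing on \<open>A[2]\<close> include \<open>f x\<^sub>1 g\<^sub>1 x\<^sub>1 x\<^sub>2\<close> with \<open>g\<^sub>1\<close> of bidegree at most \<open>(2, 6)\<close>,
  \<open>f x\<^sub>2 g\<^sub>2 x\<^sub>1 x\<^sub>2\<close> with \<open>g\<^sub>2\<close> of bidegree at most \<open>(6, 2)\<close>, and all \<open>w h x\<^sub>1 x\<^sub>2\<close>; together they
  generate the ideal \<open>(f x\<^sub>1, f x\<^sub>2, w)\<close> of the 16 points locally, also where a coordinate is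
  infinite.\<close>

definition kummer_cone :: "rat \<Rightarrow> rat \<Rightarrow>
    ((coord + coord) qpoly + (coord + coord) qpoly qpoly \<Rightarrow> 'k::field_char_0) set" where
  "kummer_cone a b = blowup_cone 1
     (quotient_map_coords 4 ` surface_cone a b) (quotient_map_coords 4 ` two_torsion_cone a b)"

text \<open>The point of a product of two projective spaces with given coordinate vectors, as the set of
  all of its coordinate vectors.\<close>

definition biproj_point :: "('i + 'j \<Rightarrow> 'k::field) \<Rightarrow> ('i + 'j \<Rightarrow> 'k) set" where
  "biproj_point w =
     {case_sum (\<lambda>i. s * w (Inl i)) (\<lambda>j. t * w (Inr j)) | s t. s \<noteq> 0 \<and> t \<noteq> 0}"

definition kummer_points :: "rat \<Rightarrow> rat \<Rightarrow>
    ((coord + coord) qpoly + (coord + coord) qpoly qpoly \<Rightarrow> 'k::field_char_0) set set" where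
  "kummer_points a b = biproj_point ` kummer_cone a b"

text \<open>The rational points, inside the set of points over an extension field.\<close>

definition kummer_rat_points :: "rat \<Rightarrow> rat \<Rightarrow>
    ((coord + coord) qpoly + (coord + coord) qpoly qpoly \<Rightarrow> 'k::field_char_0) set set" where
  "kummer_rat_points a b = (\<lambda>w. biproj_point (\<lambda>i. of_rat (w i))) ` kummer_cone a b"


section \<open>The topology on the points over a valued field\<close>

definition quotient_topology :: "'a topology \<Rightarrow> ('a \<Rightarrow> 'b) \<Rightarrow> 'b topology" where
  "quotient_topology T f =
     topology (\<lambda>U. U \<subseteq> f ` topspace T \<and> openin T {x \<in> topspace T. f x \<in> U})"

lemma openin_quotient_topology:
  "openin (quotient_topology T f) U \<longleftrightarrow>
     U \<subseteq> f ` topspace T \<and> openin T {x \<in> topspace T. f x \<in> U}"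
proof -
  have "istopology (\<lambda>U. U \<subseteq> f ` topspace T \<and> openin T {x \<in> topspace T. f x \<in> U})"
    unfolding istopology_def
  proof (intro conjI allI impI)
    fix S S' assume *: "S \<subseteq> f ` topspace T \<and> openin T {x \<in> topspace T. f x \<in> S}"
      "S' \<subseteq> f ` topspace T \<and> openin T {x \<in> topspace T. f x \<in> S'}"
    have "{x \<in> topspace T. f x \<in> S \<inter> S'} =
        {x \<in> topspace T. f x \<in> S} \<inter> {x \<in> topspace T. f x \<in> S'}" by auto
    with * show "openin T {x \<in> topspace T. f x \<in> S \<inter> S'}" by auto
  next
    fix K assume *: "\<forall>S\<in>K. S \<subseteq> f ` topspace T \<and> openin T {x \<in> topspace T. f x \<in> S}"
    have "{x \<in> topspace T. f x \<in> \<Union>K} = (\<Union>S\<in>K. {x \<in> topspace T. f x \<in> S})" by auto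
    with * show "openin T {x \<in> topspace T. f x \<in> \<Union>K}" by auto
  qed auto
  thus ?thesis by (simp add: quotient_topology_def topology_inverse')
qed

lemma topspace_quotient_topology: "topspace (quotient_topology T f) = f ` topspace T"
proof
  have "{x \<in> topspace T. f x \<in> f ` topspace T} = topspace T" by auto
  hence "openin (quotient_topology T f) (f ` topspace T)"
    by (simp add: openin_quotient_topology)
  thus "f ` topspace T \<subseteq> topspace (quotient_topology T f)" by (rule openin_subset)
  show "topspace (quotient_topology T f) \<subseteq> f ` topspace T"
    using openin_topspace[of "quotient_topology T f"]
    by (simp only: openin_quotient_topology)
qed

lemma quotient_map_quotient_topology: "quotient_map T (quotient_topology T f) f"
  by (auto simp: quotient_map_def topspace_quotient_topology openin_quotient_topology)

text \<open>The topology on the set of points of the Kummer surface over the field \<open>'k\<close> with absolute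
  value \<open>v\<close>: the quotient by scaling of the topology on coordinate vectors.  This is the subspace
  topology in the product of projective spaces, since the quotient maps by the groups of scalars
  are open.\<close>

definition kummer_topology :: "('k::field_char_0 \<Rightarrow> real) \<Rightarrow> rat \<Rightarrow> rat \<Rightarrow>
    ((coord + coord) qpoly + (coord + coord) qpoly qpoly \<Rightarrow> 'k) set topology" where
  "kummer_topology v a b =
     quotient_topology
       (subtopology (product_topology (\<lambda>_. Metric_space.mtopology UNIV (abs_dist v)) UNIV)
          (kummer_cone a b))
       biproj_point"

lemma (in padic_field) topspace_kummer_topology:
  "topspace (kummer_topology v a b) = kummer_points a b"
  by (simp add: kummer_topology_def kummer_points_def topspace_quotient_topology)

end

theory Submission
  imports Defs
begin

text \<open>In coordinates \<open>C\<close>, \<open>S\<close>, \<open>E\<close> with \<open>C\<^sup>2 + S\<^sup>2 = 1\<close> and \<open>2 E\<^sup>2 = C\<close> on each factor, the Kummer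
  surface becomes the double cover \<open>\<Omega>\<^sup>2 = C\<^sub>1 C\<^sub>2\<close> of a product of two conics, where
  \<open>\<Omega> = 2 E\<^sub>1 E\<^sub>2\<close>.  No \<open>p\<close>-adic point is lost, because \<open>-1\<close> is not a square, and the points with
  \<open>\<Omega> = 0\<close>, including those on the exceptional curves, are limits of points with \<open>\<Omega> \<noteq> 0\<close>.

  If \<open>\<Omega> \<noteq> 0\<close> then, up to changing the signs of both \<open>C\<^sub>i\<close>, one has \<open>C\<^sub>i = e x\<^sub>i\<^sup>2\<close> and \<open>\<Omega> = e x\<^sub>1 x\<^sub>2\<close> with
  \<open>e = 1\<close> or \<open>e = p\<close>, and \<open>(x\<^sub>i, y\<^sub>i)\<close> with \<open>y\<^sub>i = S\<^sub>i / (1 + C\<^sub>i)\<close> are points of the twisted Edwards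
  curve \<open>e x\<^sup>2 + y\<^sup>2 + e x\<^sup>2 y\<^sup>2 = 1\<close>.  The group of \<open>p\<close>-adic points of this curve is topologically
  cyclic: the kernel of reduction is so by the approximate additivity of \<open>x\<close>, and the group modulo
  \<open>p\<close> is cyclic because division polynomials have too few roots for a full \<open>l\<close>-torsion subgroup.
  A generator \<open>G\<close> can be approximated by points \<open>G' = (s, t)\<close> with \<open>t\<close> and \<open>e s\<^sup>2\<close> rational.  Then all
  multiples of \<open>G'\<close> have coordinates of the form \<open>(s \<xi>, \<eta>)\<close> with rational \<open>\<xi>\<close>, \<open>\<eta>\<close>, so that pairs of
  multiples of \<open>G'\<close> define rational points of the Kummer surface, and these approximate the given
  point.\<close>

section \<open>Evaluation of rational polynomials\<close>

text \<open>Two obstacles shape the proof. A rational point of the Kummer surface arises from two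
  rational points on one and the same quadratic twist, and a twist fixed beforehand need not have
  rational points near a given p-adic one. The twist is therefore left open: a rational
  \<open>t\<close> lies on the twist with \<open>e s^2 = (1 - t^2) / (1 + t^2)\<close>, so that
  \<open>t\<close> is chosen first, by density of the rationals. This yields only one point G', and
  both factors have to be approximated by independent multiples of it; hence the need for a
  topologically cyclic group.

  The Edwards form is chosen because the denominators of its addition law are units at all p-adic
  points, so that one formula covers the whole group. On the geometric side, closures are tested by
  rational polynomials at complex points. Facts about p-adic points of the blow-up thus become
  polynomial identities on the complex graph, and its infinitely many coordinates are expressed
  through the finitely many parameters of \<open>kummer_vec\<close>.\<close>

definition monomial_value :: "('i \<Rightarrow>\<^sub>0 nat) \<Rightarrow> ('i \<Rightarrow> 'k::field_char_0) \<Rightarrow> 'k" where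
  "monomial_value m x = (\<Prod>i\<in>Poly_Mapping.keys m. x i ^ Poly_Mapping.lookup m i)"

definition const_poly :: "rat \<Rightarrow> 'i qpoly" where
  "const_poly r = Poly_Mapping.single 0 r"

definition var_poly :: "'i \<Rightarrow> 'i qpoly" where
  "var_poly i = Poly_Mapping.single (Poly_Mapping.single i 1) 1"

lemma evalp_superset:
  assumes "finite A" "Poly_Mapping.keys P \<subseteq> A"
  shows "evalp P x = (\<Sum>m\<in>A. of_rat (Poly_Mapping.lookup P m) * monomial_value m x)"
  unfolding evalp_def monomial_value_def
  using assms by (intro sum.mono_neutral_left) (auto simp: in_keys_iff)

lemma monomial_value_superset:
  assumes "finite A" "Poly_Mapping.keys m \<subseteq> A"
  shows "monomial_value m x = (\<Prod>i\<in>A. x i ^ Poly_Mapping.lookup m i)"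
  unfolding monomial_value_def
  using assms by (intro prod.mono_neutral_left) (auto simp: in_keys_iff)

lemma monomial_value_add: "monomial_value (m + n) x = monomial_value m x * monomial_value n x"
proof -
  let ?A = "Poly_Mapping.keys m \<union> Poly_Mapping.keys n"
  have f: "finite ?A" by simp
  have k: "Poly_Mapping.keys (m + n) \<subseteq> ?A" by (rule Poly_Mapping.keys_add)
  show ?thesis
    by (subst (1 2 3) monomial_value_superset[OF f])
       (use k in \<open>auto simp: lookup_add power_add prod.distrib\<close>)
qed

lemma monomial_value_single [simp]: "monomial_value (Poly_Mapping.single i n) x = x i ^ n"
  by (cases "n = 0") (auto simp: monomial_value_def)

lemma monomial_value_zero [simp]: "monomial_value 0 x = 1"
  by (simp add: monomial_value_def)

lemma evalp_zero [simp]: "evalp 0 x = 0"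
  by (simp add: evalp_def)

lemma evalp_single [simp]:
  "evalp (Poly_Mapping.single m r) x = of_rat r * monomial_value m x"
  by (cases "r = 0") (auto simp: evalp_def monomial_value_def)

lemma evalp_add [simp]: "evalp (P + Q) x = evalp P x + evalp Q x"
proof -
  let ?A = "Poly_Mapping.keys P \<union> Poly_Mapping.keys Q"
  have f: "finite ?A" by simp
  have k: "Poly_Mapping.keys (P + Q) \<subseteq> ?A" by (rule Poly_Mapping.keys_add)
  show ?thesis
    by (subst (1 2 3) evalp_superset[OF f])
       (use k in \<open>auto simp: lookup_add of_rat_add distrib_right sum.distrib\<close>)
qed

text \<open>Without the freshness condition of \<open>update_induct\<close> the rule becomes an
  induction over sums of monomials, to which additivity of \<open>evalp\<close> applies
  directly.\<close>

lemma poly_mapping_add_induct [case_names zero add]: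
  assumes "P 0" and "\<And>f a b. P f \<Longrightarrow> P (Poly_Mapping.single a b + f)"
  shows "P (f :: 'a \<Rightarrow>\<^sub>0 'b::comm_monoid_add)"
proof (induction f rule: update_induct)
  case const
  then show ?case using assms(1) by simp
next
  case (update f a b)
  have "Poly_Mapping.update a b f = Poly_Mapping.single a b + f"
    using update(1)
    by (intro poly_mapping_eqI) (auto simp: lookup_update lookup_add lookup_single in_keys_iff when_def)
  then show ?case using assms(2)[OF update(3)] by simp
qed

lemma evalp_mult [simp]: "evalp (P * Q) x = evalp P x * evalp Q x"
proof (induction P rule: poly_mapping_add_induct)
  case zero
  then show ?case by simp
next
  case (add P a b)
  have "evalp (Poly_Mapping.single a b * Q) x = of_rat b * monomial_value a x * evalp Q x"
  proof (induction Q rule: poly_mapping_add_induct)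
    case (add Q c d)
    then show ?case
      by (simp add: distrib_left mult_single monomial_value_add of_rat_mult)
  qed simp
  with add show ?case by (simp add: distrib_right)
qed

lemma evalp_const_poly [simp]: "evalp (const_poly r) x = of_rat r"
  by (simp add: const_poly_def)

lemma evalp_var_poly [simp]: "evalp (var_poly i) x = x i"
  by (simp add: var_poly_def)

lemma evalp_one [simp]: "evalp 1 x = 1"
  using evalp_single[of 0 1 x] by simp

lemma evalp_power [simp]: "evalp (P ^ n) x = evalp P x ^ n"
  by (induction n) auto

lemma evalp_uminus [simp]: "evalp (- P) x = - evalp P x"
proof -
  have "evalp (- P) x + evalp P x = evalp (- P + P) x" by (rule evalp_add[symmetric])
  thus ?thesis by (simp add: eq_neg_iff_add_eq_0)
qed

lemma evalp_diff [simp]: "evalp (P - Q) x = evalp P x - evalp Q x"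
  using evalp_add[of P "- Q" x] by simp

lemma evalp_sum: "evalp (sum f A) x = (\<Sum>i\<in>A. evalp (f i) x)"
  by (induction A rule: infinite_finite_induct) auto

lemma evalp_eq_monomial_sum:
  "evalp P x = (\<Sum>m\<in>Poly_Mapping.keys P. of_rat (Poly_Mapping.lookup P m) * monomial_value m x)"
  by (simp add: evalp_def monomial_value_def)

lemma evalp_of_rat: "evalp P (\<lambda>i. of_rat (x i)) = of_rat (evalp P x)"
  by (simp add: evalp_def of_rat_sum of_rat_mult of_rat_prod of_rat_power)

text \<open>Homogenisation, the normal form on the circles and continuity are all compatible with
  sums and products; with this rule only constants and variables remain to be checked.\<close>

lemma qpoly_induct [case_names const var add mult]:
  assumes c: "\<And>r. P (const_poly r)" and v: "\<And>i. P (var_poly i)"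
    and a: "\<And>p q. P p \<Longrightarrow> P q \<Longrightarrow> P (p + q)" and m: "\<And>p q. P p \<Longrightarrow> P q \<Longrightarrow> P (p * q)"
  shows "P (q :: 'i qpoly)"
proof -
  have power: "P (Poly_Mapping.single (Poly_Mapping.single i n) 1)" for i n
  proof (induction n)
    case 0
    then show ?case using c[of 1] by (simp add: const_poly_def)
  next
    case (Suc n)
    have "Poly_Mapping.single (Poly_Mapping.single i (Suc n)) (1::rat)
        = var_poly i * Poly_Mapping.single (Poly_Mapping.single i n) 1"
      by (simp add: var_poly_def mult_single flip: single_add)
    then show ?case using m[OF v Suc] by simp
  qed
  have single: "P (Poly_Mapping.single k r)" for k r
  proof (induction k rule: poly_mapping_add_induct)
    case zero
    then show ?case using c[of r] by (simp add: const_poly_def)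
  next
    case (add k i n)
    have "Poly_Mapping.single (Poly_Mapping.single i n + k) r
        = Poly_Mapping.single (Poly_Mapping.single i n) 1 * Poly_Mapping.single k r"
      by (simp add: mult_single)
    then show ?case using m[OF power add] by simp
  qed
  show ?thesis
  proof (induction q rule: poly_mapping_add_induct)
    case zero
    then show ?case using single[of 0 0] by simp
  next
    case (add f k r)
    then show ?case using a[OF single] by blast
  qed
qed

lemma evalp_prod: "evalp (prod f A) x = (\<Prod>i\<in>A. evalp (f i) x)"
  by (induction A rule: infinite_finite_induct) auto

lemma evalp_numeral [simp]: "evalp (numeral n) x = numeral n"
  using evalp_single[of 0 "numeral n" x] by (simp flip: single_numeral)

definition substitute :: "'i qpoly \<Rightarrow> ('i \<Rightarrow> 'j qpoly) \<Rightarrow> 'j qpoly" where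
  "substitute P f = (\<Sum>m\<in>Poly_Mapping.keys P. const_poly (Poly_Mapping.lookup P m) *
                  (\<Prod>i\<in>Poly_Mapping.keys m. f i ^ Poly_Mapping.lookup m i))"

lemma evalp_substitute [simp]: "evalp (substitute P f) x = evalp P (\<lambda>i. evalp (f i) x)"
  by (simp add: substitute_def evalp_sum evalp_prod) (simp add: evalp_def)

section \<open>Homogeneity and relations on Zariski closures\<close>

lemma evalp_scale_hforms:
  assumes "P \<in> hforms e"
  shows "evalp P (\<lambda>i. s * x i) = s ^ e * evalp P x"
proof -
  have "monomial_value m (\<lambda>i. s * x i) = s ^ e * monomial_value m x"
    if "m \<in> Poly_Mapping.keys P" for m
  proof -
    have "(\<Sum>i\<in>Poly_Mapping.keys m. Poly_Mapping.lookup m i) = e"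
      using that assms by (auto simp: hforms_def)
    thus ?thesis
      by (simp add: monomial_value_def power_mult_distrib prod.distrib flip: power_sum)
  qed
  thus ?thesis
    by (simp add: evalp_eq_monomial_sum sum_distrib_left mult.left_commute)
qed

text \<open>The same exponent and the same polynomial clear denominators over both fields. This is
  what allows a relation checked at complex points to be transported to \<open>'k\<close>.\<close>

lemma exists_homogenization:
  fixes Q :: "'i qpoly"
  shows "\<exists>N Q'. (\<forall>x::'i \<Rightarrow> complex. x d \<noteq> 0 \<longrightarrow>
                    evalp Q' x = x d ^ N * evalp Q (\<lambda>j. x j / x d)) \<and>
                (\<forall>x::'i \<Rightarrow> 'k::field_char_0. x d \<noteq> 0 \<longrightarrow>
                    evalp Q' x = x d ^ N * evalp Q (\<lambda>j. x j / x d))"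
    (is "\<exists>N Q'. ?R N Q' Q")
proof (induction Q rule: qpoly_induct)
  case (const r)
  show ?case by (intro exI[of _ 0] exI[of _ "const_poly r"]) simp
next
  case (var i)
  show ?case by (intro exI[of _ 1] exI[of _ "var_poly i"]) simp
next
  case (add p q)
  then obtain N p' M q' where "?R N p' p" "?R M q' q" by blast
  then have "?R (N + M) (p' * var_poly d ^ M + q' * var_poly d ^ N) (p + q)"
    by (simp add: power_add distrib_left mult_ac)
  then show ?case by blast
next
  case (mult p q)
  then obtain N p' M q' where "?R N p' p" "?R M q' q" by blast
  then have "?R (N + M) (p' * q') (p * q)"
    by (simp add: power_add mult_ac)
  then show ?case by blast
qed

text \<open>The homogenised relation is multiplied by \<open>var_poly d\<close>, so that it also
  holds where the coordinate \<open>d\<close> vanishes. Membership in the closure then applies,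
  although \<open>Q\<close> is known only on an open part of \<open>C\<close>.\<close>

lemma rat_closure_affine_relation:
  fixes w :: "'i \<Rightarrow> 'k::field_char_0"
  assumes w: "w \<in> rat_closure C" and d: "w d \<noteq> 0"
    and Q: "\<And>z. z \<in> C \<Longrightarrow> z d \<noteq> 0 \<Longrightarrow> evalp Q (\<lambda>j. z j / z d) = 0"
  shows "evalp Q (\<lambda>j. w j / w d) = 0"
proof -
  obtain N Q' where 1: "\<forall>x::'i \<Rightarrow> complex. x d \<noteq> 0 \<longrightarrow>
                    evalp Q' x = x d ^ N * evalp Q (\<lambda>j. x j / x d)"
    and 2: "\<forall>x::'i \<Rightarrow> 'k. x d \<noteq> 0 \<longrightarrow> evalp Q' x = x d ^ N * evalp Q (\<lambda>j. x j / x d)"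
    using exists_homogenization[where 'k = 'k, of d Q] by blast
  have "evalp (var_poly d * Q') z = 0" if "z \<in> C" for z
    using 1 Q[OF that] by (cases "z d = 0") auto
  hence "evalp (var_poly d * Q') w = 0" using w unfolding rat_closure_def by blast
  thus ?thesis using 2 d by simp
qed

lemma rat_closure_relation:
  assumes "w \<in> rat_closure C" and "\<And>z. z \<in> C \<Longrightarrow> evalp Q z = 0"
  shows "evalp Q w = 0"
  using assms by (auto simp: rat_closure_def)

section \<open>Bihomogeneous forms\<close>

definition bihomogeneous :: "(coord + coord) qpoly \<Rightarrow> nat \<Rightarrow> nat \<Rightarrow> bool" where
  "bihomogeneous P a b \<longleftrightarrow> (\<forall>m\<in>Poly_Mapping.keys P.
     Poly_Mapping.lookup m (Inl CX) + Poly_Mapping.lookup m (Inl CY)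
       + Poly_Mapping.lookup m (Inl CZ) = a \<and>
     Poly_Mapping.lookup m (Inr CX) + Poly_Mapping.lookup m (Inr CY)
       + Poly_Mapping.lookup m (Inr CZ) = b)"

text \<open>The target bidegree consists of free variables tied by equations, so that the rule
  unifies with every goal and leaves the arithmetic as side conditions.\<close>

lemma bihomogeneous_mult:
  assumes "bihomogeneous P a b" "bihomogeneous Q c d" "n = a + c" "m = b + d"
  shows "bihomogeneous (P * Q) n m"
  unfolding bihomogeneous_def
proof
  fix k assume "k \<in> Poly_Mapping.keys (P * Q)"
  then obtain i j where "i \<in> Poly_Mapping.keys P" "j \<in> Poly_Mapping.keys Q" "k = i + j"
    using Poly_Mapping.keys_mult[of P Q] by blast
  with assms show "Poly_Mapping.lookup k (Inl CX) + Poly_Mapping.lookup k (Inl CY)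
       + Poly_Mapping.lookup k (Inl CZ) = n \<and>
     Poly_Mapping.lookup k (Inr CX) + Poly_Mapping.lookup k (Inr CY)
       + Poly_Mapping.lookup k (Inr CZ) = m"
    unfolding bihomogeneous_def by (fastforce simp: lookup_add)
qed

lemma bihomogeneous_one: "bihomogeneous 1 0 0"
  unfolding bihomogeneous_def by simp

lemma bihomogeneous_numeral: "bihomogeneous (numeral k) 0 0"
  unfolding bihomogeneous_def by (simp flip: single_numeral)

lemma bihomogeneous_power:
  assumes "bihomogeneous P a b" "n = k * a" "m = k * b"
  shows "bihomogeneous (P ^ k) n m"
  unfolding assms(2,3)
  by (induction k) (auto intro!: bihomogeneous_one bihomogeneous_mult[OF assms(1)])

lemma bihomogeneous_add:
  assumes "bihomogeneous P a b" "bihomogeneous Q a' b'" "a' = a" "b' = b"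
  shows "bihomogeneous (P + Q) a b"
  using assms Poly_Mapping.keys_add[of P Q] unfolding bihomogeneous_def by blast

lemma bihomogeneous_uminus: "bihomogeneous P a b \<Longrightarrow> bihomogeneous (- P) a b"
  unfolding bihomogeneous_def by simp

lemma bihomogeneous_diff:
  assumes "bihomogeneous P a b" "bihomogeneous Q a' b'" "a' = a" "b' = b"
  shows "bihomogeneous (P - Q) a b"
  using bihomogeneous_add[OF assms(1) bihomogeneous_uminus[OF assms(2)]] assms(3,4) by simp

lemma bihomogeneous_zero: "bihomogeneous 0 a b"
  unfolding bihomogeneous_def by simp

lemma bihomogeneous_Inl: "n = 1 \<Longrightarrow> m = 0 \<Longrightarrow> bihomogeneous (var_poly (Inl i)) n m"
  unfolding bihomogeneous_def by (cases i) (auto simp: var_poly_def lookup_single)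

lemma bihomogeneous_Inr: "n = 0 \<Longrightarrow> m = 1 \<Longrightarrow> bihomogeneous (var_poly (Inr i)) n m"
  unfolding bihomogeneous_def by (cases i) (auto simp: var_poly_def lookup_single)

lemma surface_neg_simps [simp]:
  "surface_neg c (Inl CX) = c (Inl CX)" "surface_neg c (Inl CY) = - c (Inl CY)"
  "surface_neg c (Inl CZ) = c (Inl CZ)" "surface_neg c (Inr CX) = c (Inr CX)"
  "surface_neg c (Inr CY) = - c (Inr CY)" "surface_neg c (Inr CZ) = c (Inr CZ)"
  by (simp_all add: surface_neg_def curve_neg_def)

lemma invariant_formsI:
  assumes "bihomogeneous P d d"
    and "\<And>c::coord + coord \<Rightarrow> complex. evalp P (surface_neg c) = evalp P c"
  shows "P \<in> invariant_forms d"
  using assms unfolding invariant_forms_def bihomogeneous_def by blast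

abbreviation "X1 \<equiv> var_poly (Inl CX) :: (coord + coord) qpoly"
abbreviation "Y1 \<equiv> var_poly (Inl CY) :: (coord + coord) qpoly"
abbreviation "Z1 \<equiv> var_poly (Inl CZ) :: (coord + coord) qpoly"
abbreviation "X2 \<equiv> var_poly (Inr CX) :: (coord + coord) qpoly"
abbreviation "Y2 \<equiv> var_poly (Inr CY) :: (coord + coord) qpoly"
abbreviation "Z2 \<equiv> var_poly (Inr CZ) :: (coord + coord) qpoly"


section \<open>Quartics on the curve\<close>

text \<open>In the affine coordinates with \<open>Z = 1\<close> and \<open>g = x\<^sup>2 + 1\<close>, so that \<open>y\<^sup>2 = x g\<close>, the quotients
  of \<open>quartic_C\<close>, \<open>quartic_S\<close> and \<open>quartic_E\<close> by \<open>quartic_D\<close> are \<open>C = 2 x / g\<close>,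
  \<open>S = (x\<^sup>2 - 1) / g\<close> and \<open>E = y / g\<close>.  They satisfy \<open>C\<^sup>2 + S\<^sup>2 = 1\<close> and \<open>2 E\<^sup>2 = C\<close>.\<close>

definition quartic_D :: "'a::comm_ring_1 \<Rightarrow> 'a \<Rightarrow> 'a \<Rightarrow> 'a" where
  "quartic_D x y z = y ^ 4 + (x\<^sup>2 + z\<^sup>2)\<^sup>2"

definition quartic_C :: "'a::comm_ring_1 \<Rightarrow> 'a \<Rightarrow> 'a \<Rightarrow> 'a" where
  "quartic_C x y z = 2 * y\<^sup>2 * (x\<^sup>2 + z\<^sup>2)"

definition quartic_S :: "'a::comm_ring_1 \<Rightarrow> 'a \<Rightarrow> 'a \<Rightarrow> 'a" where
  "quartic_S x y z = y ^ 4 - (x\<^sup>2 + z\<^sup>2)\<^sup>2"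

definition quartic_E :: "'a::comm_ring_1 \<Rightarrow> 'a \<Rightarrow> 'a \<Rightarrow> 'a" where
  "quartic_E x y z = x * y ^ 3 + y * z * (x\<^sup>2 + z\<^sup>2)"

text \<open>The quotient by \<open>quartic_D\<close> (for even \<open>k\<close>) or \<open>quartic_E\<close> (for odd \<open>k\<close>) of the monomial
  \<open>X\<^sup>i Y\<^sup>k Z\<^sup>j\<close> of degree 4, in terms of \<open>a = x\<^sup>2 / g\<close>, \<open>b = 1 / g\<close> and \<open>h = x / g\<close>.\<close>

definition quartic_ratio :: "nat \<Rightarrow> nat \<Rightarrow> 'a::comm_ring_1 \<Rightarrow> 'a \<Rightarrow> 'a \<Rightarrow> 'a" where
  "quartic_ratio i k a b h =
     (if k = 0 then (if i = 0 then b ^ 3 else if i = 1 then h * b\<^sup>2 else if i = 2 then a * b\<^sup>2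
                     else if i = 3 then a * h * b else a\<^sup>2 * b)
      else if k = 1 then (if i = 0 then b\<^sup>2 else if i = 1 then h * b else if i = 2 then a * b
                     else a * h)
      else if k = 2 then (if i = 0 then b * h else if i = 1 then h\<^sup>2 else a * h)
      else if k = 3 then (if i = 0 then h else a)
      else a)"

lemma evalp_quartics [simp]:
  "evalp (quartic_D P Q R) c = quartic_D (evalp P c) (evalp Q c) (evalp R c)"
  "evalp (quartic_C P Q R) c = quartic_C (evalp P c) (evalp Q c) (evalp R c)"
  "evalp (quartic_S P Q R) c = quartic_S (evalp P c) (evalp Q c) (evalp R c)"
  "evalp (quartic_E P Q R) c = quartic_E (evalp P c) (evalp Q c) (evalp R c)"
  by (simp_all add: quartic_D_def quartic_C_def quartic_S_def quartic_E_def)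

lemma evalp_quartic_ratio [simp]:
  "evalp (quartic_ratio i k P Q R) c = quartic_ratio i k (evalp P c) (evalp Q c) (evalp R c)"
  by (simp add: quartic_ratio_def)

text \<open>With \<open>G = x^2 + z^2\<close> the curve is \<open>y^2 z = x G\<close>, and
  multiplying by \<open>d\<close> gives \<open>x^2 = a G\<close>, \<open>x z = h G\<close>,
  \<open>z^2 = b G\<close>, \<open>x y = y^2 E\<close> and \<open>y z = G E\<close>, where
  \<open>E\<close> is the quotient of \<open>quartic_E\<close> by \<open>d\<close>. Every quartic
  monomial other than \<open>y^4\<close> reduces by these five relations.\<close>

lemma quartic_monomial:
  fixes x y z :: "'a::field"
  assumes curve: "y\<^sup>2 * z = x ^ 3 + x * z\<^sup>2" and D: "quartic_D x y z \<noteq> 0" and deg: "i + k + j = 4"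
    and a: "a = y ^ 4 / quartic_D x y z" and b: "b = (x\<^sup>2 + z\<^sup>2)\<^sup>2 / quartic_D x y z"
    and h: "h = y\<^sup>2 * (x\<^sup>2 + z\<^sup>2) / quartic_D x y z"
  shows "x ^ i * y ^ k * z ^ j =
           (if even k then quartic_D x y z else quartic_E x y z) * quartic_ratio i k a b h"
proof -
  define G where "G = x\<^sup>2 + z\<^sup>2"
  define d where "d = quartic_D x y z"
  define E where "E = quartic_E x y z / d"
  have d0: "d \<noteq> 0" using D by (simp add: d_def)
  have cu: "y\<^sup>2 * z = x * G" using curve by (simp add: G_def power3_eq_cube power2_eq_square algebra_simps)
  have dd: "d = y ^ 4 + G\<^sup>2" by (simp add: d_def quartic_D_def G_def)
  have ad: "a * d = y ^ 4" and bd: "b * d = G\<^sup>2" and hd: "h * d = y\<^sup>2 * G"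
    using d0 by (simp_all add: a b h flip: d_def G_def)
  have Ed: "quartic_E x y z = E * d" and Ed': "E * d = x * y ^ 3 + y * z * G"
    using d0 by (simp_all add: E_def quartic_E_def G_def)
  have x2: "x\<^sup>2 * d = y ^ 4 * G" and xz: "x * z * d = y\<^sup>2 * G\<^sup>2" and z2: "z\<^sup>2 * d = G ^ 3"
    using cu unfolding dd G_def by Groebner_Basis.algebra+
  have X2: "x\<^sup>2 = a * G"
  proof -
    have "x\<^sup>2 * d = (a * G) * d" using x2 ad by (simp add: mult_ac)
    thus ?thesis using d0 by simp
  qed
  have XZ: "x * z = h * G"
  proof -
    have "(x * z) * d = (h * G) * d" using xz hd by (simp add: mult_ac power2_eq_square)
    thus ?thesis using d0 by simp
  qed
  have Z2: "z\<^sup>2 = b * G"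
  proof -
    have "z\<^sup>2 * d = (b * G) * d" using z2 bd by (simp add: mult_ac power2_eq_square power3_eq_cube)
    thus ?thesis using d0 by simp
  qed
  have XY: "x * y = y\<^sup>2 * E"
  proof -
    have "(x * y) * d = (y\<^sup>2 * E) * d"
      using cu Ed' unfolding dd G_def by Groebner_Basis.algebra
    thus ?thesis using d0 by simp
  qed
  have YZ: "y * z = G * E"
  proof -
    have "(y * z) * d = (G * E) * d"
      using cu Ed' unfolding dd G_def by Groebner_Basis.algebra
    thus ?thesis using d0 by simp
  qed
  have m0: "x ^ 4 = d * (a\<^sup>2 * b)"
    using X2 bd by Groebner_Basis.algebra
  have m1: "x ^ 3 * z = d * (a * h * b)"
    using X2 XZ bd by Groebner_Basis.algebra
  have m2: "x\<^sup>2 * z\<^sup>2 = d * (a * b\<^sup>2)"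
    using X2 Z2 bd by Groebner_Basis.algebra
  have m3: "x * z ^ 3 = d * (h * b\<^sup>2)"
    using XZ Z2 bd by Groebner_Basis.algebra
  have m4: "z ^ 4 = d * b ^ 3"
    using Z2 bd by Groebner_Basis.algebra
  have m5: "x\<^sup>2 * y\<^sup>2 = d * (a * h)"
    using X2 hd by Groebner_Basis.algebra
  have m6: "x * y\<^sup>2 * z = d * h\<^sup>2"
    using XZ hd by Groebner_Basis.algebra
  have m7: "y\<^sup>2 * z\<^sup>2 = d * (b * h)"
    using Z2 hd by Groebner_Basis.algebra
  have m8: "x ^ 3 * y = E * d * (a * h)"
    using X2 XY hd by Groebner_Basis.algebra
  have m9: "x\<^sup>2 * y * z = E * d * (a * b)"
    using X2 YZ bd by Groebner_Basis.algebra
  have m10: "x * y * z\<^sup>2 = E * d * (h * b)"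
    using XZ YZ bd by Groebner_Basis.algebra
  have m11: "y * z ^ 3 = E * d * b\<^sup>2"
    using Z2 YZ bd by Groebner_Basis.algebra
  have m12: "x * y ^ 3 = E * d * a"
    using XY ad by Groebner_Basis.algebra
  have m13: "y ^ 3 * z = E * d * h"
    using YZ hd by Groebner_Basis.algebra
  have k: "k = 0 \<or> k = 1 \<or> k = 2 \<or> k = 3 \<or> k = 4" using deg by linarith
  have i: "i = 0 \<or> i = 1 \<or> i = 2 \<or> i = 3 \<or> i = 4" using deg by linarith
  have j: "j = 4 - i - k" using deg by simp
  show ?thesis
    unfolding Ed d_def[symmetric] j quartic_ratio_def using deg k i m0 m1 m2 m3 m4 m5 m6 m7 m8 m9 m10 m11 m12 m13
    by (elim disjE; simp add: ad[symmetric] mult_ac)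
qed

text \<open>Reduction with \<open>X\<^sup>3 = Y\<^sup>2 Z - X Z\<^sup>2\<close> writes the square of \<open>X\<^sup>i Y\<^sup>k Z\<^sup>j\<close> as
  \<open>Y\<^sup>4 square_Y + Z\<^sup>4 square_Z\<close>.\<close>

definition square_Y :: "nat \<Rightarrow> nat \<Rightarrow> 'a::comm_ring_1 \<Rightarrow> 'a \<Rightarrow> 'a \<Rightarrow> 'a" where
  "square_Y i k x y z =
     (if i + k \<le> 2 then 0
      else if k \<ge> 2 then x ^ (2 * i) * y ^ (2 * k - 4) * z ^ (2 * (4 - i - k))
      else if i = 4 then x\<^sup>2 * z\<^sup>2
      else if k = 1 \<and> i = 3 then y\<^sup>2 * z\<^sup>2 - 2 * (x * z ^ 3)
      else if k = 1 then x * z ^ 3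
      else 0)"

definition square_Z :: "nat \<Rightarrow> nat \<Rightarrow> 'a::comm_ring_1 \<Rightarrow> 'a \<Rightarrow> 'a \<Rightarrow> 'a" where
  "square_Z i k x y z =
     (if i + k \<le> 2 then x ^ (2 * i) * y ^ (2 * k) * z ^ (4 - 2 * i - 2 * k)
      else if k \<ge> 2 then 0
      else if i = 4 then x ^ 4 - 2 * y ^ 4 + 2 * (x * y\<^sup>2 * z)
      else if k = 1 \<and> i = 3 then x\<^sup>2 * y\<^sup>2
      else if k = 1 then - (x\<^sup>2 * y\<^sup>2)
      else y ^ 4 - 2 * (x * y\<^sup>2 * z) + x\<^sup>2 * z\<^sup>2)"

lemma evalp_square_YZ [simp]:
  "evalp (square_Y i k P Q R) c = square_Y i k (evalp P c) (evalp Q c) (evalp R c)"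
  "evalp (square_Z i k P Q R) c = square_Z i k (evalp P c) (evalp Q c) (evalp R c)"
  by (simp_all add: square_Y_def square_Z_def)

text \<open>On the curve \<open>y\<close> and \<open>z\<close> have no common zero. This is a form
  of that fact which survives passage to the Zariski closure; the monomial is squared so that each
  summand becomes a product of two quartics, hence of coordinates of the embedding.\<close>

lemma quartic_monomial_square:
  fixes x y z :: "'a::field_char_0"
  assumes curve: "y\<^sup>2 * z = x ^ 3 + x * z\<^sup>2" and deg: "i + k + j = 4"
  shows "(x ^ i * y ^ k * z ^ j)\<^sup>2 = y ^ 4 * square_Y i k x y z + z ^ 4 * square_Z i k x y z"
proof -
  have j: "j = 4 - i - k" using deg by simp
  have sq: "(x ^ i * y ^ k * z ^ j)\<^sup>2 = x ^ (2 * i) * y ^ (2 * k) * z ^ (2 * j)"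
    by (simp add: power_mult_distrib mult.commute flip: power_mult)
  consider "i + k \<le> 2" | "i + k > 2" "k \<ge> 2" | "i = 4" "k = 0" | "i = 3" "k = 1" | "i = 2" "k = 1"
    | "i = 3" "k = 0" using deg by linarith
  then show ?thesis
  proof cases
    case 1
    then have "2 * j = 4 + (4 - 2 * i - 2 * k)" using deg by linarith
    then have "z ^ (2 * j) = z ^ 4 * z ^ (4 - 2 * i - 2 * k)" by (metis power_add)
    with 1 show ?thesis unfolding sq by (simp add: square_Y_def square_Z_def mult_ac)
  next
    case 2
    then have "2 * k = 4 + (2 * k - 4)" by linarith
    then have "y ^ (2 * k) = y ^ 4 * y ^ (2 * k - 4)" by (metis power_add)
    with 2 show ?thesis unfolding sq by (simp add: square_Y_def square_Z_def mult_ac j)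
  next
    case 3
    then have "j = 0" using deg by simp
    moreover have "x ^ 8 = y ^ 4 * (x\<^sup>2 * z\<^sup>2) + z ^ 4 * (x ^ 4 - 2 * y ^ 4 + 2 * x * y\<^sup>2 * z)"
      using curve by Groebner_Basis.algebra
    ultimately show ?thesis unfolding sq using 3 by (simp add: square_Y_def square_Z_def)
  next
    case 4
    then have "j = 0" using deg by simp
    moreover have "x ^ 6 * y\<^sup>2 = y ^ 4 * (y\<^sup>2 * z\<^sup>2 - 2 * x * z ^ 3) + z ^ 4 * (x\<^sup>2 * y\<^sup>2)"
      using curve by Groebner_Basis.algebra
    ultimately show ?thesis unfolding sq using 4 by (simp add: square_Y_def square_Z_def)
  next
    case 5
    then have "j = 1" using deg by simp
    moreover have "x ^ 4 * y\<^sup>2 * z\<^sup>2 = y ^ 4 * (x * z ^ 3) + z ^ 4 * (- (x\<^sup>2 * y\<^sup>2))"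
      using curve by Groebner_Basis.algebra
    ultimately show ?thesis unfolding sq using 5 by (simp add: square_Y_def square_Z_def)
  next
    case 6
    then have "j = 1" using deg by simp
    moreover have "x ^ 6 * z\<^sup>2 = z ^ 4 * (y ^ 4 - 2 * x * y\<^sup>2 * z + x\<^sup>2 * z\<^sup>2)"
      using curve by Groebner_Basis.algebra
    ultimately show ?thesis unfolding sq using 6 by (simp add: square_Y_def square_Z_def)
  qed
qed

lemma square_YZ_neg:
  "square_Y i k x (- y) z = square_Y i k x y z"
  "square_Z i k x (- y) z = square_Z i k x y z"
  by (simp_all add: square_Y_def square_Z_def)

lemma bihomogeneous_square_YZ:
  assumes deg: "i + k \<le> 4" and X: "bihomogeneous X p q" and Y: "bihomogeneous Y p q"
    and Z: "bihomogeneous Z p q"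
  shows "bihomogeneous (square_Y i k X Y Z) (4 * p) (4 * q)"
    and "bihomogeneous (square_Z i k X Y Z) (4 * p) (4 * q)"
proof -
  have mono: "bihomogeneous (X ^ a * Y ^ b * Z ^ c) (4 * p) (4 * q)" if "a + b + c = 4" for a b c
    using that
    by (intro bihomogeneous_mult bihomogeneous_power[OF X] bihomogeneous_power[OF Y]
          bihomogeneous_power[OF Z]) (auto simp flip: distrib_right)
  have scale: "bihomogeneous (2 * P) (4 * p) (4 * q)" if "bihomogeneous P (4 * p) (4 * q)" for P
    using bihomogeneous_mult[OF bihomogeneous_numeral that refl refl] by simp
  note m = mono[of 2 0 2] mono[of 0 2 2] mono[of 1 0 3] mono[of 4 0 0] mono[of 0 4 0]
    mono[of 1 2 1] mono[of 2 2 0]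
  note r = bihomogeneous_add bihomogeneous_diff bihomogeneous_uminus scale m[simplified]
  consider "i + k \<le> 2" | "i + k > 2" "k \<ge> 2" | "i = 4" "k = 0" | "i = 3" "k = 1" | "i = 2" "k = 1"
    | "i = 3" "k = 0" using deg by linarith
  then show "bihomogeneous (square_Y i k X Y Z) (4 * p) (4 * q)"
  proof cases
    case 2
    then show ?thesis using deg by (auto simp: square_Y_def intro!: mono)
  qed (auto simp: square_Y_def bihomogeneous_zero intro!: r)
  consider "i + k \<le> 2" | "i + k > 2" "k \<ge> 2" | "i = 4" "k = 0" | "i = 3" "k = 1" | "i = 2" "k = 1"
    | "i = 3" "k = 0" using deg by linarith
  then show "bihomogeneous (square_Z i k X Y Z) (4 * p) (4 * q)"
  proof cases
    case 1
    then show ?thesis using deg by (auto simp: square_Z_def intro!: mono)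
  qed (auto simp: square_Z_def bihomogeneous_zero intro!: r)
qed

section \<open>An affine chart of the Kummer surface\<close>

text \<open>The affine coordinates \<open>C\<^sub>i\<close>, \<open>S\<^sub>i\<close> of the two curves, and the coordinate \<open>\<Omega> = 2 E\<^sub>1 E\<^sub>2\<close>.\<close>

datatype chart = C1 | S1 | C2 | S2 | Om

definition form_D :: "(coord + coord) qpoly" where
  "form_D = quartic_D X1 Y1 Z1 * quartic_D X2 Y2 Z2"

primrec chart_form :: "chart \<Rightarrow> (coord + coord) qpoly" where
  "chart_form C1 = quartic_C X1 Y1 Z1 * quartic_D X2 Y2 Z2"
| "chart_form S1 = quartic_S X1 Y1 Z1 * quartic_D X2 Y2 Z2"
| "chart_form C2 = quartic_D X1 Y1 Z1 * quartic_C X2 Y2 Z2"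
| "chart_form S2 = quartic_D X1 Y1 Z1 * quartic_S X2 Y2 Z2"
| "chart_form Om = 2 * (quartic_E X1 Y1 Z1 * quartic_E X2 Y2 Z2)"

lemma bihomogeneous_quartics:
  assumes X: "bihomogeneous X p q" and Y: "bihomogeneous Y p q" and Z: "bihomogeneous Z p q"
  shows "bihomogeneous (quartic_D X Y Z) (4 * p) (4 * q)"
    and "bihomogeneous (quartic_C X Y Z) (4 * p) (4 * q)"
    and "bihomogeneous (quartic_S X Y Z) (4 * p) (4 * q)"
    and "bihomogeneous (quartic_E X Y Z) (4 * p) (4 * q)"
proof -
  have Y2: "bihomogeneous (2 * Y\<^sup>2) (2 * p) (2 * q)"
    by (rule bihomogeneous_mult[OF bihomogeneous_numeral bihomogeneous_power[OF Y refl refl]]) simp_all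
  have G: "bihomogeneous (X\<^sup>2 + Z\<^sup>2) (2 * p) (2 * q)"
    by (rule bihomogeneous_add[OF bihomogeneous_power[OF X refl refl] bihomogeneous_power[OF Z refl refl]])
       simp_all
  have Y4: "bihomogeneous (Y ^ 4) (4 * p) (4 * q)" by (intro bihomogeneous_power[OF Y] refl)
  have GG: "bihomogeneous ((X\<^sup>2 + Z\<^sup>2)\<^sup>2) (4 * p) (4 * q)" by (rule bihomogeneous_power[OF G]) simp_all
  show "bihomogeneous (quartic_D X Y Z) (4 * p) (4 * q)"
    unfolding quartic_D_def by (rule bihomogeneous_add[OF Y4 GG refl refl])
  show "bihomogeneous (quartic_S X Y Z) (4 * p) (4 * q)"
    unfolding quartic_S_def by (rule bihomogeneous_diff[OF Y4 GG refl refl])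
  show "bihomogeneous (quartic_C X Y Z) (4 * p) (4 * q)"
    unfolding quartic_C_def by (rule bihomogeneous_mult[OF Y2 G]) simp_all
  have 1: "bihomogeneous (X * Y ^ 3) (4 * p) (4 * q)"
    by (rule bihomogeneous_mult[OF X bihomogeneous_power[OF Y refl refl]]) simp_all
  have 2: "bihomogeneous (Y * Z * (X\<^sup>2 + Z\<^sup>2)) (4 * p) (4 * q)"
    by (rule bihomogeneous_mult[OF bihomogeneous_mult[OF Y Z refl refl] G]) simp_all
  show "bihomogeneous (quartic_E X Y Z) (4 * p) (4 * q)"
    unfolding quartic_E_def by (rule bihomogeneous_add[OF 1 2 refl refl])
qed

lemma bihomogeneous_coords:
  "bihomogeneous X1 1 0" "bihomogeneous Y1 1 0" "bihomogeneous Z1 1 0"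
  "bihomogeneous X2 0 1" "bihomogeneous Y2 0 1" "bihomogeneous Z2 0 1"
  by (simp_all add: bihomogeneous_Inl bihomogeneous_Inr)

lemmas bihomogeneous_quartics1 = bihomogeneous_quartics[OF bihomogeneous_coords(1-3), simplified]
lemmas bihomogeneous_quartics2 = bihomogeneous_quartics[OF bihomogeneous_coords(4-6), simplified]
lemmas bihomogeneous_square1 = bihomogeneous_square_YZ[OF _ bihomogeneous_coords(1-3), simplified]
lemmas bihomogeneous_square2 = bihomogeneous_square_YZ[OF _ bihomogeneous_coords(4-6), simplified]

lemma bihomogeneous_4_4I:
  "bihomogeneous P 4 0 \<Longrightarrow> bihomogeneous Q 0 4 \<Longrightarrow> bihomogeneous (P * Q) 4 4"
  using bihomogeneous_mult[of P 4 0 Q 0 4 4 4] by simp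

lemma quartics_neg:
  "quartic_D x (- y) z = quartic_D x y z" "quartic_C x (- y) z = quartic_C x y z"
  "quartic_S x (- y) z = quartic_S x y z" "quartic_E x (- y) z = - quartic_E x y z"
  by (simp_all add: quartic_D_def quartic_C_def quartic_S_def quartic_E_def algebra_simps)

lemma form_D_invariant: "form_D \<in> invariant_forms 4"
  unfolding form_D_def
  by (rule invariant_formsI[OF bihomogeneous_4_4I])
     (simp_all add: bihomogeneous_quartics1 bihomogeneous_quartics2 quartics_neg)

lemma chart_form_invariant: "chart_form v \<in> invariant_forms 4"
proof -
  have 2: "bihomogeneous (2 * P) 4 4" if "bihomogeneous P 4 4" for P
    using bihomogeneous_mult[OF bihomogeneous_numeral that refl refl] by simp
  show ?thesis
    by (cases v; simp; rule invariant_formsI)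
       (auto intro!: 2 bihomogeneous_4_4I bihomogeneous_quartics1 bihomogeneous_quartics2
             simp: quartics_neg)
qed

definition chart_point :: "(coord + coord \<Rightarrow> complex) \<Rightarrow> chart \<Rightarrow> complex" where
  "chart_point c v = evalp (chart_form v) c / evalp form_D c"

text \<open>The arguments \<open>a\<close>, \<open>b\<close>, \<open>h\<close> of
  \<open>quartic_ratio\<close> are \<open>(1 + S) / 2\<close>, \<open>(1 - S) / 2\<close> and
  \<open>C / 2\<close>. In an even monomial both \<open>Y\<close> exponents have the same parity, so
  \<open>k1\<close> decides; if it is odd, the product of the two \<open>quartic_E\<close>
  contributes \<open>form_D\<close> times half of \<open>Om\<close>.\<close>

definition monomial_ratio :: "(coord + coord \<Rightarrow>\<^sub>0 nat) \<Rightarrow> chart qpoly" where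
  "monomial_ratio m =
     (let i1 = Poly_Mapping.lookup m (Inl CX); k1 = Poly_Mapping.lookup m (Inl CY);
          i2 = Poly_Mapping.lookup m (Inr CX); k2 = Poly_Mapping.lookup m (Inr CY);
          h = const_poly (1 / 2)
      in (if even k1 then 1 else h * var_poly Om) *
         quartic_ratio i1 k1 (h * (1 + var_poly S1)) (h * (1 - var_poly S1)) (h * var_poly C1) *
         quartic_ratio i2 k2 (h * (1 + var_poly S2)) (h * (1 - var_poly S2)) (h * var_poly C2))"

definition even_keys :: "(coord + coord) qpoly \<Rightarrow> (coord + coord \<Rightarrow>\<^sub>0 nat) set" where
  "even_keys P = {m \<in> Poly_Mapping.keys P.
     even (Poly_Mapping.lookup m (Inl CY) + Poly_Mapping.lookup m (Inr CY))}"

text \<open>The value 0 outside \<open>invariant_forms 4\<close> mirrors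
  \<open>quotient_map_coords\<close>, so that the formulas below hold at every index.\<close>

definition form_ratio :: "(coord + coord) qpoly \<Rightarrow> chart qpoly" where
  "form_ratio P = (if P \<in> invariant_forms 4 then
     (\<Sum>m\<in>even_keys P. const_poly (Poly_Mapping.lookup P m) * monomial_ratio m) else 0)"

lemma surface_cone_iff:
  "c \<in> surface_cone 1 0 \<longleftrightarrow>
     c \<circ> Inl \<noteq> (\<lambda>_. 0) \<and> c \<circ> Inr \<noteq> (\<lambda>_. 0) \<and>
     (c (Inl CY))\<^sup>2 * c (Inl CZ) = c (Inl CX) ^ 3 + c (Inl CX) * (c (Inl CZ))\<^sup>2 \<and>
     (c (Inr CY))\<^sup>2 * c (Inr CZ) = c (Inr CX) ^ 3 + c (Inr CX) * (c (Inr CZ))\<^sup>2"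
  by (auto simp: surface_cone_def curve_cone_def)

lemma coord_UNIV: "(UNIV :: coord set) = {CX, CY, CZ}"
  using coord.exhaust by blast

lemma coord_sum_UNIV:
  "(UNIV :: (coord + coord) set) = {Inl CX, Inl CY, Inl CZ, Inr CX, Inr CY, Inr CZ}"
  by (simp add: UNIV_sum coord_UNIV insert_commute)

lemma monomial_value_coords:
  "monomial_value m c =
     (c (Inl CX) ^ Poly_Mapping.lookup m (Inl CX) * c (Inl CY) ^ Poly_Mapping.lookup m (Inl CY) *
        c (Inl CZ) ^ Poly_Mapping.lookup m (Inl CZ)) *
     (c (Inr CX) ^ Poly_Mapping.lookup m (Inr CX) * c (Inr CY) ^ Poly_Mapping.lookup m (Inr CY) *
        c (Inr CZ) ^ Poly_Mapping.lookup m (Inr CZ))"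
proof -
  have "finite (UNIV :: (coord + coord) set)"
    by (simp only: coord_sum_UNIV finite.emptyI finite_insert)
  hence "monomial_value m c = (\<Prod>i\<in>UNIV. c i ^ Poly_Mapping.lookup m i)"
    by (rule monomial_value_superset[OF _ subset_UNIV])
  thus ?thesis by (simp add: coord_sum_UNIV mult.assoc)
qed

text \<open>Averaging over \<open>c\<close> and \<open>surface_neg c\<close> doubles the monomials
  of even total degree in the two \<open>Y\<close> coordinates and cancels the others.\<close>

lemma evalp_invariant_form:
  fixes c :: "coord + coord \<Rightarrow> complex"
  assumes "P \<in> invariant_forms d"
  shows "evalp P c = (\<Sum>m\<in>even_keys P. of_rat (Poly_Mapping.lookup P m) * monomial_value m c)"
proof -
  let ?k = "\<lambda>m. Poly_Mapping.lookup m (Inl CY) + Poly_Mapping.lookup m (Inr CY)"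
  have neg: "monomial_value m (surface_neg c) = (- 1) ^ ?k m * monomial_value m c" for m
  proof -
    have p: "(- y) ^ n = (- 1) ^ n * y ^ n" for y :: complex and n by (rule power_minus)
    show ?thesis
      unfolding monomial_value_coords surface_neg_simps p[of "c (Inl CY)"] p[of "c (Inr CY)"] power_add
      by (simp only: mult_ac)
  qed
  have "2 * evalp P c = evalp P c + evalp P (surface_neg c)"
    using assms by (simp add: invariant_forms_def)
  also have "\<dots> = (\<Sum>m\<in>Poly_Mapping.keys P. of_rat (Poly_Mapping.lookup P m) *
                    ((1 + (- 1) ^ ?k m) * monomial_value m c))"
    by (simp add: evalp_eq_monomial_sum neg sum.distrib algebra_simps)
  also have "\<dots> = (\<Sum>m\<in>even_keys P. of_rat (Poly_Mapping.lookup P m) * (2 * monomial_value m c))"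
    by (intro sum.mono_neutral_cong_right) (auto simp: even_keys_def)
  also have "\<dots> = 2 * (\<Sum>m\<in>even_keys P. of_rat (Poly_Mapping.lookup P m) * monomial_value m c)"
    by (simp add: sum_distrib_left mult_ac)
  finally show ?thesis by simp
qed

lemma invariant_form_degree:
  assumes "P \<in> invariant_forms d" "m \<in> even_keys P"
  shows "Poly_Mapping.lookup m (Inl CX) + Poly_Mapping.lookup m (Inl CY)
           + Poly_Mapping.lookup m (Inl CZ) = d"
    and "Poly_Mapping.lookup m (Inr CX) + Poly_Mapping.lookup m (Inr CY)
           + Poly_Mapping.lookup m (Inr CZ) = d"
    and "even (Poly_Mapping.lookup m (Inl CY)) \<longleftrightarrow> even (Poly_Mapping.lookup m (Inr CY))"
  using assms by (auto simp: even_keys_def invariant_forms_def)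

lemma chart_point_simps:
  assumes "evalp form_D c \<noteq> 0"
  shows "chart_point c C1 = quartic_C (c (Inl CX)) (c (Inl CY)) (c (Inl CZ)) / quartic_D (c (Inl CX)) (c (Inl CY)) (c (Inl CZ))"
    and "chart_point c S1 = quartic_S (c (Inl CX)) (c (Inl CY)) (c (Inl CZ)) / quartic_D (c (Inl CX)) (c (Inl CY)) (c (Inl CZ))"
    and "chart_point c C2 = quartic_C (c (Inr CX)) (c (Inr CY)) (c (Inr CZ)) / quartic_D (c (Inr CX)) (c (Inr CY)) (c (Inr CZ))"
    and "chart_point c S2 = quartic_S (c (Inr CX)) (c (Inr CY)) (c (Inr CZ)) / quartic_D (c (Inr CX)) (c (Inr CY)) (c (Inr CZ))"
    and "chart_point c Om = 2 * (quartic_E (c (Inl CX)) (c (Inl CY)) (c (Inl CZ)) / quartic_D (c (Inl CX)) (c (Inl CY)) (c (Inl CZ)))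
           * (quartic_E (c (Inr CX)) (c (Inr CY)) (c (Inr CZ)) / quartic_D (c (Inr CX)) (c (Inr CY)) (c (Inr CZ)))"
  using assms by (simp_all add: chart_point_def form_D_def)

lemma half_SC:
  fixes x y z :: complex
  assumes "quartic_D x y z \<noteq> 0"
  shows "1 / 2 * (1 + quartic_S x y z / quartic_D x y z) = y ^ 4 / quartic_D x y z"
    and "1 / 2 * (1 - quartic_S x y z / quartic_D x y z) = (x\<^sup>2 + z\<^sup>2)\<^sup>2 / quartic_D x y z"
    and "1 / 2 * (quartic_C x y z / quartic_D x y z) = y\<^sup>2 * (x\<^sup>2 + z\<^sup>2) / quartic_D x y z"
proof -
  have half: "1 / 2 * (2 * b / d) = b / d" for b d :: complex by simp
  have one_plus: "1 + a / quartic_D x y z = (quartic_D x y z + a) / quartic_D x y z"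
    and one_minus: "1 - a / quartic_D x y z = (quartic_D x y z - a) / quartic_D x y z" for a
    using assms by (simp_all add: add_divide_distrib diff_divide_distrib)
  have "quartic_D x y z + quartic_S x y z = 2 * y ^ 4"
    "quartic_D x y z - quartic_S x y z = 2 * (x\<^sup>2 + z\<^sup>2)\<^sup>2"
    "quartic_C x y z = 2 * (y\<^sup>2 * (x\<^sup>2 + z\<^sup>2))"
    by (simp_all add: quartic_D_def quartic_S_def quartic_C_def)
  thus "1 / 2 * (1 + quartic_S x y z / quartic_D x y z) = y ^ 4 / quartic_D x y z"
    and "1 / 2 * (1 - quartic_S x y z / quartic_D x y z) = (x\<^sup>2 + z\<^sup>2)\<^sup>2 / quartic_D x y z"
    and "1 / 2 * (quartic_C x y z / quartic_D x y z) = y\<^sup>2 * (x\<^sup>2 + z\<^sup>2) / quartic_D x y z"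
    by (simp_all only: one_plus one_minus half)
qed

lemma evalp_form_ratio:
  fixes c :: "coord + coord \<Rightarrow> complex"
  assumes P: "P \<in> invariant_forms 4" and c: "c \<in> surface_cone 1 0" and D: "evalp form_D c \<noteq> 0"
  shows "evalp P c = evalp form_D c * evalp (form_ratio P) (chart_point c)"
proof -
  have "monomial_value m c = evalp form_D c * evalp (monomial_ratio m) (chart_point c)"
    if m: "m \<in> even_keys P" for m
  proof -
    define x1 y1 z1 where x1: "x1 = c (Inl CX)" and y1: "y1 = c (Inl CY)" and z1: "z1 = c (Inl CZ)"
    define x2 y2 z2 where x2: "x2 = c (Inr CX)" and y2: "y2 = c (Inr CY)" and z2: "z2 = c (Inr CZ)"
    note xyz = x1[symmetric] y1[symmetric] z1[symmetric] x2[symmetric] y2[symmetric] z2[symmetric]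
    have D1: "quartic_D x1 y1 z1 \<noteq> 0" and D2: "quartic_D x2 y2 z2 \<noteq> 0"
      using D by (auto simp: form_D_def xyz)
    have cu1: "y1\<^sup>2 * z1 = x1 ^ 3 + x1 * z1\<^sup>2" and cu2: "y2\<^sup>2 * z2 = x2 ^ 3 + x2 * z2\<^sup>2"
      using c by (auto simp: surface_cone_iff xyz)
    note q1 = quartic_monomial[OF cu1 D1 invariant_form_degree(1)[OF P m] refl refl refl]
    note q2 = quartic_monomial[OF cu2 D2 invariant_form_degree(2)[OF P m] refl refl refl]
    have "quartic_E x1 y1 z1 * quartic_E x2 y2 z2 = quartic_D x1 y1 z1 * (quartic_D x2 y2 z2 *
         (1 / 2 * (2 * (quartic_E x1 y1 z1 / quartic_D x1 y1 z1) * (quartic_E x2 y2 z2 / quartic_D x2 y2 z2))))"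
      using D1 D2 by simp
    with invariant_form_degree(3)[OF P m] D1 D2 show ?thesis
      unfolding monomial_value_coords xyz q1 q2
      by (simp add: monomial_ratio_def Let_def of_rat_divide chart_point_simps[OF D] xyz half_SC
            form_D_def del: times_divide_eq_left times_divide_eq_right mult_numeral_1)
  qed
  thus ?thesis
    unfolding evalp_invariant_form[OF P] using P
    by (simp add: form_ratio_def evalp_sum sum_distrib_left mult.left_commute)
qed

lemma chart_point_relations:
  assumes c: "c \<in> surface_cone 1 0" and D: "evalp form_D c \<noteq> 0"
  shows "(chart_point c C1)\<^sup>2 + (chart_point c S1)\<^sup>2 = 1"
    and "(chart_point c C2)\<^sup>2 + (chart_point c S2)\<^sup>2 = 1"
    and "(chart_point c Om)\<^sup>2 = chart_point c C1 * chart_point c C2"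
proof -
  have circle: "(quartic_C x y z / quartic_D x y z)\<^sup>2 + (quartic_S x y z / quartic_D x y z)\<^sup>2 = 1"
    if "quartic_D x y z \<noteq> 0" for x y z :: complex
  proof -
    have "(quartic_C x y z)\<^sup>2 + (quartic_S x y z)\<^sup>2 = (quartic_D x y z)\<^sup>2"
      by (simp add: quartic_C_def quartic_S_def quartic_D_def power2_eq_square algebra_simps
            power4_eq_xxxx)
    thus ?thesis using that by (simp add: power_divide flip: add_divide_distrib)
  qed
  have E: "2 * (quartic_E x y z / quartic_D x y z)\<^sup>2 = quartic_C x y z / quartic_D x y z"
    if "quartic_D x y z \<noteq> 0" "y\<^sup>2 * z = x ^ 3 + x * z\<^sup>2" for x y z :: complex
  proof -
    have "2 * (quartic_E x y z)\<^sup>2 = quartic_C x y z * quartic_D x y z"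
      using that(2) unfolding quartic_C_def quartic_E_def quartic_D_def by Groebner_Basis.algebra
    thus ?thesis using that by (simp add: power_divide field_simps power2_eq_square)
  qed
  have sq: "(2 * e * e')\<^sup>2 = a * a'" if "2 * e\<^sup>2 = a" "2 * e'\<^sup>2 = a'" for a a' e e' :: complex
    using that by (auto simp: power_mult_distrib)
  have D12: "quartic_D (c (Inl CX)) (c (Inl CY)) (c (Inl CZ)) \<noteq> 0"
    "quartic_D (c (Inr CX)) (c (Inr CY)) (c (Inr CZ)) \<noteq> 0"
    using D by (auto simp: form_D_def)
  show "(chart_point c C1)\<^sup>2 + (chart_point c S1)\<^sup>2 = 1"
    and "(chart_point c C2)\<^sup>2 + (chart_point c S2)\<^sup>2 = 1"
    unfolding chart_point_simps[OF D] by (intro circle D12)+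
  show "(chart_point c Om)\<^sup>2 = chart_point c C1 * chart_point c C2"
    unfolding chart_point_simps[OF D]
    by (rule sq; rule E; use D12 c in \<open>auto simp: surface_cone_iff\<close>)
qed

section \<open>The ideal of the 2-torsion points in the chart\<close>

definition chart_circle :: "(chart \<Rightarrow> 'k::field_char_0) \<Rightarrow> bool" where
  "chart_circle x \<longleftrightarrow> (x C1)\<^sup>2 + (x S1)\<^sup>2 = 1 \<and> (x C2)\<^sup>2 + (x S2)\<^sup>2 = 1"

text \<open>Modulo \<open>C1\<close>, \<open>C2\<close> and \<open>Om\<close> the circle equations
  become \<open>S1^2 = S2^2 = 1\<close>, so that every polynomial has a remainder spanned by 1,
  \<open>S1\<close>, \<open>S2\<close> and \<open>S1 S2\<close>.\<close>

lemma chart_decomposition: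
  fixes R :: "chart qpoly"
  shows "\<exists>U V N r0 r1 r2 r3. \<forall>x::chart \<Rightarrow> complex. chart_circle x \<longrightarrow>
     evalp R x = x C1 * evalp U x + x C2 * evalp V x + x Om * evalp N x +
       (of_rat r0 + of_rat r1 * x S1 + of_rat r2 * x S2 + of_rat r3 * (x S1 * x S2))"
    (is "\<exists>U V N r0 r1 r2 r3. ?R R U V N r0 r1 r2 r3")
proof (induction R rule: qpoly_induct)
  case (const r)
  have "?R (const_poly r) 0 0 0 r 0 0 0" by simp
  then show ?case by blast
next
  case (var v)
  have "?R (var_poly C1) 1 0 0 0 0 0 0" "?R (var_poly C2) 0 1 0 0 0 0 0"
    "?R (var_poly Om) 0 0 1 0 0 0 0" "?R (var_poly S1) 0 0 0 0 1 0 0" "?R (var_poly S2) 0 0 0 0 0 1 0"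
    by simp_all
  then show ?case by (cases v) blast+
next
  case (add p q)
  then obtain U V N r0 r1 r2 r3 U' V' N' r0' r1' r2' r3' where
    "?R p U V N r0 r1 r2 r3" "?R q U' V' N' r0' r1' r2' r3'" by blast
  then have "?R (p + q) (U + U') (V + V') (N + N') (r0 + r0') (r1 + r1') (r2 + r2') (r3 + r3')"
    by (simp add: of_rat_add algebra_simps)
  then show ?case by blast
next
  case (mult p q)
  then obtain U V N r0 r1 r2 r3 U' V' N' s0 s1 s2 s3 where
    p: "?R p U V N r0 r1 r2 r3" and q: "?R q U' V' N' s0 s1 s2 s3" by blast
  define r where "r = const_poly r0 + const_poly r1 * var_poly S1 + const_poly r2 * var_poly S2
      + const_poly r3 * (var_poly S1 * var_poly S2)"
  \<comment> \<open>The product of the two remainders is reduced by \<open>S1^2 = 1 - C1^2\<close>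
    and \<open>S2^2 = 1 - C2^2\<close>; the subtracted terms in the first two witnesses collect what
    this produces, with \<open>S1^2 S2^2\<close> replaced by
    \<open>1 - C1^2 - C2^2 S1^2\<close>.\<close>
  have "?R (p * q)
      (U * q + r * U' - var_poly C1 * (const_poly (r1 * s1 + r3 * s3)
          + const_poly (r1 * s3 + r3 * s1) * var_poly S2))
      (V * q + r * V' - var_poly C2 * (const_poly (r2 * s2) + const_poly (r3 * s3) * (var_poly S1)\<^sup>2
          + const_poly (r2 * s3 + r3 * s2) * var_poly S1))
      (N * q + r * N')
      (r0 * s0 + r1 * s1 + r2 * s2 + r3 * s3)
      (r0 * s1 + r1 * s0 + (r2 * s3 + r3 * s2))
      (r0 * s2 + r2 * s0 + (r1 * s3 + r3 * s1))
      (r0 * s3 + r3 * s0 + r1 * s2 + r2 * s1)"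
  proof (intro allI impI)
    fix x :: "chart \<Rightarrow> complex"
    assume x: "chart_circle x"
    have 1: "(x C1)\<^sup>2 + (x S1)\<^sup>2 = 1" and 2: "(x C2)\<^sup>2 + (x S2)\<^sup>2 = 1"
      using x by (auto simp: chart_circle_def)
    have p': "evalp p x = x C1 * evalp U x + x C2 * evalp V x + x Om * evalp N x + evalp r x"
      using p x by (simp add: r_def)
    have q': "evalp q x = x C1 * evalp U' x + x C2 * evalp V' x + x Om * evalp N' x +
       (of_rat s0 + of_rat s1 * x S1 + of_rat s2 * x S2 + of_rat s3 * (x S1 * x S2))"
      using q x by simp
    have pq: "evalp p x * evalp q x = (x C1 * evalp U x + x C2 * evalp V x + x Om * evalp N x) * evalp q x
       + evalp r x * (x C1 * evalp U' x + x C2 * evalp V' x + x Om * evalp N' x)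
       + evalp r x * (of_rat s0 + of_rat s1 * x S1 + of_rat s2 * x S2 + of_rat s3 * (x S1 * x S2))"
      unfolding p' q' by (simp only: distrib_left distrib_right add_ac)
    have r: "evalp r x = of_rat r0 + of_rat r1 * x S1 + of_rat r2 * x S2 + of_rat r3 * (x S1 * x S2)"
      by (simp add: r_def)
    define a0 a1 a2 a3 b0 b1 b2 b3 where ab: "a0 = (of_rat r0 :: complex)" "a1 = (of_rat r1 :: complex)"
      "a2 = (of_rat r2 :: complex)" "a3 = (of_rat r3 :: complex)" "b0 = (of_rat s0 :: complex)"
      "b1 = (of_rat s1 :: complex)" "b2 = (of_rat s2 :: complex)" "b3 = (of_rat s3 :: complex)"
    have "(a0 + a1 * x S1 + a2 * x S2 + a3 * (x S1 * x S2)) * (b0 + b1 * x S1 + b2 * x S2 + b3 * (x S1 * x S2))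
      = - (x C1 * (x C1 * (a1 * b1 + a3 * b3 + (a1 * b3 + a3 * b1) * x S2)))
        - (x C2 * (x C2 * (a2 * b2 + a3 * b3 * (x S1)\<^sup>2 + (a2 * b3 + a3 * b2) * x S1)))
        + (a0 * b0 + a1 * b1 + a2 * b2 + a3 * b3 + (a0 * b1 + a1 * b0 + (a2 * b3 + a3 * b2)) * x S1
           + (a0 * b2 + a2 * b0 + (a1 * b3 + a3 * b1)) * x S2
           + (a0 * b3 + a3 * b0 + a1 * b2 + a2 * b1) * (x S1 * x S2))"
      using 1 2 by Groebner_Basis.algebra
    then show "evalp (p * q) x = x C1 * evalp (U * q + r * U' - var_poly C1 * (const_poly (r1 * s1 + r3 * s3)
          + const_poly (r1 * s3 + r3 * s1) * var_poly S2)) x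
       + x C2 * evalp (V * q + r * V' - var_poly C2 * (const_poly (r2 * s2) + const_poly (r3 * s3) * (var_poly S1)\<^sup>2
          + const_poly (r2 * s3 + r3 * s2) * var_poly S1)) x
       + x Om * evalp (N * q + r * N') x +
       (of_rat (r0 * s0 + r1 * s1 + r2 * s2 + r3 * s3)
        + of_rat (r0 * s1 + r1 * s0 + (r2 * s3 + r3 * s2)) * x S1
        + of_rat (r0 * s2 + r2 * s0 + (r1 * s3 + r3 * s1)) * x S2
        + of_rat (r0 * s3 + r3 * s0 + r1 * s2 + r2 * s1) * (x S1 * x S2))"
      using pq
      unfolding evalp_mult evalp_add evalp_diff evalp_const_poly evalp_var_poly evalp_power
        of_rat_add of_rat_mult r ab[symmetric]
      by (simp only: distrib_left right_diff_distrib mult_ac diff_conv_add_uminus add_ac)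
         (simp add: algebra_simps)
  qed
  then show ?case by blast
qed

abbreviation "kummer_base \<equiv> quotient_map_coords 4 ` surface_cone 1 0"
abbreviation "kummer_centre \<equiv> quotient_map_coords 4 ` two_torsion_cone 1 0"
abbreviation "kummer_vanishing \<equiv> vanishing_forms 1 kummer_centre"

lemma quotient_map_coords_chart:
  assumes "c \<in> surface_cone 1 0" "evalp form_D c \<noteq> 0"
  shows "quotient_map_coords 4 c = (\<lambda>P. evalp form_D c * evalp (form_ratio P) (chart_point c))"
  using evalp_form_ratio[OF _ assms]
  by (auto simp: quotient_map_coords_def form_ratio_def)

lemma evalp_linear_form:
  assumes "H \<in> hforms 1" and c: "c \<in> surface_cone 1 0" "evalp form_D c \<noteq> 0"
  shows "evalp H (quotient_map_coords 4 c)
           = evalp form_D c * evalp (substitute H form_ratio) (chart_point c)"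
  unfolding quotient_map_coords_chart[OF c] using evalp_scale_hforms[OF assms(1)] by simp

text \<open>The factors are \<open>[0 : 1 : 0]\<close> and \<open>[0 : 0 : 1]\<close>. The other two
  points of order 2 have \<open>y = 0\<close> and \<open>x^2 + z^2 = 0\<close>, where
  \<open>quartic_D\<close> vanishes; so just these four of the 16 points lie in the chart.\<close>

definition torsion_point :: "bool \<Rightarrow> bool \<Rightarrow> coord + coord \<Rightarrow> complex" where
  "torsion_point s t = case_sum (\<lambda>i. if i = (if s then CY else CZ) then 1 else 0)
                                (\<lambda>i. if i = (if t then CY else CZ) then 1 else 0)"

lemma torsion_point: "torsion_point s t \<in> two_torsion_cone 1 0"
proof -
  have 1: "same_point c (curve_neg c)" if "c = (\<lambda>i. if i = (if s then CY else CZ) then 1 else 0)"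
    for c :: "coord \<Rightarrow> complex" and s
    unfolding same_point_def that
    by (intro exI[of _ "if s then -1 else 1"] conjI ext) (auto simp: curve_neg_def)
  have 2: "(\<lambda>i. if i = (if s then CY else CZ) then 1 else 0) \<noteq> (\<lambda>_. 0 :: complex)" for s
    by (auto simp: fun_eq_iff)
  have 3: "torsion_point s t \<circ> Inl = (\<lambda>i. if i = (if s then CY else CZ) then 1 else 0)"
    "torsion_point s t \<circ> Inr = (\<lambda>i. if i = (if t then CY else CZ) then 1 else 0)"
    by (auto simp: torsion_point_def)
  have 4: "surface_neg c \<circ> Inl = curve_neg (c \<circ> Inl)" "surface_neg c \<circ> Inr = curve_neg (c \<circ> Inr)"
    for c :: "coord + coord \<Rightarrow> complex"
    by (auto simp: surface_neg_def)
  have "torsion_point s t \<in> surface_cone 1 0"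
    unfolding surface_cone_iff 3 using 2 by (auto simp: torsion_point_def)
  thus ?thesis
    unfolding two_torsion_cone_def 4 using 1[OF 3(1)] 1[OF 3(2)] by simp
qed

lemma two_torsion_subset: "two_torsion_cone a b \<subseteq> surface_cone a b"
  by (auto simp: two_torsion_cone_def)

definition linear_decomposition :: "(coord + coord) qpoly qpoly \<Rightarrow> (chart \<Rightarrow> chart qpoly) \<Rightarrow> bool" where
  "linear_decomposition H f \<longleftrightarrow> (\<forall>c\<in>surface_cone 1 0. evalp form_D c \<noteq> 0 \<longrightarrow>
    evalp H (quotient_map_coords 4 c) = evalp (chart_form C1) c * evalp (f C1) (chart_point c)
      + evalp (chart_form C2) c * evalp (f C2) (chart_point c)
      + evalp (chart_form Om) c * evalp (f Om) (chart_point c))"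

text \<open>At the four torsion points of the chart \<open>C1\<close>, \<open>C2\<close> and
  \<open>Om\<close> vanish and \<open>(S1, S2)\<close> runs through all pairs of signs. A form
  vanishing there has remainder 0, which means that \<open>C1\<close>, \<open>C2\<close> and
  \<open>Om\<close> generate the ideal of the centre in the chart.\<close>

lemma vanishing_decomposition:
  assumes H: "H \<in> kummer_vanishing"
  shows "\<exists>f. linear_decomposition H f"
proof -
  have hom: "H \<in> hforms 1" and van: "\<And>c::coord + coord \<Rightarrow> complex. c \<in> two_torsion_cone 1 0 \<Longrightarrow> evalp H (quotient_map_coords 4 c) = 0"
    using H by (auto simp: vanishing_forms_def)
  define R where "R = substitute H form_ratio"
  obtain U V N r0 r1 r2 r3 where dec: "\<And>x::chart \<Rightarrow> complex. chart_circle x \<Longrightarrow>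
     evalp R x = x C1 * evalp U x + x C2 * evalp V x + x Om * evalp N x +
       (of_rat r0 + of_rat r1 * x S1 + of_rat r2 * x S2 + of_rat r3 * (x S1 * x S2))"
    using chart_decomposition[of R] by blast
  have circ: "chart_circle (chart_point c)" if "c \<in> surface_cone 1 0" "evalp form_D c \<noteq> 0" for c
    using chart_point_relations[OF that] by (simp add: chart_circle_def)
  have at: "of_rat r0 + of_rat r1 * (if s then 1 else - 1) + of_rat r2 * (if t then 1 else - 1) +
        of_rat r3 * ((if s then 1 else - 1) * (if t then 1 else - 1)) = (0::complex)" for s t
  proof -
    let ?c = "torsion_point s t"
    have c: "?c \<in> surface_cone 1 0" using torsion_point two_torsion_subset by blast
    have D: "evalp form_D ?c = 1"
      by (auto simp: form_D_def quartic_D_def torsion_point_def)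
    hence D0: "evalp form_D ?c \<noteq> 0" by simp
    have ch: "chart_point ?c C1 = 0" "chart_point ?c C2 = 0" "chart_point ?c Om = 0"
      "chart_point ?c S1 = (if s then 1 else -1)" "chart_point ?c S2 = (if t then 1 else -1)"
      unfolding chart_point_def D
      by (auto simp: quartic_D_def quartic_C_def quartic_S_def quartic_E_def torsion_point_def)
    have "evalp R (chart_point ?c) = 0"
      using van[OF torsion_point] evalp_linear_form[OF hom c D0] D by (simp add: R_def)
    thus ?thesis using dec[OF circ[OF c D0]] ch by simp
  qed
  \<comment> \<open>This inverts the character table of the group of pairs of signs.\<close>
  have lin: "a = 0 \<and> b = 0 \<and> c = 0 \<and> d = 0"
    if "a + b + c + d = 0" "a + b - c - d = 0" "a - b + c - d = 0" "a - b - c + d = 0"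
    for a b c d :: complex
  proof -
    have "4 * a = 0" "4 * b = 0" "4 * c = 0" "4 * d = 0" using that by Groebner_Basis.algebra+
    thus ?thesis by simp
  qed
  have r: "(of_rat r0 :: complex) = 0 \<and> (of_rat r1 :: complex) = 0 \<and> (of_rat r2 :: complex) = 0 \<and>
    (of_rat r3 :: complex) = 0"
    by (rule lin) (use at[of True True] at[of True False] at[of False True] at[of False False] in simp_all)
  have "evalp H (quotient_map_coords 4 c) = evalp (chart_form C1) c * evalp U (chart_point c)
      + evalp (chart_form C2) c * evalp V (chart_point c)
      + evalp (chart_form Om) c * evalp N (chart_point c)"
    if c: "c \<in> surface_cone 1 0" "evalp form_D c \<noteq> 0" for c
  proof -
    have e: "evalp form_D c * chart_point c v = evalp (chart_form v) c" for v
      using c(2) by (simp add: chart_point_def)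
    have "evalp H (quotient_map_coords 4 c) = evalp form_D c * evalp R (chart_point c)"
      unfolding R_def by (rule evalp_linear_form[OF hom c])
    also have "evalp R (chart_point c) = chart_point c C1 * evalp U (chart_point c)
      + chart_point c C2 * evalp V (chart_point c) + chart_point c Om * evalp N (chart_point c)"
      using dec[OF circ[OF c]] r by simp
    also have "evalp form_D c * \<dots> = (evalp form_D c * chart_point c C1) * evalp U (chart_point c)
      + (evalp form_D c * chart_point c C2) * evalp V (chart_point c)
      + (evalp form_D c * chart_point c Om) * evalp N (chart_point c)"
      by (simp only: distrib_left mult.assoc)
    finally show ?thesis unfolding e .
  qed
  hence "linear_decomposition H (\<lambda>v. case v of C1 \<Rightarrow> U | C2 \<Rightarrow> V | _ \<Rightarrow> N)"
    by (simp add: linear_decomposition_def del: chart_form.simps)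
  thus ?thesis by (intro exI)
qed

text \<open>One decomposition is fixed for each form, valid at all points of the chart. The
  coefficients are rational polynomials, so they can be evaluated over \<open>'k\<close> as well as
  over the complex numbers.\<close>

definition linear_coeff :: "chart \<Rightarrow> (coord + coord) qpoly qpoly \<Rightarrow> chart qpoly" where
  "linear_coeff v H = (if H \<in> kummer_vanishing then (SOME f. linear_decomposition H f) v else 0)"

lemma evalp_vanishing_form:
  assumes "H \<in> kummer_vanishing" "c \<in> surface_cone 1 0" "evalp form_D c \<noteq> 0"
  shows "evalp H (quotient_map_coords 4 c) = evalp (chart_form C1) c * evalp (linear_coeff C1 H) (chart_point c)
      + evalp (chart_form C2) c * evalp (linear_coeff C2 H) (chart_point c)
      + evalp (chart_form Om) c * evalp (linear_coeff Om H) (chart_point c)"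
proof -
  have "linear_decomposition H (SOME f. linear_decomposition H f)"
    by (rule someI_ex[OF vanishing_decomposition[OF assms(1)]])
  moreover have "(SOME f. linear_decomposition H f) = (\<lambda>v. linear_coeff v H)"
    by (simp only: linear_coeff_def assms(1) if_True)
  ultimately have "linear_decomposition H (\<lambda>v. linear_coeff v H)" by simp
  from this[unfolded linear_decomposition_def, rule_format, OF assms(2,3)] show ?thesis .
qed

lemma linear_coeff_eq_0: "H \<notin> kummer_vanishing \<Longrightarrow> linear_coeff v H = 0"
  unfolding linear_coeff_def by (rule if_not_P)

text \<open>A point with \<open>P = -P\<close> has \<open>y = 0\<close> or \<open>x = z = 0\<close>,
  and either kills \<open>quartic_C\<close> and \<open>quartic_E\<close>. The three generators of
  the ideal are therefore themselves among the blow-up coordinates.\<close>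

lemma chart_form_vanishing:
  assumes "v \<in> {C1, C2, Om}"
  shows "var_poly (chart_form v) \<in> kummer_vanishing"
proof -
  have hom: "var_poly P \<in> hforms 1" for P :: "(coord + coord) qpoly"
    by (simp add: hforms_def var_poly_def)
  have tor: "quartic_C (c CX) (c CY) (c CZ) = 0" "quartic_E (c CX) (c CY) (c CZ) = 0"
    if same: "same_point c (curve_neg c)" for c :: "coord \<Rightarrow> complex"
  proof -
    obtain s where s: "\<And>i. curve_neg c i = s * c i" using same unfolding same_point_def by metis
    have X: "c CX = s * c CX" and Y: "- c CY = s * c CY" and Z: "c CZ = s * c CZ"
      using s[of CX] s[of CY] s[of CZ] by (simp_all add: curve_neg_def)
    have "c CY = 0 \<or> (c CX = 0 \<and> c CZ = 0)"
    proof (cases "c CY = 0")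
      case False
      then have "s = - 1" using Y by (metis mult_cancel_right mult_minus1)
      with X Z show ?thesis by (simp add: eq_neg_iff_add_eq_0)
    qed simp
    thus "quartic_C (c CX) (c CY) (c CZ) = 0" "quartic_E (c CX) (c CY) (c CZ) = 0"
      by (auto simp: quartic_C_def quartic_E_def)
  qed
  have "evalp (chart_form v) c = 0" if "c \<in> two_torsion_cone 1 0" for c :: "coord + coord \<Rightarrow> complex"
  proof -
    have "same_point (c \<circ> Inl) (curve_neg (c \<circ> Inl))" "same_point (c \<circ> Inr) (curve_neg (c \<circ> Inr))"
      using that by (auto simp: two_torsion_cone_def surface_neg_def comp_def)
    from tor[OF this(1)] tor[OF this(2)] show ?thesis using assms by auto
  qed
  thus ?thesis
    using hom by (auto simp: vanishing_forms_def quotient_map_coords_def chart_form_invariant)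
qed

section \<open>Points of the Kummer surface in the chart\<close>

type_synonym kummer_index = "(coord + coord) qpoly + (coord + coord) qpoly qpoly"

abbreviation "kummer_graph \<equiv> blowup_graph 1 kummer_base kummer_centre"

text \<open>A parametrisation of the cone over the chart: \<open>\<kappa>\<close> stands for the
  value of \<open>form_D\<close>, and \<open>a\<close>, \<open>b\<close>, \<open>g\<close> for the
  blow-up coordinates of \<open>C1\<close>, \<open>C2\<close>, \<open>Om\<close>. The scalings of
  \<open>\<kappa>\<close> and of \<open>(a, b, g)\<close> are the two independent scalings of a
  point in a product of projective spaces.\<close>

definition kummer_vec :: "'k \<Rightarrow> 'k \<Rightarrow> 'k \<Rightarrow> 'k \<Rightarrow> (chart \<Rightarrow> 'k) \<Rightarrow>
    kummer_index \<Rightarrow> 'k::field_char_0" where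
  "kummer_vec \<kappa> a b g x = case_sum (\<lambda>P. \<kappa> * evalp (form_ratio P) x)
     (\<lambda>H. a * evalp (linear_coeff C1 H) x + b * evalp (linear_coeff C2 H) x
          + g * evalp (linear_coeff Om H) x)"

lemma kummer_graphE:
  assumes "z \<in> kummer_graph"
  obtains c s where "c \<in> surface_cone 1 0" "s \<noteq> 0"
    "\<And>P. z (Inl P) = (if P \<in> invariant_forms 4 then evalp P c else 0)"
    "\<And>H. z (Inr H) = (if H \<in> kummer_vanishing then s * evalp H (quotient_map_coords 4 c) else 0)"
proof -
  obtain u s where z: "z = case_sum u (\<lambda>H. if H \<in> kummer_vanishing then s * evalp H u else 0)"
    and u: "u \<in> kummer_base" and s: "s \<noteq> 0"
    using assms unfolding blowup_graph_def by blast
  obtain c where c: "c \<in> surface_cone 1 0" "u = quotient_map_coords 4 c" using u by blast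
  show ?thesis
    by (rule that[of c s]) (simp_all add: c s z quotient_map_coords_def)
qed

section \<open>The chart contains every point over a field in which -1 is not a square\<close>

definition corner :: "bool \<Rightarrow> 'a::comm_ring_1 \<Rightarrow> 'a \<Rightarrow> 'a" where
  "corner t y z = (if t then y ^ 4 else z ^ 4)"

text \<open>Divided by the corner it becomes \<open>(x^2 + z^2) / y^2\<close> or
  \<open>x / z\<close>. These functions are chosen because the quotient of \<open>quartic_D\<close>
  by the corner is a power of one plus their square.\<close>

definition corner_coord :: "bool \<Rightarrow> 'a::comm_ring_1 \<Rightarrow> 'a \<Rightarrow> 'a \<Rightarrow> 'a" where
  "corner_coord t x y z = (if t then y\<^sup>2 * (x\<^sup>2 + z\<^sup>2) else x * z ^ 3)"

abbreviation corner_form :: "bool \<Rightarrow> bool \<Rightarrow> (coord + coord) qpoly" where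
  "corner_form t1 t2 \<equiv> corner t1 Y1 Z1 * corner t2 Y2 Z2"

lemma evalp_corner [simp]:
  "evalp (corner t P Q) c = corner t (evalp P c) (evalp Q c)"
  "evalp (corner_coord t P Q R) c = corner_coord t (evalp P c) (evalp Q c) (evalp R c)"
  by (simp_all add: corner_def corner_coord_def)

lemma corner_neg:
  "corner t (- y) z = corner t y z" "corner_coord t x (- y) z = corner_coord t x y z"
  by (simp_all add: corner_def corner_coord_def)

lemma bihomogeneous_corner:
  assumes X: "bihomogeneous X p q" and Y: "bihomogeneous Y p q" and Z: "bihomogeneous Z p q"
  shows "bihomogeneous (corner t Y Z) (4 * p) (4 * q)"
    and "bihomogeneous (corner_coord t X Y Z) (4 * p) (4 * q)"
proof -
  have "bihomogeneous (Y ^ 4) (4 * p) (4 * q)" "bihomogeneous (Z ^ 4) (4 * p) (4 * q)"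
    by (rule bihomogeneous_power[OF Y refl refl] bihomogeneous_power[OF Z refl refl])+
  thus "bihomogeneous (corner t Y Z) (4 * p) (4 * q)" by (simp add: corner_def)
  have G: "bihomogeneous (X\<^sup>2 + Z\<^sup>2) (2 * p) (2 * q)"
    by (rule bihomogeneous_add[OF bihomogeneous_power[OF X refl refl] bihomogeneous_power[OF Z refl refl]])
       simp_all
  have 1: "bihomogeneous (Y\<^sup>2 * (X\<^sup>2 + Z\<^sup>2)) (4 * p) (4 * q)"
    by (rule bihomogeneous_mult[OF bihomogeneous_power[OF Y refl refl] G]) simp_all
  have 2: "bihomogeneous (X * Z ^ 3) (4 * p) (4 * q)"
    by (rule bihomogeneous_mult[OF X bihomogeneous_power[OF Z refl refl]]) simp_all
  show "bihomogeneous (corner_coord t X Y Z) (4 * p) (4 * q)"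
    using 1 2 by (simp add: corner_coord_def)
qed

lemmas bihomogeneous_corner1 = bihomogeneous_corner[OF bihomogeneous_coords(1-3), simplified]
lemmas bihomogeneous_corner2 = bihomogeneous_corner[OF bihomogeneous_coords(4-6), simplified]

lemma quartic_D_corner:
  fixes x y z :: "'a::field_char_0"
  assumes "y\<^sup>2 * z = x ^ 3 + x * z\<^sup>2" "corner t y z \<noteq> 0"
  shows "quartic_D x y z / corner t y z
           = (1 + (corner_coord t x y z / corner t y z)\<^sup>2) ^ (if t then 1 else 3)"
proof (cases t)
  case True
  then have y: "y \<noteq> 0" using assms(2) by (auto simp: corner_def)
  show ?thesis using y True
    by (simp add: corner_def corner_coord_def quartic_D_def field_simps power2_eq_square power4_eq_xxxx)
next
  case False
  then have z: "z \<noteq> 0" using assms(2) by (auto simp: corner_def)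
  have e: "x * z ^ 3 / z ^ 4 = x / z" using z by (simp add: field_simps eval_nat_numeral)
  have D: "quartic_D x y z * z\<^sup>2 = (x\<^sup>2 + z\<^sup>2) ^ 3"
    using assms(1) unfolding quartic_D_def by Groebner_Basis.algebra
  have "quartic_D x y z / z ^ 4 = (quartic_D x y z * z\<^sup>2) / z ^ 6"
    using z by (simp add: field_simps eval_nat_numeral)
  also have "\<dots> = ((x\<^sup>2 + z\<^sup>2) / z\<^sup>2) ^ 3" unfolding D by (simp add: power_divide flip: power_mult)
  also have "(x\<^sup>2 + z\<^sup>2) / z\<^sup>2 = 1 + (x / z)\<^sup>2" using z by (simp add: power_divide add_divide_distrib)
  finally show ?thesis using False by (simp add: corner_def corner_coord_def e)
qed

text \<open>A nonzero coordinate forces a nonzero monomial coordinate, whose square is a combination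
  of products with corner forms by \<open>quartic_monomial_square\<close>. Each step is a polynomial
  relation on the graph and hence holds on the closure.\<close>

lemma corner_nonzero:
  fixes w :: "_ \<Rightarrow> 'k::field_char_0"
  assumes w: "w \<in> rat_closure kummer_graph" and nz: "w \<circ> Inl \<noteq> (\<lambda>_. 0)"
  shows "\<exists>t1 t2. w (Inl (corner_form t1 t2)) \<noteq> 0"
proof -
  obtain P where P: "w (Inl P) \<noteq> 0" using nz by (auto simp: fun_eq_iff)
  have inv: "P \<in> invariant_forms 4"
  proof (rule ccontr)
    assume P4: "P \<notin> invariant_forms 4"
    have "evalp (var_poly (Inl P)) w = 0"
    proof (rule rat_closure_relation[OF w])
      fix z assume "z \<in> kummer_graph"
      then obtain c where "\<And>P. z (Inl P) = (if P \<in> invariant_forms 4 then evalp P c else 0)"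
        by (rule kummer_graphE) (rule that)
      then show "evalp (var_poly (Inl P)) z = 0" using P4 by simp
    qed
    with P show False by simp
  qed
  let ?mono = "\<lambda>m. Poly_Mapping.single m 1 :: (coord + coord) qpoly"
  have mono_inv: "?mono m \<in> invariant_forms 4" if m: "m \<in> even_keys P" for m
  proof (rule invariant_formsI)
    show "bihomogeneous (?mono m) 4 4"
      using invariant_form_degree[OF inv m] by (simp add: bihomogeneous_def)
    fix c :: "coord + coord \<Rightarrow> complex"
    show "evalp (?mono m) (surface_neg c) = evalp (?mono m) c"
      using invariant_form_degree(3)[OF inv m]
      by (cases "even (Poly_Mapping.lookup m (Inl CY))")
         (simp_all add: monomial_value_coords power_minus_odd)
  qed
  have "evalp (var_poly (Inl P) - (\<Sum>m\<in>even_keys P. const_poly (Poly_Mapping.lookup P m) *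
          var_poly (Inl (?mono m)))) w = 0"
  proof (rule rat_closure_relation[OF w])
    fix z assume "z \<in> kummer_graph"
    then obtain c where "\<And>P. z (Inl P) = (if P \<in> invariant_forms 4 then evalp P c else 0)"
      by (rule kummer_graphE) (rule that)
    then show "evalp (var_poly (Inl P) - (\<Sum>m\<in>even_keys P. const_poly (Poly_Mapping.lookup P m) *
          var_poly (Inl (?mono m)))) z = 0"
      using inv mono_inv evalp_invariant_form[OF inv, of c] by (simp add: evalp_sum)
  qed
  hence "w (Inl P) = (\<Sum>m\<in>even_keys P. of_rat (Poly_Mapping.lookup P m) * w (Inl (?mono m)))"
    by (simp add: evalp_sum)
  with P obtain m where m: "m \<in> even_keys P" and wm: "w (Inl (?mono m)) \<noteq> 0"
    by (metis (no_types, lifting) mult_zero_right sum.neutral)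
  define i1 k1 i2 k2 where ik: "i1 = Poly_Mapping.lookup m (Inl CX)" "k1 = Poly_Mapping.lookup m (Inl CY)"
    "i2 = Poly_Mapping.lookup m (Inr CX)" "k2 = Poly_Mapping.lookup m (Inr CY)"
  have le: "i1 + k1 \<le> 4" "i2 + k2 \<le> 4"
    using invariant_form_degree(1,2)[OF inv m] by (auto simp: ik)
  define T1 where "T1 t = (if t then square_Y i1 k1 X1 Y1 Z1 else square_Z i1 k1 X1 Y1 Z1)" for t
  define T2 where "T2 t = (if t then square_Y i2 k2 X2 Y2 Z2 else square_Z i2 k2 X2 Y2 Z2)" for t
  have T_inv: "T1 t * T2 t' \<in> invariant_forms 4" for t t'
    unfolding T1_def T2_def
    by (rule invariant_formsI)
       (use le in \<open>auto intro!: bihomogeneous_4_4I bihomogeneous_square1 bihomogeneous_square2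
          simp: square_YZ_neg\<close>)
  have corner_inv: "corner_form t t' \<in> invariant_forms 4" for t t'
    by (rule invariant_formsI)
       (auto intro!: bihomogeneous_4_4I bihomogeneous_corner1 bihomogeneous_corner2 simp: corner_neg)
  let ?rhs = "\<lambda>t t'. var_poly (Inl (corner_form t t')) * var_poly (Inl (T1 t * T2 t'))
                :: kummer_index qpoly"
  let ?Q = "(var_poly (Inl (?mono m)))\<^sup>2 -
              (?rhs True True + ?rhs True False + ?rhs False True + ?rhs False False)"
  have "evalp ?Q w = 0"
  proof (rule rat_closure_relation[OF w])
    fix z assume "z \<in> kummer_graph"
    then obtain c where c: "c \<in> surface_cone 1 0"
      and z: "\<And>P. z (Inl P) = (if P \<in> invariant_forms 4 then evalp P c else 0)"
      by (rule kummer_graphE) (rule that)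
    have cu: "(c (Inl CY))\<^sup>2 * c (Inl CZ) = c (Inl CX) ^ 3 + c (Inl CX) * (c (Inl CZ))\<^sup>2"
       "(c (Inr CY))\<^sup>2 * c (Inr CZ) = c (Inr CX) ^ 3 + c (Inr CX) * (c (Inr CZ))\<^sup>2"
      using c by (auto simp: surface_cone_iff)
    note s1 = quartic_monomial_square[OF cu(1) invariant_form_degree(1)[OF inv m]]
    note s2 = quartic_monomial_square[OF cu(2) invariant_form_degree(2)[OF inv m]]
    have "(evalp (?mono m) c)\<^sup>2 =
        evalp (corner True Y1 Z1 * T1 True + corner False Y1 Z1 * T1 False) c *
        evalp (corner True Y2 Z2 * T2 True + corner False Y2 Z2 * T2 False) c"
      by (simp add: monomial_value_coords[of m c] power_mult_distrib[of "_ * _ * _" "_ * _ * _"] s1 s2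
          T1_def T2_def ik corner_def)
    then show "evalp ?Q z = 0"
      by (simp add: z T_inv corner_inv mono_inv[OF m]) (simp add: algebra_simps)
  qed
  hence "(w (Inl (?mono m)))\<^sup>2 = evalp (?rhs True True + ?rhs True False + ?rhs False True + ?rhs False False) w"
    by simp
  hence nz: "evalp (?rhs True True + ?rhs True False + ?rhs False True + ?rhs False False) w \<noteq> 0"
    using wm by auto
  show ?thesis
  proof (rule ccontr)
    assume "\<nexists>t1 t2. w (Inl (corner_form t1 t2)) \<noteq> 0"
    hence "w (Inl (corner_form t1 t2)) = 0" for t1 t2 by blast
    with nz show False by simp
  qed
qed

text \<open>Relative to a nonzero corner form, \<open>form_D\<close> is a product of powers of two
  expressions \<open>1 + f^2\<close>; this is where it matters that -1 is not a square.\<close>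

lemma form_D_nonzero:
  fixes w :: "_ \<Rightarrow> 'k::field_char_0"
  assumes w: "w \<in> rat_closure kummer_graph" and nz: "w \<circ> Inl \<noteq> (\<lambda>_. 0)"
    and nonsq: "\<And>k::'k. 1 + k\<^sup>2 \<noteq> 0"
  shows "w (Inl form_D) \<noteq> 0"
proof -
  obtain t1 t2 where d: "w (Inl (corner_form t1 t2)) \<noteq> 0" using corner_nonzero[OF w nz] by blast
  let ?f1 = "corner_coord t1 X1 Y1 Z1 * corner t2 Y2 Z2"
  let ?f2 = "corner t1 Y1 Z1 * corner_coord t2 X2 Y2 Z2"
  let ?n = "\<lambda>t. if t then 1 else 3 :: nat"
  let ?Q = "var_poly (Inl form_D) - (1 + (var_poly (Inl ?f1))\<^sup>2) ^ ?n t1 * (1 + (var_poly (Inl ?f2))\<^sup>2) ^ ?n t2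
     :: kummer_index qpoly"
  have inv: "?f1 \<in> invariant_forms 4" "?f2 \<in> invariant_forms 4" "corner_form t1 t2 \<in> invariant_forms 4"
    by (rule invariant_formsI;
        auto intro!: bihomogeneous_4_4I bihomogeneous_corner1 bihomogeneous_corner2 simp: corner_neg)+
  have "evalp ?Q (\<lambda>j. w j / w (Inl (corner_form t1 t2))) = 0"
  proof (rule rat_closure_affine_relation[OF w d])
    fix z assume zg: "z \<in> kummer_graph" and zd: "z (Inl (corner_form t1 t2)) \<noteq> 0"
    from zg obtain c where c: "c \<in> surface_cone 1 0"
      and z: "\<And>P. z (Inl P) = (if P \<in> invariant_forms 4 then evalp P c else 0)"
      by (rule kummer_graphE) (rule that)
    have cu: "(c (Inl CY))\<^sup>2 * c (Inl CZ) = c (Inl CX) ^ 3 + c (Inl CX) * (c (Inl CZ))\<^sup>2"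
       "(c (Inr CY))\<^sup>2 * c (Inr CZ) = c (Inr CX) ^ 3 + c (Inr CX) * (c (Inr CZ))\<^sup>2"
      using c by (auto simp: surface_cone_iff)
    have k0: "corner t1 (c (Inl CY)) (c (Inl CZ)) \<noteq> 0" "corner t2 (c (Inr CY)) (c (Inr CZ)) \<noteq> 0"
      using zd inv(3) by (auto simp: z)
    have e: "z (Inl form_D) / z (Inl (corner_form t1 t2)) =
         (quartic_D (c (Inl CX)) (c (Inl CY)) (c (Inl CZ)) / corner t1 (c (Inl CY)) (c (Inl CZ))) *
         (quartic_D (c (Inr CX)) (c (Inr CY)) (c (Inr CZ)) / corner t2 (c (Inr CY)) (c (Inr CZ)))"
      "z (Inl ?f1) / z (Inl (corner_form t1 t2)) =
         corner_coord t1 (c (Inl CX)) (c (Inl CY)) (c (Inl CZ)) / corner t1 (c (Inl CY)) (c (Inl CZ))"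
      "z (Inl ?f2) / z (Inl (corner_form t1 t2)) =
         corner_coord t2 (c (Inr CX)) (c (Inr CY)) (c (Inr CZ)) / corner t2 (c (Inr CY)) (c (Inr CZ))"
      using inv k0 by (simp_all add: z form_D_invariant) (simp add: form_D_def)
    show "evalp ?Q (\<lambda>j. z j / z (Inl (corner_form t1 t2))) = 0"
      unfolding evalp_diff evalp_mult evalp_power evalp_add evalp_one evalp_var_poly e
        quartic_D_corner[OF cu(1) k0(1)] quartic_D_corner[OF cu(2) k0(2)] by simp
  qed
  hence "w (Inl form_D) / w (Inl (corner_form t1 t2)) =
     (1 + (w (Inl ?f1) / w (Inl (corner_form t1 t2)))\<^sup>2) ^ ?n t1 *
     (1 + (w (Inl ?f2) / w (Inl (corner_form t1 t2)))\<^sup>2) ^ ?n t2"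
    by simp
  also have "\<dots> \<noteq> 0" using nonsq by simp
  finally show ?thesis by auto
qed

text \<open>The conditions on \<open>(a, b, g)\<close> say that \<open>(C\<^sub>1, C\<^sub>2, \<Omega>)\<close> is a multiple of this nonzero vector
  on the cone \<open>a b = g\<^sup>2\<close>.\<close>

definition kummer_chart :: "'k \<Rightarrow> 'k \<Rightarrow> 'k \<Rightarrow> (chart \<Rightarrow> 'k::field_char_0) \<Rightarrow> bool" where
  "kummer_chart a b g x \<longleftrightarrow> chart_circle x \<and> (x Om)\<^sup>2 = x C1 * x C2 \<and> (a, b, g) \<noteq> (0, 0, 0) \<and>
     a * b = g\<^sup>2 \<and> a * x C2 = b * x C1 \<and> a * x Om = g * x C1 \<and> b * x Om = g * x C2"

text \<open>On the graph every coordinate is a fixed rational polynomial in the chart forms and the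
  three generators, relative to \<open>form_D\<close>. These relations persist on the closure, and
  so do the equations that make up \<open>kummer_chart\<close>.\<close>

lemma kummer_cone_chart:
  fixes w :: "_ \<Rightarrow> 'k::field_char_0"
  assumes w: "w \<in> kummer_cone 1 0" and nonsq: "\<And>k::'k. 1 + k\<^sup>2 \<noteq> 0"
  obtains \<kappa> a b g x where "\<kappa> \<noteq> 0" "kummer_chart a b g x" "w = kummer_vec \<kappa> a b g x"
proof -
  have wc: "w \<in> rat_closure kummer_graph" and w1: "w \<circ> Inl \<noteq> (\<lambda>_. 0)" and w2: "w \<circ> Inr \<noteq> (\<lambda>_. 0)"
    using w by (auto simp: kummer_cone_def blowup_cone_def)
  define d where "d = w (Inl form_D)"
  have d: "d \<noteq> 0" unfolding d_def by (rule form_D_nonzero[OF wc w1 nonsq])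
  define x where "x v = w (Inl (chart_form v)) / d" for v
  define f where "f v = w (Inr (var_poly (chart_form v)))" for v
  let ?N = "\<lambda>v. var_poly (Inl (chart_form v)) :: kummer_index qpoly"
  let ?F = "\<lambda>v. var_poly (Inr (var_poly (chart_form v))) :: kummer_index qpoly"
  \<comment> \<open>A transfer principle for all relations below. Both kinds of coordinates are
    divided by the same number, the value of \<open>form_D\<close>, so that at a graph point the
    blow-up coordinates of the generators become \<open>s\<close> times their chart values.\<close>
  have rel: "evalp Q (\<lambda>j. w j / d) = 0"
    if Q: "\<And>z c s. z \<in> kummer_graph \<Longrightarrow> c \<in> surface_cone 1 0 \<Longrightarrow> s \<noteq> 0 \<Longrightarrow> evalp form_D c \<noteq> 0 \<Longrightarrow>
        z (Inl form_D) = evalp form_D c \<Longrightarrow>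
        (\<And>P. z (Inl P) = (if P \<in> invariant_forms 4 then evalp P c else 0)) \<Longrightarrow>
        (\<And>H. z (Inr H) = (if H \<in> kummer_vanishing then s * evalp H (quotient_map_coords 4 c) else 0)) \<Longrightarrow>
        (\<And>v. z (Inl (chart_form v)) / evalp form_D c = chart_point c v) \<Longrightarrow>
        (\<And>v. v \<in> {C1, C2, Om} \<Longrightarrow> z (Inr (var_poly (chart_form v))) / evalp form_D c = s * chart_point c v) \<Longrightarrow>
        evalp Q (\<lambda>j. z j / evalp form_D c) = 0" for Q
    unfolding d_def
  proof (rule rat_closure_affine_relation[OF wc])
    show "w (Inl form_D) \<noteq> 0" using d by (simp add: d_def)
    fix z assume zg: "z \<in> kummer_graph" and zd: "z (Inl form_D) \<noteq> 0"
    from zg obtain c s where c: "c \<in> surface_cone 1 0" "s \<noteq> 0"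
      and z: "\<And>P. z (Inl P) = (if P \<in> invariant_forms 4 then evalp P c else 0)"
      and z': "\<And>H. z (Inr H) = (if H \<in> kummer_vanishing then s * evalp H (quotient_map_coords 4 c) else 0)"
      by (rule kummer_graphE) (rule that)
    have D: "z (Inl form_D) = evalp form_D c" by (simp add: z form_D_invariant)
    have D0: "evalp form_D c \<noteq> 0" using zd D by simp
    have 1: "z (Inl (chart_form v)) / evalp form_D c = chart_point c v" for v
      by (simp add: z chart_form_invariant chart_point_def)
    have 2: "z (Inr (var_poly (chart_form v))) / evalp form_D c = s * chart_point c v"
      if "v \<in> {C1, C2, Om}" for v
      using chart_form_vanishing[OF that]
      by (simp add: z' chart_form_invariant chart_point_def quotient_map_coords_def)
    show "evalp Q (\<lambda>j. z j / z (Inl form_D)) = 0"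
      unfolding D by (rule Q[OF zg c D0 D z z' 1 2])
  qed
  have wP: "w (Inl P) = d * evalp (form_ratio P) x" for P
  proof -
    have "evalp (var_poly (Inl P) - substitute (form_ratio P) ?N) (\<lambda>j. w j / d) = 0"
    proof (rule rel)
      fix z :: "kummer_index \<Rightarrow> complex" and c :: "coord + coord \<Rightarrow> complex" and s
      assume c: "c \<in> surface_cone 1 0" "evalp form_D c \<noteq> 0"
        and z: "\<And>P. z (Inl P) = (if P \<in> invariant_forms 4 then evalp P c else 0)"
        and ch: "\<And>v. z (Inl (chart_form v)) / evalp form_D c = chart_point c v"
      show "evalp (var_poly (Inl P) - substitute (form_ratio P) ?N) (\<lambda>j. z j / evalp form_D c) = 0"
      proof (cases "P \<in> invariant_forms 4")
        case True
        then show ?thesis using evalp_form_ratio[OF True c] c(2) by (simp add: ch) (simp add: z)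
      next
        case False
        then show ?thesis by (simp add: z form_ratio_def)
      qed
    qed
    hence "w (Inl P) / d = evalp (form_ratio P) x" by (simp add: x_def[abs_def])
    thus ?thesis using d by (simp add: field_simps)
  qed
  have wH: "w (Inr H) = f C1 * evalp (linear_coeff C1 H) x + f C2 * evalp (linear_coeff C2 H) x
       + f Om * evalp (linear_coeff Om H) x" for H
  proof -
    let ?Q = "var_poly (Inr H) - (?F C1 * substitute (linear_coeff C1 H) ?N
       + ?F C2 * substitute (linear_coeff C2 H) ?N + ?F Om * substitute (linear_coeff Om H) ?N)"
    have "evalp ?Q (\<lambda>j. w j / d) = 0"
    proof (rule rel)
      fix z :: "kummer_index \<Rightarrow> complex" and c :: "coord + coord \<Rightarrow> complex" and s
      assume c: "c \<in> surface_cone 1 0" "evalp form_D c \<noteq> 0"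
        and z: "\<And>H. z (Inr H) = (if H \<in> kummer_vanishing then s * evalp H (quotient_map_coords 4 c) else 0)"
        and ch: "\<And>v. z (Inl (chart_form v)) / evalp form_D c = chart_point c v"
        "\<And>v. v \<in> {C1, C2, Om} \<Longrightarrow> z (Inr (var_poly (chart_form v))) / evalp form_D c = s * chart_point c v"
      show "evalp ?Q (\<lambda>j. z j / evalp form_D c) = 0"
      proof (cases "H \<in> kummer_vanishing")
        case True
        then have "z (Inr H) / evalp form_D c = s * chart_point c C1 * evalp (linear_coeff C1 H) (chart_point c)
           + s * chart_point c C2 * evalp (linear_coeff C2 H) (chart_point c)
           + s * chart_point c Om * evalp (linear_coeff Om H) (chart_point c)"
          using evalp_vanishing_form[OF True c]
          by (simp add: z chart_point_def add_divide_distrib distrib_left mult.assoc del: chart_form.simps)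
        then show ?thesis by (simp add: ch del: chart_form.simps)
      next
        case False
        then show ?thesis using linear_coeff_eq_0[OF False] by (simp add: z)
      qed
    qed
    hence "w (Inr H) / d = (f C1 / d) * evalp (linear_coeff C1 H) x + (f C2 / d) * evalp (linear_coeff C2 H) x
       + (f Om / d) * evalp (linear_coeff Om H) x"
      by (simp add: x_def[abs_def] f_def del: chart_form.simps)
    also have "\<dots> = (f C1 * evalp (linear_coeff C1 H) x + f C2 * evalp (linear_coeff C2 H) x
       + f Om * evalp (linear_coeff Om H) x) / d" by (simp add: add_divide_distrib)
    finally show ?thesis using d by simp
  qed
  have vec: "w = kummer_vec d (f C1) (f C2) (f Om) x"
    unfolding kummer_vec_def by (rule ext) (simp split: sum.split add: wP wH)
  have "f C1 \<noteq> 0 \<or> f C2 \<noteq> 0 \<or> f Om \<noteq> 0"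
    using w2 wH by (auto simp: fun_eq_iff)
  moreover have "evalp ((?N C1)\<^sup>2 + (?N S1)\<^sup>2 - 1) (\<lambda>j. w j / d) = 0"
    "evalp ((?N C2)\<^sup>2 + (?N S2)\<^sup>2 - 1) (\<lambda>j. w j / d) = 0"
    "evalp ((?N Om)\<^sup>2 - ?N C1 * ?N C2) (\<lambda>j. w j / d) = 0"
    by (rule rel; use chart_point_relations in \<open>simp del: chart_form.simps\<close>)+
  moreover have "evalp (?F C1 * ?F C2 - (?F Om)\<^sup>2) (\<lambda>j. w j / d) = 0"
    by (rule rel; use chart_point_relations(3) in \<open>simp add: power_mult_distrib power2_eq_square del: chart_form.simps\<close>)
  moreover have "evalp (?F C1 * ?N C2 - ?F C2 * ?N C1) (\<lambda>j. w j / d) = 0"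
     "evalp (?F C1 * ?N Om - ?F Om * ?N C1) (\<lambda>j. w j / d) = 0"
     "evalp (?F C2 * ?N Om - ?F Om * ?N C2) (\<lambda>j. w j / d) = 0"
    by (rule rel; simp del: chart_form.simps)+
  ultimately have "kummer_chart (f C1) (f C2) (f Om) x"
    using d by (simp add: kummer_chart_def chart_circle_def x_def f_def power_divide power2_eq_square del: chart_form.simps)
  from that[OF d this vec] show ?thesis .
qed

text \<open>The inverse of the chart on one factor: \<open>y = l\<close>, \<open>x / y = E\<close>
  and \<open>z / x = C / (1 + S)\<close>. The free scale \<open>l\<close> enters
  \<open>quartic_D\<close> by its fourth power, which allows any prescribed value of
  \<open>form_D\<close>.\<close>

lemma scaled_curve_point:
  fixes C S E l D :: complex
  assumes E: "2 * E\<^sup>2 = C" and cs: "C\<^sup>2 + S\<^sup>2 = 1" and S: "1 + S \<noteq> 0"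
    and D: "D = 2 * l ^ 4 / (1 + S)" and z: "z = l * E * C / (1 + S)"
  shows "l\<^sup>2 * z = (l * E) ^ 3 + (l * E) * z\<^sup>2"
    and "quartic_D (l * E) l z = D" and "quartic_C (l * E) l z = D * C"
    and "quartic_S (l * E) l z = D * S" and "quartic_E (l * E) l z = D * E"
proof -
  define r where "r = 1 / (1 + S)"
  have r: "r * (1 + S) = 1" using S by (simp add: r_def)
  have D': "D = 2 * l ^ 4 * r" and z': "z = l * E * C * r"
    by (simp_all add: D z r_def)
  have q: "1 + C\<^sup>2 * r\<^sup>2 = 2 * r"
  proof -
    have "C\<^sup>2 = (1 - S) * (1 + S)" using cs by (simp add: algebra_simps power2_eq_square)
    hence "C\<^sup>2 * r\<^sup>2 = (1 - S) * r * (r * (1 + S))" by (simp add: power2_eq_square mult_ac)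
    hence "C\<^sup>2 * r\<^sup>2 = (1 - S) * r" by (simp only: r mult_1_right)
    hence "1 + C\<^sup>2 * r\<^sup>2 = r * (1 + S) + (1 - S) * r" by (simp only: r)
    thus ?thesis by (simp add: algebra_simps)
  qed
  have G: "(l * E)\<^sup>2 + z\<^sup>2 = l\<^sup>2 * C * r"
  proof -
    have "(l * E)\<^sup>2 + z\<^sup>2 = l\<^sup>2 * E\<^sup>2 * (1 + C\<^sup>2 * r\<^sup>2)"
      unfolding z' by (simp add: power_mult_distrib distrib_left mult_ac)
    also have "\<dots> = l\<^sup>2 * (2 * E\<^sup>2) * r" unfolding q by simp
    finally show ?thesis unfolding E .
  qed
  have "(l * E) ^ 3 + (l * E) * z\<^sup>2 = l * E * ((l * E)\<^sup>2 + z\<^sup>2)"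
    by (simp add: power3_eq_cube power2_eq_square algebra_simps)
  also have "\<dots> = l * E * (l\<^sup>2 * C * r)" unfolding G ..
  also have "\<dots> = l\<^sup>2 * z" unfolding z' by (simp add: power2_eq_square mult_ac)
  finally show "l\<^sup>2 * z = (l * E) ^ 3 + (l * E) * z\<^sup>2" ..
  have "quartic_D (l * E) l z = l ^ 4 * (1 + C\<^sup>2 * r\<^sup>2)"
    unfolding quartic_D_def G by (simp add: power_mult_distrib distrib_left mult_ac flip: power_mult)
  thus "quartic_D (l * E) l z = D" unfolding q D' by simp
  show "quartic_C (l * E) l z = D * C"
    unfolding quartic_C_def G D' by (simp add: power2_eq_square power4_eq_xxxx mult_ac)
  have "quartic_S (l * E) l z = l ^ 4 * (2 - (1 + C\<^sup>2 * r\<^sup>2))"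
    unfolding quartic_S_def G by (simp add: power_mult_distrib right_diff_distrib mult_ac flip: power_mult)
  also have "2 - (1 + C\<^sup>2 * r\<^sup>2) = 2 * (r * S)"
    using arg_cong[OF r, of "\<lambda>u. 2 * u"] unfolding q by (simp add: algebra_simps)
  finally show "quartic_S (l * E) l z = D * S" unfolding D' by (simp add: mult_ac)
  have "quartic_E (l * E) l z = (l * E) * l ^ 3 + l * z * (l\<^sup>2 * C * r)"
    unfolding quartic_E_def G ..
  also have "\<dots> = l ^ 4 * E * (1 + C\<^sup>2 * r\<^sup>2)"
    unfolding z' by (simp add: power2_eq_square power3_eq_cube power4_eq_xxxx distrib_left mult_ac)
  finally show "quartic_E (l * E) l z = D * E" unfolding q D' by (simp add: mult_ac)
qed

text \<open>The two points of the elliptic curve need not be rational, only the vector does. As the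
  closure is tested by rational polynomials, it is enough that the vector is the coordinate vector
  of some complex point of the graph.\<close>

lemma kummer_vec_rational:
  fixes x :: "chart \<Rightarrow> rat"
  assumes circ: "chart_circle x" and Om: "(x Om)\<^sup>2 = x C1 * x C2" and Om0: "x Om \<noteq> 0"
    and \<kappa>: "\<kappa> \<noteq> 0" and t: "t \<noteq> 0"
  shows "kummer_vec \<kappa> (t * x C1) (t * x C2) (t * x Om) x \<in> kummer_cone 1 0"
proof -
  let ?w = "kummer_vec \<kappa> (t * x C1) (t * x C2) (t * x Om) x"
  define X where "X v = complex_of_rat (x v)" for v
  have cs1: "(X C1)\<^sup>2 + (X S1)\<^sup>2 = 1" and cs2: "(X C2)\<^sup>2 + (X S2)\<^sup>2 = 1"
    using circ unfolding X_def chart_circle_def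
    by (metis of_rat_1 of_rat_add of_rat_power)+
  have OmX: "(X Om)\<^sup>2 = X C1 * X C2" unfolding X_def using Om by (metis of_rat_mult of_rat_power)
  have Om0X: "X Om \<noteq> 0" using Om0 by (simp add: X_def)
  hence C0: "X C1 \<noteq> 0" "X C2 \<noteq> 0" using OmX by auto
  have S0: "1 + X S1 \<noteq> 0" "1 + X S2 \<noteq> 0"
    using C0 cs1 cs2 by (auto simp: add_eq_0_iff)
  define E1 where "E1 = csqrt (X C1 / 2)"
  have E1: "2 * E1\<^sup>2 = X C1" by (simp add: E1_def)
  hence E10: "E1 \<noteq> 0" using C0 by auto
  \<comment> \<open>Either root will do for \<open>E1\<close>; the sign of \<open>E2\<close> is then
    dictated by \<open>Om\<close>.\<close>
  define E2 where "E2 = X Om / (2 * E1)"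
  have E12: "2 * E1 * E2 = X Om" using E10 by (simp add: E2_def)
  have "X C1 * (2 * E2\<^sup>2) = X C1 * X C2"
  proof -
    have "X C1 * (2 * E2\<^sup>2) = (2 * E1 * E2)\<^sup>2"
      unfolding E1[symmetric] by (simp add: power_mult_distrib)
    thus ?thesis unfolding E12 OmX .
  qed
  hence E2: "2 * E2\<^sup>2 = X C2" using C0 by simp
  \<comment> \<open>The two values of \<open>quartic_D\<close> are \<open>2 l^4 / (1 + S1)\<close>
    and \<open>2 / (1 + S2)\<close>; this \<open>l\<close> makes their product
    \<open>\<kappa>\<close>.\<close>
  define l where "l = csqrt (csqrt (of_rat \<kappa> * (1 + X S1) * (1 + X S2) / 4))"
  have l4: "l ^ 4 = of_rat \<kappa> * (1 + X S1) * (1 + X S2) / 4"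
  proof -
    have "l ^ 4 = (l\<^sup>2)\<^sup>2" by simp
    thus ?thesis by (simp add: l_def)
  qed
  have l0: "l \<noteq> 0" using l4 \<kappa> S0 by auto
  define c where "c = case_sum
     (\<lambda>i. case i of CX \<Rightarrow> l * E1 | CY \<Rightarrow> l | CZ \<Rightarrow> l * E1 * X C1 / (1 + X S1))
     (\<lambda>i. case i of CX \<Rightarrow> 1 * E2 | CY \<Rightarrow> 1 | CZ \<Rightarrow> 1 * E2 * X C2 / (1 + X S2))"
  note p1 = scaled_curve_point[OF E1 cs1 S0(1) refl refl, of l]
  note p2 = scaled_curve_point[OF E2 cs2 S0(2) refl refl, of 1]
  have c: "c \<in> surface_cone 1 0"
    unfolding surface_cone_iff
  proof (intro conjI)
    show "c \<circ> Inl \<noteq> (\<lambda>_. 0)"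
    proof
      assume "c \<circ> Inl = (\<lambda>_. 0)"
      from fun_cong[OF this, of CY] l0 show False by (simp add: c_def)
    qed
    show "c \<circ> Inr \<noteq> (\<lambda>_. 0)"
    proof
      assume "c \<circ> Inr = (\<lambda>_. 0)"
      from fun_cong[OF this, of CY] show False by (simp add: c_def)
    qed
  qed (use p1(1) p2(1) in \<open>simp_all add: c_def\<close>)
  have c_simps: "c (Inl CX) = l * E1" "c (Inl CY) = l" "c (Inl CZ) = l * E1 * X C1 / (1 + X S1)"
    "c (Inr CX) = 1 * E2" "c (Inr CY) = 1" "c (Inr CZ) = 1 * E2 * X C2 / (1 + X S2)"
    by (simp_all add: c_def)
  have gen: "2 * (k * a * b / 4) / a * (2 * 1 ^ 4 / b) = k" if "a \<noteq> 0" "b \<noteq> 0" for a b k :: complex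
    using that by simp
  have D: "evalp form_D c = of_rat \<kappa>"
    unfolding form_D_def evalp_mult evalp_quartics evalp_var_poly c_simps p1(2) p2(2)
    unfolding l4 by (rule gen[OF S0])
  have D0: "evalp form_D c \<noteq> 0" using D \<kappa> by simp
  have D12: "quartic_D (c (Inl CX)) (c (Inl CY)) (c (Inl CZ)) \<noteq> 0"
    "quartic_D (c (Inr CX)) (c (Inr CY)) (c (Inr CZ)) \<noteq> 0"
    using D0 by (auto simp: form_D_def)
  have ch: "chart_point c = X"
  proof
    fix v
    have f: "D * a / D = a" if "D \<noteq> 0" for D a :: complex using that by simp
    have g: "2 * (D * a / D) * (D' * b / D') = 2 * a * b" if "D \<noteq> 0" "D' \<noteq> 0" for D D' a b :: complex
      using that by simp
    note nz = D12[unfolded c_simps p1(2) p2(2)]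
    show "chart_point c v = X v"
      by (cases v; simp only: chart_point_simps[OF D0] c_simps p1(2-5) p2(2-5) f[OF nz(1)] f[OF nz(2)]
            g[OF nz] E12)
  qed
  have cf: "evalp (chart_form v) c = of_rat \<kappa> * X v" for v
    using fun_cong[OF ch, of v] D0 by (simp add: chart_point_def D field_simps del: chart_form.simps)
  \<comment> \<open>The generators have values \<open>\<kappa> * X v\<close> at \<open>c\<close>, so
    this factor turns them into \<open>t * X v\<close>.\<close>
  define s where "s = complex_of_rat (t / \<kappa>)"
  have s0: "s \<noteq> 0" using t \<kappa> by (simp add: s_def)
  have evX: "evalp R X = of_rat (evalp R x)" for R
    unfolding X_def by (rule evalp_of_rat)
  let ?u = "quotient_map_coords 4 c"
  have u: "?u \<notin> kummer_centre"
  proof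
    assume "?u \<in> kummer_centre"
    hence "evalp (var_poly (chart_form Om)) ?u = 0"
      using chart_form_vanishing[of Om] unfolding vanishing_forms_def by blast
    thus False using cf[of Om] Om0X \<kappa>
      by (simp add: quotient_map_coords_def chart_form_invariant del: chart_form.simps)
  qed
  have "(\<lambda>j. of_rat (?w j)) = case_sum ?u (\<lambda>H. if H \<in> kummer_vanishing then s * evalp H ?u else 0)"
  proof
    fix j
    show "of_rat (?w j) = case_sum ?u (\<lambda>H. if H \<in> kummer_vanishing then s * evalp H ?u else 0) j"
    proof (cases j)
      case (Inl P)
      then show ?thesis
        by (simp add: kummer_vec_def quotient_map_coords_chart[OF c D0] D ch evX of_rat_mult)
    next
      case (Inr H)
      have "evalp H ?u = of_rat \<kappa> * X C1 * evalp (linear_coeff C1 H) X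
          + of_rat \<kappa> * X C2 * evalp (linear_coeff C2 H) X + of_rat \<kappa> * X Om * evalp (linear_coeff Om H) X"
        if H: "H \<in> kummer_vanishing"
        using evalp_vanishing_form[OF H c D0] unfolding ch cf .
      moreover have "linear_coeff v H = 0" if "H \<notin> kummer_vanishing" for v
        by (rule linear_coeff_eq_0[OF that])
      ultimately show ?thesis
        using Inr \<kappa> by (simp add: kummer_vec_def evX s_def of_rat_add of_rat_mult of_rat_divide
            X_def[symmetric] distrib_left)
    qed
  qed
  hence graph: "(\<lambda>j. of_rat (?w j)) \<in> kummer_graph"
    unfolding blowup_graph_def using u c s0 by blast
  have closure: "?w \<in> rat_closure kummer_graph"
    unfolding rat_closure_def
  proof safe
    fix P :: "kummer_index qpoly"
    assume "\<forall>z\<in>kummer_graph. evalp P z = 0"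
    hence "complex_of_rat (evalp P ?w) = 0" using graph by (simp flip: evalp_of_rat)
    thus "evalp P ?w = 0" by simp
  qed
  have "complex_of_rat (?w (Inl form_D)) \<noteq> 0"
    using fun_cong[OF \<open>(\<lambda>j. of_rat (?w j)) = _\<close>, of "Inl form_D"] D0
    by (simp add: quotient_map_coords_def form_D_invariant)
  moreover have "complex_of_rat (?w (Inr (var_poly (chart_form Om)))) \<noteq> 0"
    using fun_cong[OF \<open>(\<lambda>j. of_rat (?w j)) = _\<close>, of "Inr (var_poly (chart_form Om))"] s0 Om0X \<kappa>
      chart_form_vanishing[of Om] cf[of Om]
    by (simp add: quotient_map_coords_def chart_form_invariant del: chart_form.simps)
  ultimately show ?thesis
    using closure unfolding kummer_cone_def blowup_cone_def
    by (auto simp: fun_eq_iff)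
qed

section \<open>The \<open>p\<close>-adic absolute value\<close>

context padic_field
begin

lemma p_gt_1: "1 < real p"
  using prime_gt_1_nat[OF prime_p] by simp

lemma v_zero [simp]: "v 0 = 0" by (simp add: v_eq_0_iff)

lemma v_one [simp]: "v 1 = 1"
proof -
  have "v 1 = v 1 * v 1" using v_mult[of 1 1] by simp
  moreover have "v 1 \<noteq> 0" by (simp add: v_eq_0_iff)
  ultimately show ?thesis by simp
qed

lemma v_diff: "v (x - y) \<le> max (v x) (v y)"
  using v_add[of x "- y"] by (simp add: v_minus)

lemma v_diff_commute: "v (x - y) = v (y - x)"
  using v_minus[of "x - y"] by simp

lemma v_power: "v (x ^ n) = v x ^ n"
  by (induction n) (auto simp: v_mult)

lemma v_pos: "x \<noteq> 0 \<Longrightarrow> 0 < v x"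
  using v_nonneg[of x] v_eq_0_iff[of x] by linarith

lemma v_inverse: "v (inverse x) = inverse (v x)"
proof (cases "x = 0")
  case False
  then have "v x * v (inverse x) = 1" by (simp flip: v_mult)
  then show ?thesis by (simp add: inverse_unique)
qed simp

lemma v_divide: "v (x / y) = v x / v y"
  by (simp add: divide_inverse v_mult v_inverse)

lemma v_add_less: "v x < c \<Longrightarrow> v y < c \<Longrightarrow> v (x + y) < c"
  using v_add[of x y] by (simp add: max_def split: if_splits)

lemma v_diff_less: "v x < c \<Longrightarrow> v y < c \<Longrightarrow> v (x - y) < c"
  using v_diff[of x y] by (simp add: max_def split: if_splits)

lemma v_add_le: "v x \<le> c \<Longrightarrow> v y \<le> c \<Longrightarrow> v (x + y) \<le> c"
  using v_add[of x y] by (simp add: max_def split: if_splits)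

lemma v_diff_le: "v x \<le> c \<Longrightarrow> v y \<le> c \<Longrightarrow> v (x - y) \<le> c"
  using v_diff[of x y] by (simp add: max_def split: if_splits)

lemma v_add_eq: "v y < v x \<Longrightarrow> v (x + y) = v x"
proof (rule antisym)
  assume "v y < v x"
  then show "v (x + y) \<le> v x" using v_add[of x y] by simp
  show "v x \<le> v (x + y)"
  proof (rule ccontr)
    assume "\<not> v x \<le> v (x + y)"
    then have "v (x + y - y) < v x" using \<open>v y < v x\<close> by (intro v_diff_less) auto
    then show False by simp
  qed
qed

lemma v_eq_of_close: "v (x - y) < v x \<Longrightarrow> v y = v x"
  using v_add_eq[of "y - x" x] by (simp add: v_diff_commute)

lemma v_of_int: "v (of_int n) = (if n = 0 then 0 else real p powi (- int (multiplicity (int p) n)))"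
proof -
  have "v (of_rat (of_int n)) = padic_abs p (of_int n)" by (rule v_of_rat)
  thus ?thesis by (simp add: padic_abs_def)
qed

lemma v_of_int_le: "v (of_int n) \<le> 1"
  using p_gt_1 by (simp add: v_of_int power_int_minus inverse_le_1_iff one_le_power)

lemma v_of_nat_le: "v (of_nat n) \<le> 1"
  using v_of_int_le[of "int n"] by simp

lemma v_of_int_less_iff: "v (of_int n) < 1 \<longleftrightarrow> int p dvd n"
proof (cases "n = 0")
  case False
  have "\<not> is_unit (int p)" using prime_p by (auto simp: prime_gt_1_nat)
  hence "0 < multiplicity (int p) n \<longleftrightarrow> int p dvd n"
    using False by (intro multiplicity_gt_zero_iff) auto
  moreover have "v (of_int n) < 1 \<longleftrightarrow> 0 < multiplicity (int p) n"
  proof (cases "multiplicity (int p) n = 0")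
    case True
    then show ?thesis using False by (simp add: v_of_int)
  next
    case pos: False
    then have "1 < real p ^ multiplicity (int p) n" using p_gt_1 by (intro one_less_power) auto
    then show ?thesis using False pos by (simp add: v_of_int power_int_minus inverse_less_1_iff)
  qed
  ultimately show ?thesis by simp
qed simp

lemma v_of_int_eq_1_iff: "v (of_int n) = 1 \<longleftrightarrow> \<not> int p dvd n"
  using v_of_int_less_iff[of n] v_of_int_le[of n] by linarith

lemma v_p: "v (of_nat p) = 1 / real p"
proof -
  have "multiplicity (int p) (int p) = 1"
    using prime_p by (intro multiplicity_self) (auto simp: prime_gt_1_nat)
  hence "v (of_int (int p)) = 1 / real p"
    using prime_gt_0_nat[OF prime_p] unfolding v_of_int by (simp add: power_int_minus divide_inverse)
  thus ?thesis by simp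
qed

lemma rat_dense:
  assumes "0 < e"
  obtains r where "v (x - of_rat r) < e"
proof -
  have "x \<in> Metric_space.mtopology UNIV (abs_dist v) closure_of (range of_rat)"
    using dense by blast
  hence "\<exists>y\<in>range of_rat. y \<in> mball x e"
    using assms unfolding metric_closure_of by blast
  thus ?thesis using that by (auto simp: in_mball abs_dist_def)
qed

lemma v_int_power: "v (x powi k) = v x powi k"
  by (cases "k \<ge> 0") (auto simp: power_int_def v_power v_inverse)

text \<open>A rational number closer to \<open>x\<close> than \<open>v x\<close> has the same
  absolute value as \<open>x\<close>.\<close>

lemma value_group:
  assumes "x \<noteq> 0"
  obtains k :: int where "v x = v (of_nat p) powi k"
proof -
  obtain r where r: "v (x - of_rat r) < v x" using rat_dense v_pos[OF assms] by blast
  have "v (of_rat r) = v x" by (rule v_eq_of_close[OF r])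
  moreover have "r \<noteq> 0" using calculation v_pos[OF assms] by auto
  ultimately have "v x = real p powi (int (multiplicity (int p) (snd (quotient_of r)))
                        - int (multiplicity (int p) (fst (quotient_of r))))"
    by (simp add: v_of_rat padic_abs_def)
  also have "\<dots> = v (of_nat p) powi (int (multiplicity (int p) (fst (quotient_of r)))
                        - int (multiplicity (int p) (snd (quotient_of r))))"
    using prime_gt_0_nat[OF prime_p]
    by (simp add: v_p divide_inverse power_int_inverse flip: power_int_minus)
  finally show ?thesis by (rule that)
qed

lemma v_less_1_imp:
  assumes "v x < 1"
  shows "v x \<le> 1 / real p"
proof (cases "x = 0")
  case False
  then obtain k where k: "v x = v (of_nat p) powi k" by (rule value_group)
  have "k \<ge> 1"
  proof (rule ccontr)
    assume "\<not> k \<ge> 1"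
    hence "1 \<le> real p powi (- k)" using p_gt_1 by (intro one_le_power_int) auto
    thus False using assms k prime_gt_0_nat[OF prime_p]
      by (simp add: v_p divide_inverse power_int_inverse power_int_minus)
  qed
  hence "v x = v (of_nat p) * v (of_nat p) powi (k - 1)"
  proof -
    have "v (of_nat p) powi (1 + (k - 1)) = v (of_nat p) powi 1 * v (of_nat p) powi (k - 1)"
      using p_gt_1 by (intro power_int_add) (auto simp: v_p)
    thus ?thesis using k by simp
  qed
  moreover have "v (of_nat p) powi (k - 1) \<le> 1"
  proof -
    have "v (of_nat p) powi (k - 1) = v (of_nat p) ^ nat (k - 1)"
      using \<open>k \<ge> 1\<close> by (simp add: power_int_def)
    thus ?thesis using v_of_nat_le[of p] v_nonneg by (simp add: power_le_one)
  qed
  hence "v (of_nat p) * v (of_nat p) powi (k - 1) \<le> v (of_nat p) * 1"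
    using v_nonneg by (intro mult_left_mono) auto
  ultimately show ?thesis by (simp add: v_p)
qed simp

text \<open>By density \<open>x\<close> is congruent to a reduced fraction \<open>a / b\<close> with
  \<open>v (a / b) \<le> 1\<close>. Then \<open>p\<close> does not divide \<open>b\<close>, and an
  inverse of \<open>b\<close> modulo \<open>p\<close> yields the integer.\<close>

lemma residue:
  assumes "v x \<le> 1"
  obtains n :: int where "0 \<le> n" "n < int p" "v (x - of_int n) < 1"
proof -
  obtain r where r: "v (x - of_rat r) < 1" using rat_dense[of 1] zero_less_one by blast
  define a b where "a = fst (quotient_of r)" and "b = snd (quotient_of r)"
  have b: "b > 0" and co: "coprime a b"
    unfolding a_def b_def by (simp_all add: quotient_of_denom_pos' quotient_of_coprime)
  have rab: "r = of_int a / of_int b" unfolding a_def b_def by (rule quotient_of_div) simp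
  have vr: "v (of_rat r) \<le> 1"
  proof -
    have "v (x - (x - of_rat r)) \<le> 1" by (rule v_diff_le[OF assms less_imp_le[OF r]])
    thus ?thesis by simp
  qed
  have r': "of_rat r * of_int b = (of_int a :: 'k)" using b by (simp add: rab of_rat_divide)
  have pb: "\<not> int p dvd b"
  proof
    assume pb: "int p dvd b"
    hence "v (of_rat r * of_int b) < 1"
      using vr v_of_int_less_iff[of b] by (simp add: v_mult mult_le_less_imp_less mult_le_one)
        (metis mult_left_le_one_le order_le_less_trans v_nonneg)
    hence "int p dvd a" unfolding r' by (simp add: v_of_int_less_iff)
    with pb co have "is_unit (int p)" by (rule coprime_common_divisor[rotated -1]) 
    thus False using prime_p by (auto simp: prime_gt_1_nat)
  qed
  hence "coprime b (int p)"
    using prime_p prime_imp_coprime[of "int p" b] by (simp add: coprime_commute)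
  then obtain c where c: "[b * c = 1] (mod int p)" using cong_solve_coprime_int by blast
  define n where "n = (a * c) mod int p"
  have "int p dvd b * n - a"
  proof -
    have "[b * n = b * (a * c)] (mod int p)" unfolding n_def by (intro cong_mult cong_refl) simp
    also have "b * (a * c) = a * (b * c)" by simp
    also have "[a * (b * c) = a * 1] (mod int p)" by (intro cong_mult cong_refl c)
    finally show ?thesis by (simp add: cong_iff_dvd_diff)
  qed
  hence "v (of_int (b * n - a)) < 1" unfolding v_of_int_less_iff .
  moreover have "of_int (b * n - a) = of_int b * (of_int n - of_rat r :: 'k)"
    using r' by (simp add: algebra_simps)
  ultimately have "v (of_int b) * v (of_int n - of_rat r) < 1" by (simp add: v_mult)
  hence "v (of_rat r - of_int n) < 1" using pb by (simp add: v_of_int_eq_1_iff[THEN iffD2] v_diff_commute)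
  hence "v ((x - of_rat r) + (of_rat r - of_int n)) < 1" using r by (intro v_add_less)
  hence "v (x - of_int n) < 1" by simp
  moreover have "0 \<le> n" "n < int p" using prime_gt_0_nat[OF prime_p] by (simp_all add: n_def)
  ultimately show ?thesis using that by blast
qed

lemma v_two_eq_1:
  assumes "p \<noteq> 2"
  shows "v 2 = 1"
proof -
  have "\<not> int p dvd 2"
    using assms prime_p primes_dvd_imp_eq[OF prime_p two_is_prime_nat]
    by (metis int_dvd_int_iff of_nat_numeral)
  thus ?thesis using v_of_int_eq_1_iff[of 2] by simp
qed

lemma v_mult_less_1: "v a < 1 \<Longrightarrow> v b \<le> 1 \<Longrightarrow> v (a * b) < 1"
  using mult_left_le[of "v b" "v a"] v_nonneg[of a] unfolding v_mult by linarith

lemma v_mult_le_1: "v a \<le> 1 \<Longrightarrow> v b \<le> 1 \<Longrightarrow> v (a * b) \<le> 1"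
  unfolding v_mult by (rule mult_le_one[OF _ v_nonneg])

text \<open>Newton's iteration for \<open>b\<^sup>2 = u\<close>.\<close>

lemma square_root_of_unit:
  assumes odd: "p \<noteq> 2" and a: "v a = 1" and u: "v (u - a\<^sup>2) < 1"
  obtains b where "b\<^sup>2 = u" "v (b - a) \<le> v (u - a\<^sup>2)"
proof -
  have v2: "v 2 = 1" by (rule v_two_eq_1[OF odd])
  define d where "d = v (u - a\<^sup>2)"
  have d: "0 \<le> d" "d < 1" using u v_nonneg by (auto simp: d_def)
  define f where "f b = b + (u - b\<^sup>2) / (2 * b)" for b
  define s where "s n = (f ^^ n) a" for n
  have s0: "s 0 = a" and sS: "s (Suc n) = f (s n)" for n by (simp_all add: s_def)
  \<comment> \<open>A Newton step squares the error up to a unit; the geometric bound recorded here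
    is weaker, but it already gives convergence and, at \<open>n = 0\<close>, the stated distance
    from \<open>a\<close>.\<close>
  have inv: "v (s n) = 1 \<and> v (u - (s n)\<^sup>2) \<le> d ^ Suc n \<and> v (s (Suc n) - s n) \<le> d ^ Suc n" for n
  proof -
    have step: "v (s (Suc n) - s n) = v (u - (s n)\<^sup>2)" if "v (s n) = 1" for n
      using that by (simp add: sS f_def v_divide v_mult v2)
    have "v (s n) = 1 \<and> v (u - (s n)\<^sup>2) \<le> d ^ Suc n"
    proof (induction n)
      case 0
      then show ?case by (simp add: s0 a d_def)
    next
      case (Suc n)
      then have b1: "v (s n) = 1" and b2: "v (u - (s n)\<^sup>2) \<le> d ^ Suc n" by auto
      have b0: "s n \<noteq> 0" using b1 by auto
      have le: "d ^ Suc n \<le> d" using d by (metis power_Suc mult_left_le power_le_one less_imp_le)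
      have lt: "v (u - (s n)\<^sup>2) < 1" using b2 le d by linarith
      have "v (s (Suc n) - s n) < v (s n)" using step[OF b1] lt b1 by simp
      hence "v (s (Suc n)) = 1" using v_eq_of_close[of "s n" "s (Suc n)"] b1 by (simp add: v_diff_commute)
      moreover have "u - (s (Suc n))\<^sup>2 = - (((u - (s n)\<^sup>2) / (2 * s n))\<^sup>2)"
        using b0 unfolding sS f_def by (simp add: field_simps power2_eq_square)
      hence "v (u - (s (Suc n))\<^sup>2) = v (u - (s n)\<^sup>2) ^ 2"
        by (simp add: v_minus v_power v_divide v_mult v2 b1)
      moreover have "\<dots> \<le> d ^ Suc n * d"
        unfolding power2_eq_square[of "v (u - (s n)\<^sup>2)"]
        using b2 le d v_nonneg by (intro mult_mono) auto
      ultimately show ?case by (simp add: mult_ac)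
    qed
    with step show ?thesis by simp
  qed
  have tail: "v (s (n + k) - s n) \<le> d ^ Suc n" for n k
  proof (induction k)
    case (Suc k)
    have "v (s (Suc (n + k)) - s (n + k)) \<le> d ^ Suc n"
    proof -
      have "d ^ Suc (n + k) \<le> d ^ Suc n" using d by (intro power_decreasing) auto
      thus ?thesis using inv[of "n + k"] by linarith
    qed
    with Suc have "v ((s (Suc (n + k)) - s (n + k)) + (s (n + k) - s n)) \<le> d ^ Suc n"
      by (intro v_add_le)
    then show ?case by simp
  qed (use d in simp)
  have lim0: "(\<lambda>n. d ^ Suc n) \<longlonglongrightarrow> 0"
    using d LIMSEQ_Suc[OF LIMSEQ_power_zero[of d]] by simp
  have "MCauchy s"
    unfolding MCauchy_def
  proof (intro conjI allI impI)
    fix e :: real assume e: "0 < e"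
    then obtain N where N: "\<And>n. n \<ge> N \<Longrightarrow> d ^ Suc n < e"
      using order_tendstoD(2)[OF lim0 e] unfolding eventually_sequentially by blast
    have "abs_dist v (s n) (s m) < e" if "N \<le> n" "N \<le> m" for n m
    proof -
      have "v (s n - s N) < e" "v (s m - s N) < e"
        using tail[of N "n - N"] tail[of N "m - N"] N[of N] that by auto
      hence "v ((s n - s N) - (s m - s N)) < e" by (rule v_diff_less)
      thus ?thesis by (simp add: abs_dist_def)
    qed
    thus "\<exists>N. \<forall>n n'. N \<le> n \<longrightarrow> N \<le> n' \<longrightarrow> abs_dist v (s n) (s n') < e" by blast
  qed simp
  then obtain b where b: "limitin mtopology s b sequentially"
    using complete unfolding mcomplete_def by blast
  have lim: "\<exists>N. \<forall>n\<ge>N. v (s n - b) < e" if "0 < e" for e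
    using b that unfolding limit_metric_sequentially abs_dist_def by blast
  have b_close: "v (b - s n) \<le> d ^ Suc n" for n
  proof (rule ccontr)
    assume "\<not> v (b - s n) \<le> d ^ Suc n"
    hence g: "d ^ Suc n < v (b - s n)" by simp
    hence "0 < v (b - s n)" using d by (meson le_less_trans zero_le_power)
    then obtain N where N: "\<forall>m\<ge>N. v (s m - b) < v (b - s n)" using lim by blast
    have "v ((s (n + N) - s n) - (s (n + N) - b)) < v (b - s n)"
      using tail[of n N] g N by (intro v_diff_less[of "s (n + N) - s n"]) auto
    thus False by simp
  qed
  have "v (u - b\<^sup>2) \<le> d ^ Suc n" for n
  proof -
    have n: "v (s n) = 1" "v (u - (s n)\<^sup>2) \<le> d ^ Suc n" using inv by auto
    have le1: "d ^ Suc n \<le> 1" using d by (intro power_le_one) auto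
    have "v (b + s n) \<le> 1"
    proof -
      have "v ((b - s n) + 2 * s n) \<le> 1"
        using b_close[of n] le1 n v2 by (intro v_add_le) (auto simp: v_mult)
      moreover have "(b - s n) + 2 * s n = b + s n" by simp
      ultimately show ?thesis by simp
    qed
    moreover have "b\<^sup>2 - (s n)\<^sup>2 = (b - s n) * (b + s n)" by (simp add: power2_eq_square algebra_simps)
    ultimately have "v (b\<^sup>2 - (s n)\<^sup>2) \<le> d ^ Suc n"
      using b_close[of n] v_nonneg by (simp add: v_mult) (meson mult_left_le order_trans)
    hence "v ((u - (s n)\<^sup>2) - (b\<^sup>2 - (s n)\<^sup>2)) \<le> d ^ Suc n" by (rule v_diff_le[OF n(2)])
    thus ?thesis by simp
  qed
  hence "v (u - b\<^sup>2) \<le> 0" by (intro LIMSEQ_le_const[OF lim0]) auto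
  hence "b\<^sup>2 = u" using v_nonneg[of "u - b\<^sup>2"] v_eq_0_iff[of "u - b\<^sup>2"] by simp
  moreover have "v (b - a) \<le> v (u - a\<^sup>2)" using b_close[of 0] by (simp add: s0 d_def)
  ultimately show ?thesis by (rule that)
qed

end

section \<open>Cyclic groups\<close>

context comm_group
begin

text \<open>Raising the product to the power \<open>t * ord b\<close> removes \<open>b\<close>, so
  \<open>ord a\<close> divides \<open>t * ord b\<close> and by coprimality divides
  \<open>t\<close>.\<close>

lemma ord_mult_coprime:
  assumes x: "x \<in> carrier G" and y: "y \<in> carrier G" and co: "coprime (ord x) (ord y)"
  shows "ord (x \<otimes> y) = ord x * ord y"
proof (rule dvd_antisym)
  show "ord (x \<otimes> y) dvd ord x * ord y" by (rule abelian_ord_mul_divides[OF x y])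
  define t where "t = ord (x \<otimes> y)"
  have *: "ord a dvd t" if a: "a \<in> carrier G" and b: "b \<in> carrier G" and ab: "ord (a \<otimes> b) = t"
    and cop: "coprime (ord a) (ord b)" for a b
  proof -
    have "(a \<otimes> b) [^] (t * ord b) = \<one>" using a b ab by (simp add: pow_eq_id)
    hence "a [^] (t * ord b) \<otimes> b [^] (t * ord b) = \<one>" by (simp only: pow_mult_distrib[OF m_comm[OF a b] a b])
    moreover have "b [^] (t * ord b) = \<one>" using b by (simp add: pow_eq_id)
    ultimately have "a [^] (t * ord b) = \<one>" using a by simp
    hence "ord a dvd t * ord b" using a by (simp add: pow_eq_id)
    thus ?thesis using cop by (simp add: coprime_dvd_mult_left_iff)
  qed
  have "ord x dvd t" by (rule *[OF x y]) (simp_all add: t_def co)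
  moreover have "ord y dvd t" by (rule *[OF y x]) (simp_all add: t_def co m_comm x y coprime_commute)
  ultimately show "ord x * ord y dvd ord (x \<otimes> y)" using co unfolding t_def by (simp add: divides_mult)
qed

text \<open>The \<open>l\<close>-torsion is a vector space over the field with \<open>l\<close>
  elements. If it had more than \<open>l\<close> elements, it would contain independent
  \<open>a\<close> and \<open>b\<close>, and with them the \<open>l^2\<close> products of their
  powers.\<close>

lemma torsion_card_le_prime:
  assumes fin: "finite (carrier G)" and l: "prime l"
    and small: "card {x \<in> carrier G. x [^] l = \<one>} < l ^ 2"
  shows "card {x \<in> carrier G. x [^] l = \<one>} \<le> l"
proof (rule ccontr)
  let ?T = "{x \<in> carrier G. x [^] l = \<one>}"
  assume big: "\<not> card ?T \<le> l"
  have l0: "0 < l" using l by (simp add: prime_gt_0_nat)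
  have finT: "finite ?T" using fin by simp
  have "\<not> ?T \<subseteq> {\<one>}"
  proof
    assume "?T \<subseteq> {\<one>}"
    from card_mono[OF _ this] have "card ?T \<le> 1" by simp
    thus False using big prime_gt_1_nat[OF l] by linarith
  qed
  then obtain a where a: "a \<in> carrier G" "a [^] l = \<one>" "a \<noteq> \<one>" by blast
  define A where "A = (\<lambda>i::nat. a [^] i) ` {..<l}"
  have "card A \<le> l" unfolding A_def using card_image_le[of "{..<l}"] by simp
  moreover have "finite A" by (simp add: A_def)
  ultimately have "\<not> ?T \<subseteq> A" using big card_mono[of A ?T] by linarith
  then obtain b where b: "b \<in> carrier G" "b [^] l = \<one>" "b \<notin> A" by blast
  have a_int: "a [^] (i::int) \<in> A" for i
  proof -
    have "a [^] i = a [^] (i mod int l)"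
    proof -
      have "a [^] i = a [^] (int l * (i div int l) + i mod int l)" by simp
      also have "\<dots> = (a [^] int l) [^] (i div int l) \<otimes> a [^] (i mod int l)"
        unfolding int_pow_mult[OF a(1)] int_pow_pow[OF a(1)] ..
      also have "a [^] int l = \<one>" using a(2) by (simp add: int_pow_int)
      finally show ?thesis using a(1) by simp
    qed
    also have "\<dots> = a [^] nat (i mod int l)" 
    proof -
      have "int (nat (i mod int l)) = i mod int l" using l0 by simp
      thus ?thesis using int_pow_int[of G a "nat (i mod int l)"] by simp
    qed
    also have "\<dots> \<in> A" using l0 unfolding A_def by (intro imageI) (simp add: nat_less_iff)
    finally show ?thesis .
  qed
  have swap: "x \<otimes> inv x' = y' \<otimes> inv y"
    if "x \<in> carrier G" "y \<in> carrier G" "x' \<in> carrier G" "y' \<in> carrier G" "x \<otimes> y = x' \<otimes> y'" for x y x' y'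
  proof -
    have "x \<otimes> inv x' = (x \<otimes> y) \<otimes> inv y \<otimes> inv x'" using that(1-4) by (simp add: m_assoc)
    also have "\<dots> = (x' \<otimes> inv x') \<otimes> (y' \<otimes> inv y)"
      unfolding that(5) using that(1-4) by (simp only: m_ac m_closed inv_closed)
    finally show ?thesis using that(1-4) by simp
  qed
  have cmod: "x = y" if "int l dvd int x - int y" "x < l" "y < l" for x y
  proof -
    have "int x mod int l = int y mod int l" using that(1) by (simp add: mod_eq_dvd_iff)
    thus ?thesis using that(2,3) by (simp flip: zmod_int)
  qed
  have inj: "inj_on (\<lambda>(i, j). a [^] i \<otimes> b [^] j) ({..<l} \<times> {..<l})"
  proof (rule inj_onI, clarify)
    fix i j i' j' :: nat
    assume lt: "i < l" "j < l" "i' < l" "j' < l" and eq: "a [^] i \<otimes> b [^] j = a [^] i' \<otimes> b [^] j'"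
    have e: "a [^] (int i - int i') = b [^] (int j' - int j)"
    proof -
      have "a [^] (int i - int i') = a [^] i \<otimes> inv (a [^] i')"
        using a(1) by (simp add: int_pow_diff int_pow_int)
      also have "\<dots> = b [^] j' \<otimes> inv (b [^] j)"
        by (rule swap[OF _ _ _ _ eq]) (use a b in simp_all)
      also have "\<dots> = b [^] (int j' - int j)" using b(1) by (simp add: int_pow_diff int_pow_int)
      finally show ?thesis .
    qed
    have jj: "j = j'"
    proof (rule ccontr)
      assume "j \<noteq> j'"
      hence "\<not> int l dvd int j' - int j"
        using cmod[of j' j] lt by auto
      hence "coprime (int j' - int j) (int l)"
        using l prime_imp_coprime[of "int l" "int j' - int j"] by (simp add: coprime_commute)
      then obtain u where u: "[(int j' - int j) * u = 1] (mod int l)" using cong_solve_coprime_int by blast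
      then obtain w where "(int j' - int j) * u - 1 = int l * w" by (auto simp: cong_iff_dvd_diff)
      hence w: "(int j' - int j) * u = 1 + int l * w" by simp
      have "b [^] ((int j' - int j) * u) = b"
      proof -
        have "b [^] (1 + int l * w) = b [^] (1 :: int) \<otimes> (b [^] int l) [^] w"
          unfolding int_pow_mult[OF b(1)] int_pow_pow[OF b(1)] ..
        also have "b [^] int l = \<one>" using b(2) by (simp add: int_pow_int)
        finally show ?thesis unfolding w using b(1) by (simp add: int_pow_1)
      qed
      hence "b = a [^] ((int i - int i') * u)"
        unfolding int_pow_pow[OF a(1), symmetric] e int_pow_pow[OF b(1)] ..
      with a_int[of "(int i - int i') * u"] b(3) show False by simp
    qed
    moreover have "a [^] i = a [^] i'" using eq a b unfolding jj by simp
    hence "int i = int i'"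
    proof -
      assume "a [^] i = a [^] i'"
      have od: "ord a = l"
      proof -
        have "ord a dvd l" using a by (simp add: flip: pow_eq_id)
        moreover have "ord a \<noteq> 1" using a ord_eq_1 by blast
        ultimately show ?thesis using l by (metis prime_nat_iff)
      qed
      have "a [^] (int i - int i') = \<one>" using \<open>a [^] i = a [^] i'\<close> a(1) by (simp add: int_pow_diff int_pow_int)
      hence "int l dvd int i - int i'" using a(1) od by (simp add: int_pow_eq_id)
      thus ?thesis using lt cmod[of i i'] by simp
    qed
    ultimately show "i = i' \<and> j = j'" by simp
  qed
  have "l * l = card ((\<lambda>(i, j). a [^] i \<otimes> b [^] j) ` ({..<l} \<times> {..<l}))"
    using card_image[OF inj] by (simp add: card_cartesian_product)
  also have "\<dots> \<le> card ?T"
  proof (rule card_mono[OF finT], clarify)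
    fix i j :: nat
    have "(a [^] i \<otimes> b [^] j) [^] l = (a [^] l) [^] i \<otimes> (b [^] l) [^] j"
      using a(1) b(1)
      by (simp add: pow_mult_distrib[OF m_comm] nat_pow_pow mult.commute[of _ l])
    thus "a [^] i \<otimes> b [^] j \<in> carrier G \<and> (a [^] i \<otimes> b [^] j) [^] l = \<one>"
      using a b by simp
  qed
  finally show False using small by (simp add: power2_eq_square)
qed

text \<open>For \<open>d = l * k\<close> with \<open>l\<close> prime, the \<open>k\<close>-th power
  maps the \<open>d\<close>-torsion to the \<open>l\<close>-torsion, and a fibre embeds in the
  \<open>k\<close>-torsion by division by one of its elements.\<close>

lemma torsion_card_le:
  assumes fin: "finite (carrier G)"
    and small: "\<And>l. prime l \<Longrightarrow> card {x \<in> carrier G. x [^] l = \<one>} < l ^ 2"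
    and d: "0 < d"
  shows "card {x \<in> carrier G. x [^] (d::nat) = \<one>} \<le> d"
  using d
proof (induction d rule: less_induct)
  case (less d)
  show ?case
  proof (cases "d = 1")
    case True
    have "{x \<in> carrier G. x [^] d = \<one>} \<subseteq> {\<one>}" using True by auto
    from card_mono[OF _ this] show ?thesis using True by simp
  next
    case False
    then obtain l where l: "prime l" "l dvd d" using prime_factor_nat by blast
    then obtain k where k: "d = l * k" by blast
    have k0: "0 < k" "k < d" using k less.prems prime_gt_1_nat[OF l(1)] by (auto intro: Nat.gr0I)
    let ?T = "\<lambda>n. {x \<in> carrier G. x [^] (n::nat) = \<one>}"
    let ?F = "\<lambda>c. {x \<in> ?T d. x [^] k = c}"
    have fib: "card (?F c) \<le> k" for c
    proof (cases "?F c = {}")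
      case True
      show ?thesis unfolding True by simp
    next
      case False
      then obtain y where y: "y \<in> carrier G" "y [^] k = c" by blast
      have "inj_on (\<lambda>x. x \<otimes> inv y) (?F c)" using y by (intro inj_onI) auto
      moreover have "(\<lambda>x. x \<otimes> inv y) ` ?F c \<subseteq> ?T k"
        using y by (auto simp: pow_mult_distrib[OF m_comm] nat_pow_inv)
      moreover have "finite (?T k)" using fin by simp
      ultimately have "card (?F c) \<le> card (?T k)" by (rule card_inj_on_le)
      thus ?thesis using less.IH[OF k0(2) k0(1)] by simp
    qed
    have "?T d \<subseteq> (\<Union>c\<in>?T l. ?F c)"
    proof
      fix x assume x: "x \<in> ?T d"
      hence "x [^] k \<in> ?T l" using k by (auto simp: nat_pow_pow mult.commute)
      thus "x \<in> (\<Union>c\<in>?T l. ?F c)" using x by blast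
    qed
    hence "card (?T d) \<le> card (\<Union>c\<in>?T l. ?F c)" using fin by (intro card_mono) auto
    also have "\<dots> \<le> (\<Sum>c\<in>?T l. card (?F c))" using fin by (intro card_UN_le) auto
    also have "\<dots> \<le> (\<Sum>c\<in>?T l. k)" by (intro sum_mono fib)
    also have "\<dots> = card (?T l) * k" by simp
    also have "\<dots> \<le> l * k" using torsion_card_le_prime[OF fin l(1) small[OF l(1)]] by simp
    finally show ?thesis using k by simp
  qed
qed

text \<open>Let \<open>g\<close> have maximal order \<open>m\<close>. Every order divides
  \<open>m\<close>, since otherwise a product of elements of coprime orders would have larger order.
  The group is thus its own \<open>m\<close>-torsion, which has at most \<open>m\<close> elements
  and so consists of the powers of \<open>g\<close>.\<close>

lemma cyclic_of_small_torsion: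
  assumes fin: "finite (carrier G)"
    and small: "\<And>l. prime l \<Longrightarrow> card {x \<in> carrier G. x [^] l = \<one>} < l ^ 2"
  obtains g where "g \<in> carrier G" "\<And>x. x \<in> carrier G \<Longrightarrow> \<exists>n::nat. x = g [^] n"
proof -
  have pos: "0 < ord x" if "x \<in> carrier G" for x using ord_ge_1[OF fin that] by simp
  define m where "m = Max (ord ` carrier G)"
  have "m \<in> ord ` carrier G" unfolding m_def using fin by (intro Max_in) auto
  then obtain g where g: "g \<in> carrier G" "ord g = m" by blast
  have max: "ord x \<le> m" if "x \<in> carrier G" for x unfolding m_def using fin that by simp
  have m0: "0 < m" using pos[OF g(1)] g(2) by simp
  have dvd: "ord h dvd m" if h: "h \<in> carrier G" for h
  proof (rule ccontr)
    assume ndvd: "\<not> ord h dvd m"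
    have "\<exists>q. prime q \<and> multiplicity q m < multiplicity q (ord h)"
    proof (rule ccontr)
      assume "\<nexists>q. prime q \<and> multiplicity q m < multiplicity q (ord h)"
      hence "multiplicity q (ord h) \<le> multiplicity q m" if "prime q" for q
        using that by (meson not_le)
      with ndvd pos[OF h] show False using multiplicity_le_imp_dvd[of "ord h" m] by simp
    qed
    then obtain q where q: "prime q" "multiplicity q m < multiplicity q (ord h)" by blast
    define a b where "a = multiplicity q m" and "b = multiplicity q (ord h)"
    have q1: "1 < q" using prime_gt_1_nat[OF q(1)] .
    have qa: "q ^ a dvd m" unfolding a_def by (rule multiplicity_dvd)
    have qb: "q ^ b dvd ord h" unfolding b_def by (rule multiplicity_dvd)
    obtain m' where m': "m = q ^ a * m'" using qa by blast
    obtain k where k: "ord h = q ^ b * k" using qb by blast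
    have k0: "k \<noteq> 0" using k pos[OF h] by auto
    have nq: "\<not> q dvd m'"
    proof
      assume "q dvd m'"
      hence "q ^ Suc a dvd m" using m' by (auto simp: mult_ac)
      hence "Suc a \<le> multiplicity q m" using m0 q1 by (intro multiplicity_geI) auto
      thus False by (simp add: a_def)
    qed
    \<comment> \<open>The first power strips \<open>g\<close> of its \<open>q\<close>-part, the
      second leaves only the \<open>q\<close>-part of \<open>h\<close>; the orders become coprime
      with a product exceeding \<open>m\<close>.\<close>
    define x y where "x = g [^] (q ^ a)" and "y = h [^] k"
    have xc: "x \<in> carrier G" and yc: "y \<in> carrier G" using g h by (simp_all add: x_def y_def)
    have ox: "ord x = m'" unfolding x_def using ord_pow[OF g(1), of "q ^ a"] qa g(2) m' q1 by simp
    have oy: "ord y = q ^ b" unfolding y_def using ord_pow[OF h, of k] k k0 by simp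
    have "coprime (ord x) (ord y)"
      unfolding ox oy using prime_imp_coprime[OF q(1) nq] by (simp add: coprime_commute)
    hence "ord (x \<otimes> y) = m' * q ^ b" using ord_mult_coprime[OF xc yc] ox oy by simp
    moreover have "q ^ a < q ^ b" using q(2) q1 by (simp add: a_def b_def)
    hence "m < m' * q ^ b" using m' m0 by (simp add: mult.commute)
    ultimately show False using max[of "x \<otimes> y"] xc yc by simp
  qed
  let ?C = "(\<lambda>i::nat. g [^] i) ` {..<m}"
  have inj: "inj_on (\<lambda>i::nat. g [^] i) {..<m}"
    using ord_inj[OF g(1)] g(2) m0 by (intro inj_onI) (auto simp: inj_on_def)
  have "card ?C = m" using card_image[OF inj] by simp
  moreover have "?C \<subseteq> {x \<in> carrier G. x [^] m = \<one>}"
    using g by (auto simp: nat_pow_pow pow_eq_id)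
  moreover have "finite {x \<in> carrier G. x [^] m = \<one>}" using fin by simp
  moreover have "card {x \<in> carrier G. x [^] m = \<one>} \<le> m"
    by (rule torsion_card_le[OF fin small m0])
  ultimately have eq: "?C = {x \<in> carrier G. x [^] m = \<one>}" by (intro card_seteq) simp_all
  have "\<exists>n::nat. x = g [^] n" if x: "x \<in> carrier G" for x
  proof -
    have "x [^] m = \<one>" using x dvd[OF x] by (simp add: pow_eq_id)
    with x eq have "x \<in> ?C" by blast
    thus ?thesis by blast
  qed
  with g(1) show ?thesis by (rule that)
qed

end

section \<open>Square classes for \<open>p \<equiv> 3\<close> modulo 4\<close>

locale padic_3mod4 = padic_field p v for p :: nat and v :: "'k::field_char_0 \<Rightarrow> real" +
  assumes p_mod_4: "p mod 4 = 3"
begin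

lemma p_ne_2: "p \<noteq> 2" using p_mod_4 by auto

lemma v_two: "v 2 = 1"
  by (rule v_two_eq_1[OF p_ne_2])

text \<open>Euler's criterion: \<open>n\<^bsup>(p-1)/2\<^esup> = \<plusminus>1\<close>, with \<open>(p-1)/2\<close> odd.\<close>

lemma not_dvd_one_plus_square: "\<not> int p dvd 1 + (int n)\<^sup>2"
proof
  assume d: "int p dvd 1 + (int n)\<^sup>2"
  obtain k where k: "p = 4 * k + 3" using p_mod_4 by (metis mult.commute div_mult_mod_eq)
  have "\<not> p dvd n"
  proof
    assume "p dvd n"
    hence "int p dvd (int n)\<^sup>2" by (simp add: power2_eq_square)
    with d have "int p dvd 1" using dvd_add_left_iff by blast
    thus False using prime_gt_1_nat[OF prime_p] by simp
  qed
  from fermat_theorem[OF prime_p this] have "[int (n ^ (p - 1)) = int 1] (mod int p)"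
    by (simp only: cong_int_iff)
  moreover have "p - 1 = 2 * (2 * k + 1)" using k by simp
  ultimately have f: "[((int n)\<^sup>2) ^ (2 * k + 1) = 1] (mod int p)"
    by (simp only: power_mult of_nat_power of_nat_1)
  have "[(int n)\<^sup>2 = - 1] (mod int p)" using d by (simp add: cong_iff_dvd_diff add.commute)
  hence "[((int n)\<^sup>2) ^ (2 * k + 1) = (- 1) ^ (2 * k + 1)] (mod int p)" by (rule cong_pow)
  hence "[- 1 = (1 :: int)] (mod int p)" using f by (simp add: cong_def)
  hence "int p dvd - 2" by (simp add: cong_iff_dvd_diff)
  hence "v (of_int (- 2)) < 1" unfolding v_of_int_less_iff .
  thus False using v_two by (simp add: v_minus)
qed

lemma v_one_plus_square: "v x \<le> 1 \<Longrightarrow> v (1 + x\<^sup>2) = 1"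
proof -
  assume x: "v x \<le> 1"
  obtain n where n: "0 \<le> n" "n < int p" "v (x - of_int n) < 1" by (rule residue[OF x])
  have "v (1 + (of_int n)\<^sup>2) = 1"
    using not_dvd_one_plus_square[of "nat n"] n(1) v_of_int_eq_1_iff[of "1 + n\<^sup>2"] by simp
  moreover have "v ((1 + (of_int n)\<^sup>2) - (1 + x\<^sup>2)) < 1"
  proof -
    have "v (of_int n + x) \<le> 1" by (rule v_add_le[OF v_of_int_le x])
    moreover have "(1 + (of_int n)\<^sup>2) - (1 + x\<^sup>2) = (of_int n - x) * (of_int n + x)"
      by (simp add: power2_eq_square algebra_simps)
    ultimately show ?thesis using n(3) v_nonneg
      by (simp add: v_mult v_diff_commute[of "of_int n" x]) (meson le_less_trans mult_right_le_one_le)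
  qed
  ultimately show ?thesis by (metis v_eq_of_close)
qed

text \<open>The form \<open>a^2 + b^2\<close> is anisotropic modulo \<open>p\<close>, so nothing
  cancels in a sum of two squares. Integrality of points and regularity of the addition law rest on
  this.\<close>

lemma v_sum_squares: "v (a\<^sup>2 + b\<^sup>2) = (max (v a) (v b))\<^sup>2"
proof -
  have *: "v (a\<^sup>2 + b\<^sup>2) = (v a)\<^sup>2" if "v b \<le> v a" for a b
  proof (cases "a = 0")
    case True
    with that v_nonneg[of b] have "v b = 0" by simp
    with True show ?thesis by (simp add: v_eq_0_iff)
  next
    case False
    have "a\<^sup>2 + b\<^sup>2 = a\<^sup>2 * (1 + (b / a)\<^sup>2)" using False by (simp add: field_simps)
    moreover have "v (b / a) \<le> 1" using that v_pos[OF False] by (simp add: v_divide)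
    ultimately show ?thesis by (simp add: v_mult v_power v_one_plus_square)
  qed
  show ?thesis
    using *[of b a] *[of a b] by (cases "v b \<le> v a") (auto simp: add.commute max_def)
qed

lemma one_plus_square_nonzero: "1 + x\<^sup>2 \<noteq> (0 :: 'k)"
proof
  assume "1 + x\<^sup>2 = 0"
  hence "(max (v 1) (v x))\<^sup>2 = 0" using v_sum_squares[of 1 x] by simp
  thus False by (simp add: max_def split: if_splits)
qed

text \<open>Let \<open>p = 4 k + 3\<close>. Modulo \<open>p\<close> the power
  \<open>n ^ (2 * k + 1)\<close> is a sign \<open>\<sigma>\<close>, so \<open>n ^ (k + 1)\<close> is
  an explicit square root of \<open>\<sigma> * n\<close>, which Newton's iteration lifts.\<close>

lemma unit_square_class:
  assumes u: "v u = 1"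
  obtains s where "v s = 1" "s\<^sup>2 = u \<or> s\<^sup>2 = - u"
proof -
  obtain n where n: "0 \<le> n" "n < int p" "v (u - of_int n) < 1" using residue[of u] u by auto
  obtain m where m: "n = int m" using n(1) nonneg_int_cases by blast
  obtain k where k: "p = 4 * k + 3" using p_mod_4 by (metis mult.commute div_mult_mod_eq)
  have vn: "v (of_int n) = 1" using v_eq_of_close[of u "of_int n"] n(3) u by simp
  hence "\<not> int p dvd n" unfolding v_of_int_eq_1_iff .
  hence "\<not> p dvd m" by (simp add: m)
  from fermat_theorem[OF prime_p this] have "[int (m ^ (p - 1)) = int 1] (mod int p)"
    by (simp only: cong_int_iff)
  moreover have "int (m ^ (p - 1)) = (n ^ (2 * k + 1))\<^sup>2"
  proof -
    have "p - 1 = (2 * k + 1) * 2" using k by simp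
    thus ?thesis by (simp only: m power_mult of_nat_power)
  qed
  ultimately have "int p dvd (n ^ (2 * k + 1))\<^sup>2 - 1"
    by (simp only: cong_iff_dvd_diff of_nat_1)
  also have "(n ^ (2 * k + 1))\<^sup>2 - 1 = (n ^ (2 * k + 1) - 1) * (n ^ (2 * k + 1) + 1)"
    by (simp add: power2_eq_square algebra_simps)
  finally have "int p dvd n ^ (2 * k + 1) - 1 \<or> int p dvd n ^ (2 * k + 1) + 1"
    using prime_p by (simp add: prime_dvd_mult_iff)
  then obtain \<sigma> :: int where s: "\<sigma> = 1 \<or> \<sigma> = - 1" "int p dvd n ^ (2 * k + 1) - \<sigma>" by force
  have "int p dvd n * (n ^ (2 * k + 1) - \<sigma>)" using s(2) by simp
  also have "n * (n ^ (2 * k + 1) - \<sigma>) = (n ^ (k + 1))\<^sup>2 - \<sigma> * n"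
  proof -
    have "n * n ^ (2 * k + 1) = (n ^ (k + 1))\<^sup>2"
      by (simp add: power2_eq_square mult_2 power_add)
    thus ?thesis by (simp only: right_diff_distrib mult.commute[of n \<sigma>])
  qed
  finally have "v (of_int ((n ^ (k + 1))\<^sup>2 - \<sigma> * n)) < 1" unfolding v_of_int_less_iff .
  hence 1: "v ((of_int (n ^ (k + 1)))\<^sup>2 - of_int \<sigma> * of_int n) < 1" by simp
  have 2: "v (of_int \<sigma> * of_int n - of_int \<sigma> * u) < 1"
  proof -
    have "of_int \<sigma> * of_int n - of_int \<sigma> * u = of_int \<sigma> * (of_int n - u)"
      by (simp add: right_diff_distrib)
    moreover have "v (of_int \<sigma>) = 1" using s(1) by (auto simp: v_minus)
    ultimately show ?thesis using n(3) by (simp add: v_mult v_diff_commute)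
  qed
  have "v ((of_int (n ^ (k + 1)))\<^sup>2 - of_int \<sigma> * u) < 1" using v_add_less[OF 1 2] by simp
  hence 3: "v (of_int \<sigma> * u - (of_int (n ^ (k + 1)))\<^sup>2) < 1" by (simp add: v_diff_commute)
  have "v (of_int (n ^ (k + 1))) = 1" using vn by (simp add: v_power v_mult)
  from square_root_of_unit[OF p_ne_2 this 3] obtain b where b: "b\<^sup>2 = of_int \<sigma> * u" by metis
  have "v b ^ 2 = 1 ^ 2" using s(1) u by (auto simp: b v_minus simp flip: v_power)
  hence "v b = 1" using v_nonneg[of b] by (simp add: power2_eq_1_iff)
  thus ?thesis using that[of b] b s(1) by auto
qed

text \<open>The parity of the exponent of \<open>p\<close> determines \<open>e\<close>, and the unit
  part contributes only a sign.\<close>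

lemma square_class:
  fixes x :: 'k
  assumes x: "x \<noteq> 0"
  obtains e s where "e = 1 \<or> e = of_nat p" "s \<noteq> 0" "x = e * s\<^sup>2 \<or> x = - (e * s\<^sup>2)"
proof -
  obtain k where k: "v x = v (of_nat p) powi k" by (rule value_group[OF x])
  have p0: "(of_nat p :: 'k) \<noteq> 0" using prime_gt_0_nat[OF prime_p] by simp
  define e :: 'k where "e = (if even k then 1 else of_nat p)"
  define t :: 'k where "t = of_nat p powi (k div 2)"
  have t0: "t \<noteq> 0" using p0 by (simp add: t_def)
  have et: "e * t\<^sup>2 = of_nat p powi k"
  proof -
    have "t\<^sup>2 = of_nat p powi (2 * (k div 2))"
      by (simp add: t_def mult.commute flip: power_int_mult power_int_numeral)
    moreover have "k = 2 * (k div 2) + (if even k then 0 else 1)" by presburger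
    hence "(of_nat p :: 'k) powi k = of_nat p powi (2 * (k div 2)) * of_nat p powi (if even k then 0 else 1)"
      using p0 by (metis power_int_add)
    ultimately show ?thesis by (auto simp: e_def)
  qed
  have et0: "e * t\<^sup>2 \<noteq> 0" using et p0 by simp
  have "v (e * t\<^sup>2) = v x" unfolding et v_int_power k ..
  hence "v (x / (e * t\<^sup>2)) = 1" using v_pos[OF x] by (simp add: v_divide)
  then obtain s where s: "v s = 1" "s\<^sup>2 = x / (e * t\<^sup>2) \<or> s\<^sup>2 = - (x / (e * t\<^sup>2))"
    by (rule unit_square_class)
  have "x = e * (t * s)\<^sup>2 \<or> x = - (e * (t * s)\<^sup>2)"
    using s(2) et0 by (auto simp: power_mult_distrib field_simps)
  moreover have "t * s \<noteq> 0" using t0 s(1) by auto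
  moreover have "e = 1 \<or> e = of_nat p" by (simp add: e_def)
  ultimately show ?thesis using that by blast
qed

end


section \<open>Twisted Edwards curves\<close>

text \<open>The addition law of the twisted Edwards curve \<open>a x^2 + y^2 = 1 + d x^2 y^2\<close>
  for \<open>a = e\<close>, \<open>d = -e\<close>. As in the next identities, denominators are
  cleared, so that the claim lies in the ideal generated by the curve equations.\<close>

lemma edwards_add_closed:
  fixes e x1 y1 x2 y2 :: "'a::field_char_0"
  assumes c1: "e * x1 ^ 2 + y1 ^ 2 + e * x1 ^ 2 * y1 ^ 2 = 1" and c2: "e * x2 ^ 2 + y2 ^ 2 + e * x2 ^ 2 * y2 ^ 2 = 1"
  shows "e * ((x1 * y2 + x2 * y1) * (1 + e * x1 * x2 * y1 * y2)) ^ 2 + ((y1 * y2 - e * x1 * x2) * (1 - e * x1 * x2 * y1 * y2)) ^ 2 + e * ((x1 * y2 + x2 * y1) * (y1 * y2 - e * x1 * x2)) ^ 2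
    = ((1 - e * x1 * x2 * y1 * y2) * (1 + e * x1 * x2 * y1 * y2)) ^ 2"
  using assms by Groebner_Basis.algebra

lemma edwards_assoc_x:
  fixes e x1 y1 x2 y2 x3 y3 :: "'a::field_char_0"
  assumes c1: "e * x1 ^ 2 + y1 ^ 2 + e * x1 ^ 2 * y1 ^ 2 = 1" and c2: "e * x2 ^ 2 + y2 ^ 2 + e * x2 ^ 2 * y2 ^ 2 = 1" and c3: "e * x3 ^ 2 + y3 ^ 2 + e * x3 ^ 2 * y3 ^ 2 = 1"
  shows "((x1 * y2 + x2 * y1) * (1 + e * x1 * x2 * y1 * y2) * y3 + x3 * ((y1 * y2 - e * x1 * x2) * (1 - e * x1 * x2 * y1 * y2))) * ((1 - e * x2 * x3 * y2 * y3) * (1 + e * x2 * x3 * y2 * y3) - e * x1 * y1 * ((x2 * y3 + x3 * y2) * (y2 * y3 - e * x2 * x3)))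
    = (x1 * ((y2 * y3 - e * x2 * x3) * (1 - e * x2 * x3 * y2 * y3)) + (x2 * y3 + x3 * y2) * (1 + e * x2 * x3 * y2 * y3) * y1) * ((1 - e * x1 * x2 * y1 * y2) * (1 + e * x1 * x2 * y1 * y2) - e * x3 * y3 * ((x1 * y2 + x2 * y1) * (y1 * y2 - e * x1 * x2)))"
  using assms by Groebner_Basis.algebra

lemma edwards_assoc_y:
  fixes e x1 y1 x2 y2 x3 y3 :: "'a::field_char_0"
  assumes c1: "e * x1 ^ 2 + y1 ^ 2 + e * x1 ^ 2 * y1 ^ 2 = 1" and c2: "e * x2 ^ 2 + y2 ^ 2 + e * x2 ^ 2 * y2 ^ 2 = 1" and c3: "e * x3 ^ 2 + y3 ^ 2 + e * x3 ^ 2 * y3 ^ 2 = 1"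
  shows "((y1 * y2 - e * x1 * x2) * (1 - e * x1 * x2 * y1 * y2) * y3 - e * x3 * ((x1 * y2 + x2 * y1) * (1 + e * x1 * x2 * y1 * y2))) * ((1 - e * x2 * x3 * y2 * y3) * (1 + e * x2 * x3 * y2 * y3) + e * x1 * y1 * ((x2 * y3 + x3 * y2) * (y2 * y3 - e * x2 * x3)))
    = ((y2 * y3 - e * x2 * x3) * (1 - e * x2 * x3 * y2 * y3) * y1 - e * x1 * ((x2 * y3 + x3 * y2) * (1 + e * x2 * x3 * y2 * y3))) * ((1 - e * x1 * x2 * y1 * y2) * (1 + e * x1 * x2 * y1 * y2) + e * x3 * y3 * ((x1 * y2 + x2 * y1) * (y1 * y2 - e * x1 * x2)))"
  using assms by Groebner_Basis.algebra

text \<open>Written with \<open>S = y (1 + e x^2)\<close>, this is the addition theorem of the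
  lemniscate sine: the first coordinate of a sum is
  \<open>(x1 S2 + x2 S1) / (1 + (e x1 x2)^2)\<close>.\<close>

lemma edwards_add_lemniscate:
  fixes e x1 y1 x2 y2 :: "'a::field_char_0"
  assumes c1: "e * x1 ^ 2 + y1 ^ 2 + e * x1 ^ 2 * y1 ^ 2 = 1" and c2: "e * x2 ^ 2 + y2 ^ 2 + e * x2 ^ 2 * y2 ^ 2 = 1"
  shows "(x1 * y2 + x2 * y1) * (1 + e ^ 2 * x1 ^ 2 * x2 ^ 2)
    = (x1 * (y2 * (1 + e * x2 ^ 2)) + x2 * (y1 * (1 + e * x1 ^ 2))) * (1 - e * x1 * x2 * y1 * y2)"
  using assms by Groebner_Basis.algebra

locale padic_edwards = padic_3mod4 p v for p :: nat and v :: "'k::field_char_0 \<Rightarrow> real" +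
  fixes e :: 'k
  assumes e_cases: "e = 1 \<or> e = of_nat p"
begin

definition curve :: "('k \<times> 'k) set" where
  "curve = {(x, y). e * x\<^sup>2 + y\<^sup>2 + e * x\<^sup>2 * y\<^sup>2 = 1}"

definition point_add :: "'k \<times> 'k \<Rightarrow> 'k \<times> 'k \<Rightarrow> 'k \<times> 'k" where
  "point_add P Q = (case P of (x1, y1) \<Rightarrow> case Q of (x2, y2) \<Rightarrow>
     ((x1 * y2 + x2 * y1) / (1 - e * x1 * x2 * y1 * y2), (y1 * y2 - e * x1 * x2) / (1 + e * x1 * x2 * y1 * y2)))"

definition E :: "('k \<times> 'k) monoid" where
  "E = \<lparr>carrier = curve, mult = point_add, one = (0, 1)\<rparr>"

lemma E_simps [simp]:
  "carrier E = curve" "\<one>\<^bsub>E\<^esub> = (0, 1)" "P \<otimes>\<^bsub>E\<^esub> Q = point_add P Q"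
  by (simp_all add: E_def)

lemma v_e: "v e \<le> 1" "e \<noteq> 0"
proof -
  show "v e \<le> 1" using e_cases v_of_nat_le[of p] by (elim disjE) simp_all
  show "e \<noteq> 0" using e_cases prime_gt_0_nat[OF prime_p] by (elim disjE) simp_all
qed

lemma v_one_plus_ge: "1 \<le> v (1 + y\<^sup>2)" "v (1 + y\<^sup>2) \<le> 1 \<Longrightarrow> v y \<le> 1"
proof -
  have e: "v (1 + y\<^sup>2) = (max 1 (v y))\<^sup>2" using v_sum_squares[of 1 y] by simp
  show "1 \<le> v (1 + y\<^sup>2)" unfolding e by (simp add: one_le_power)
  show "v y \<le> 1" if "v (1 + y\<^sup>2) \<le> 1"
    using that unfolding e by (smt (verit) max_def one_less_power pos2)
qed

text \<open>If \<open>e = p\<close> and \<open>v x > 1\<close>, discreteness gives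
  \<open>v x \<ge> p\<close>; the square of \<open>v x\<close> then outweighs the factor
  \<open>1 / p\<close>, and \<open>e x^2\<close> dominates 1.\<close>

lemma v_one_plus_e_ge: "1 \<le> v (1 + e * x\<^sup>2)" "v (1 + e * x\<^sup>2) \<le> 1 \<Longrightarrow> v x \<le> 1"
proof -
  have "1 \<le> v (1 + e * x\<^sup>2) \<and> (v (1 + e * x\<^sup>2) \<le> 1 \<longrightarrow> v x \<le> 1)"
  proof (cases "e = 1")
    case True
    then show ?thesis using v_one_plus_ge[of x] by simp
  next
    case False
    hence e: "e = of_nat p" using e_cases by simp
    have ve: "v (e * x\<^sup>2) = (v x)\<^sup>2 / real p" by (simp add: e v_mult v_power v_p)
    show ?thesis
    proof (cases "v x \<le> 1")
      case True
      have "(v x)\<^sup>2 / real p < 1"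
        using True v_nonneg[of x] p_gt_1 power_le_one[of "v x" 2] by (simp add: field_simps)
      hence "v (1 + e * x\<^sup>2) = v 1" by (intro v_add_eq) (simp add: ve)
      thus ?thesis using True by simp
    next
      case False
      hence "v (1 / x) < 1" using v_nonneg[of x] by (simp add: v_divide)
      hence "1 / v x \<le> 1 / real p" using v_less_1_imp[of "1 / x"] by (simp add: v_divide)
      hence "real p \<le> v x" using False p_gt_1 by (simp add: field_simps)
      hence "real p * v x \<le> v x * v x" using v_nonneg by (intro mult_right_mono) auto
      hence "v x \<le> (v x)\<^sup>2 / real p" using p_gt_1 by (simp add: power2_eq_square field_simps)
      hence "v x \<le> v (e * x\<^sup>2)" unfolding ve .
      hence "v 1 < v (e * x\<^sup>2)" using False by simp
      hence "v (e * x\<^sup>2 + 1) = v (e * x\<^sup>2)" by (rule v_add_eq)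
      thus ?thesis using \<open>v 1 < v (e * x\<^sup>2)\<close> by (simp add: add.commute)
    qed
  qed
  thus "1 \<le> v (1 + e * x\<^sup>2)" "v (1 + e * x\<^sup>2) \<le> 1 \<Longrightarrow> v x \<le> 1" by auto
qed

text \<open>The curve equation says \<open>(1 + e x^2) (1 + y^2) = 2\<close>. The right side is a
  unit and neither factor on the left has absolute value below 1, so both are units; this forces all
  points to be integral.\<close>

lemma curveD:
  assumes "(x, y) \<in> curve"
  shows "e * x\<^sup>2 + y\<^sup>2 + e * x\<^sup>2 * y\<^sup>2 = 1" "v x \<le> 1" "v y \<le> 1" "v (1 + e * x\<^sup>2) = 1" "v (1 + y\<^sup>2) = 1"
proof -
  show c: "e * x\<^sup>2 + y\<^sup>2 + e * x\<^sup>2 * y\<^sup>2 = 1" using assms by (simp add: curve_def)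
  have "(1 + e * x\<^sup>2) * (1 + y\<^sup>2) = 1 + (e * x\<^sup>2 + y\<^sup>2 + e * x\<^sup>2 * y\<^sup>2)" by (simp add: algebra_simps)
  hence "v (1 + e * x\<^sup>2) * v (1 + y\<^sup>2) = 1" unfolding c by (simp add: v_two flip: v_mult)
  hence "v (1 + e * x\<^sup>2) = 1 \<and> v (1 + y\<^sup>2) = 1"
    using v_one_plus_ge(1)[of y] v_one_plus_e_ge(1)[of x]
    mult_mono[of 1 "v (1 + e * x\<^sup>2)" "v (1 + y\<^sup>2)" "v (1 + y\<^sup>2)"]
    mult_mono[of "v (1 + e * x\<^sup>2)" "v (1 + e * x\<^sup>2)" 1 "v (1 + y\<^sup>2)"] by simp
  thus "v (1 + e * x\<^sup>2) = 1" "v (1 + y\<^sup>2) = 1" by auto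
  thus "v x \<le> 1" "v y \<le> 1" by (simp_all only: v_one_plus_ge(2)[of y] v_one_plus_e_ge(2)[of x] order_refl)
qed

text \<open>For \<open>e = p\<close> the product in question is small. For \<open>e = 1\<close> a
  small \<open>1 - a b\<close>, where \<open>a = x1 y1\<close> and \<open>b = x2 y2\<close>, would
  force \<open>x1\<close> and hence \<open>a b\<close> to be small, which is absurd.\<close>

lemma denominator_unit:
  assumes P: "(x1, y1) \<in> curve" and Q: "(x2, y2) \<in> curve"
  shows "v (1 - e * x1 * x2 * y1 * y2) = 1"
proof -
  note c1 = curveD[OF P] and c2 = curveD[OF Q]
  have le: "v (x1 * x2 * y1 * y2) \<le> 1" using c1 c2 by (intro v_mult_le_1)
  show ?thesis
  proof (cases "e = 1")
    case False
    hence "v e < 1" using e_cases p_gt_1 by (auto simp: v_p)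
    hence "v (e * (x1 * x2 * y1 * y2)) < 1" using le by (rule v_mult_less_1)
    thus ?thesis using v_add_eq[of "- (e * x1 * x2 * y1 * y2)" 1] by (simp add: v_minus mult.assoc)
  next
    case e: True
    define a b where "a = x1 * y1" and "b = x2 * y2"
    have va: "v a \<le> 1" and vb: "v b \<le> 1" unfolding a_def b_def using c1 c2 by (auto intro: v_mult_le_1)
    have ab: "1 - e * x1 * x2 * y1 * y2 = 1 - a * b" by (simp add: e a_def b_def mult_ac)
    have "v (1 - a * b) \<le> 1" by (rule v_diff_le) (use va vb in \<open>auto intro: v_mult_le_1\<close>)
    moreover have "\<not> v (1 - a * b) < 1"
    proof
      assume lt: "v (1 - a * b) < 1"
      have s1: "x1\<^sup>2 + y1\<^sup>2 = 1 - a\<^sup>2" and s2: "x2\<^sup>2 + y2\<^sup>2 = 1 - b\<^sup>2"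
        using c1(1) c2(1) by (simp_all add: e a_def b_def power_mult_distrib algebra_simps)
      \<comment> \<open>On the curve these two sums of squares are multiples of
        \<open>1 - a * b\<close>. If that is small, so is each summand by
        \<open>v_sum_squares\<close>, hence \<open>x1 + y1\<close> and \<open>x1 - y1\<close>, and
        finally \<open>x1\<close>.\<close>
      have 1: "(x1 + y1)\<^sup>2 + (a * (x2 - y2))\<^sup>2 = (1 - a * b) * ((1 + a * b) + 2 * a)"
        using s1 s2 a_def b_def by Groebner_Basis.algebra
      have 2: "(x1 - y1)\<^sup>2 + (a * (x2 + y2))\<^sup>2 = (1 - a * b) * ((1 + a * b) - 2 * a)"
        using s1 s2 a_def b_def by Groebner_Basis.algebra
      have i: "v (1 + a * b) \<le> 1" "v (2 * a) \<le> 1"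
        using va vb v_two by (auto intro!: v_add_le v_mult_le_1)
      have small: "v c < 1" if "c\<^sup>2 + d\<^sup>2 = (1 - a * b) * w" "v w \<le> 1" for c d w
      proof -
        have "(max (v c) (v d))\<^sup>2 < 1"
          using v_mult_less_1[OF lt that(2)] v_sum_squares[of c d] that(1) by simp
        hence "max (v c) (v d) < 1" using v_nonneg[of c] by (smt (verit) max_def one_le_power)
        thus ?thesis by simp
      qed
      have "v (x1 + y1) < 1" by (rule small[OF 1]) (use i in \<open>auto intro: v_add_le\<close>)
      moreover have "v (x1 - y1) < 1" by (rule small[OF 2]) (use i in \<open>auto intro: v_diff_le\<close>)
      ultimately have "v ((x1 + y1) + (x1 - y1)) < 1" by (rule v_add_less)
      hence "v x1 < 1" using v_two by (simp add: v_mult flip: mult_2)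
      hence "v (a * b) < 1" unfolding a_def using c1 vb by (intro v_mult_less_1)
      hence "v (1 - a * b + a * b) < 1" using lt by (intro v_add_less)
      thus False by simp
    qed
    ultimately show ?thesis unfolding ab by linarith
  qed
qed

lemma point_neg_curve: "(x, y) \<in> curve \<Longrightarrow> (- x, y) \<in> curve"
  by (simp add: curve_def)

lemma denominator_unit':
  assumes "(x1, y1) \<in> curve" "(x2, y2) \<in> curve"
  shows "v (1 + e * x1 * x2 * y1 * y2) = 1"
  using denominator_unit[OF point_neg_curve[OF assms(1)] assms(2)] by simp

lemma denominators_nonzero:
  assumes "(x1, y1) \<in> curve" "(x2, y2) \<in> curve"
  shows "1 - e * x1 * x2 * y1 * y2 \<noteq> 0" "1 + e * x1 * x2 * y1 * y2 \<noteq> 0"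
  using denominator_unit[OF assms] denominator_unit'[OF assms] by auto

lemma point_add_closed:
  assumes P: "P \<in> curve" and Q: "Q \<in> curve"
  shows "point_add P Q \<in> curve"
proof -
  obtain x1 y1 where P1: "P = (x1, y1)" by (cases P)
  obtain x2 y2 where Q1: "Q = (x2, y2)" by (cases Q)
  note PQ = P1 Q1
  note nz = denominators_nonzero[OF P[unfolded PQ] Q[unfolded PQ]]
  note id = edwards_add_closed[OF curveD(1)[OF P[unfolded PQ]] curveD(1)[OF Q[unfolded PQ]]]
  have *: "e * (A / B)\<^sup>2 + (C / D)\<^sup>2 + e * (A / B)\<^sup>2 * (C / D)\<^sup>2 = 1"
    if "e * (A * D)\<^sup>2 + (C * B)\<^sup>2 + e * (A * C)\<^sup>2 = (B * D)\<^sup>2" "B \<noteq> 0" "D \<noteq> 0" for A B C D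
  proof -
    have "e * (A / B)\<^sup>2 + (C / D)\<^sup>2 + e * (A / B)\<^sup>2 * (C / D)\<^sup>2
      = (e * (A * D)\<^sup>2 + (C * B)\<^sup>2 + e * (A * C)\<^sup>2) / (B * D)\<^sup>2"
      using that(2,3) by (simp add: field_simps power2_eq_square)
    thus ?thesis unfolding that(1) using that(2,3) by simp
  qed
  show ?thesis
    unfolding PQ curve_def point_add_def using *[OF id nz] by simp
qed

lemma point_add_commute: "point_add P Q = point_add Q P"
  by (cases P; cases Q) (simp add: point_add_def mult_ac add_ac)

text \<open>By commutativity both sides are instances of one computation, a point with fractional
  coordinates plus a further point; cross multiplication leaves \<open>edwards_assoc_x\<close> and
  \<open>edwards_assoc_y\<close>.\<close>

lemma point_add_assoc:
  assumes P: "P \<in> curve" and Q: "Q \<in> curve" and R: "R \<in> curve"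
  shows "point_add (point_add P Q) R = point_add P (point_add Q R)"
proof -
  obtain x1 y1 where P1: "P = (x1, y1)" by (cases P)
  obtain x2 y2 where Q1: "Q = (x2, y2)" by (cases Q)
  obtain x3 y3 where R1: "R = (x3, y3)" by (cases R)
  note PQR = P1 Q1 R1
  note P' = P[unfolded PQR] and Q' = Q[unfolded PQR] and R' = R[unfolded PQR]
  define A1 A2 D1 D2 where A: "A1 = x1 * y2 + x2 * y1" "A2 = y1 * y2 - e * x1 * x2"
    "D1 = 1 - e * x1 * x2 * y1 * y2" "D2 = 1 + e * x1 * x2 * y1 * y2"
  define B1 B2 F1 F2 where B: "B1 = x2 * y3 + x3 * y2" "B2 = y2 * y3 - e * x2 * x3"
    "F1 = 1 - e * x2 * x3 * y2 * y3" "F2 = 1 + e * x2 * x3 * y2 * y3"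
  have nz: "D1 \<noteq> 0" "D2 \<noteq> 0" "F1 \<noteq> 0" "F2 \<noteq> 0"
    unfolding A B using denominators_nonzero[OF P' Q'] denominators_nonzero[OF Q' R'] by auto
  have PQ: "point_add P Q = (A1 / D1, A2 / D2)" and QR: "point_add Q R = (B1 / F1, B2 / F2)"
    by (simp_all add: PQR point_add_def A B)
  have PQc: "(A1 / D1, A2 / D2) \<in> curve" and QRc: "(B1 / F1, B2 / F2) \<in> curve"
    using point_add_closed[OF P Q] point_add_closed[OF Q R] by (simp_all add: PQ QR)
  have *: "point_add (a / d, b / f) (x, y) =
      ((a * f * y + x * (b * d)) / (d * f - e * x * y * (a * b)), (b * d * y - e * x * (a * f)) / (d * f + e * x * y * (a * b)))
      \<and> d * f - e * x * y * (a * b) \<noteq> 0 \<and> d * f + e * x * y * (a * b) \<noteq> 0"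
    if "(a / d, b / f) \<in> curve" "(x, y) \<in> curve" "d \<noteq> 0" "f \<noteq> 0" for a b d f x y
  proof -
    note n = denominators_nonzero[OF that(1,2)]
    have 1: "d * f - e * x * y * (a * b) = (1 - e * (a / d) * x * (b / f) * y) * (d * f)"
      and 2: "d * f + e * x * y * (a * b) = (1 + e * (a / d) * x * (b / f) * y) * (d * f)"
      and 3: "a * f * y + x * (b * d) = (a / d * y + x * (b / f)) * (d * f)"
      and 4: "b * d * y - e * x * (a * f) = (b / f * y - e * (a / d) * x) * (d * f)"
      using that(3,4) by (simp_all add: field_simps)
    show ?thesis unfolding 1 2 3 4 using n that(3,4)
      by (simp add: point_add_def del: times_divide_eq_left times_divide_eq_right)
  qed
  note l = *[OF PQc R' nz(1,2)] and r = *[OF QRc P' nz(3,4)]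
  note cs = curveD(1)[OF P'] curveD(1)[OF Q'] curveD(1)[OF R']
  have X: "(A1 * D2 * y3 + x3 * (A2 * D1)) * (F1 * F2 - e * x1 * y1 * (B1 * B2))
      = (B1 * F2 * y1 + x1 * (B2 * F1)) * (D1 * D2 - e * x3 * y3 * (A1 * A2))"
    unfolding A B using edwards_assoc_x[OF cs] by (simp only: add.commute)
  have Y: "(A2 * D1 * y3 - e * x3 * (A1 * D2)) * (F1 * F2 + e * x1 * y1 * (B1 * B2))
      = (B2 * F1 * y1 - e * x1 * (B1 * F2)) * (D1 * D2 + e * x3 * y3 * (A1 * A2))"
    unfolding A B by (rule edwards_assoc_y[OF cs])
  have "point_add (point_add P Q) R = point_add (point_add Q R) P"
    unfolding PQ QR unfolding P1 R1 using l r X Y by (simp add: frac_eq_eq)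
  thus ?thesis by (simp add: point_add_commute)
qed

lemma zero_curve: "(0, 1) \<in> curve" by (simp add: curve_def)

lemma point_add_zero: "point_add (0, 1) P = P"
  by (cases P) (simp add: point_add_def)

lemma point_add_neg:
  assumes "(x, y) \<in> curve"
  shows "point_add (- x, y) (x, y) = (0, 1)"
proof -
  have "1 + e * (- x) * x * y * y \<noteq> 0"
    using denominators_nonzero[OF point_neg_curve[OF assms] assms] by simp
  thus ?thesis using curveD(1)[OF assms] by (simp add: point_add_def power2_eq_square algebra_simps)
qed

sublocale E: comm_group E
proof (rule comm_groupI; simp)
  fix P assume "P \<in> curve"
  thus "\<exists>Q\<in>curve. point_add Q P = (0, 1)"
    using point_add_neg point_neg_curve by (cases P) blast
qed (auto simp: point_add_closed point_add_assoc zero_curve point_add_zero intro: point_add_commute)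

lemma inv_E: "(x, y) \<in> curve \<Longrightarrow> inv\<^bsub>E\<^esub> (x, y) = (- x, y)"
  using E.inv_equality[of "(- x, y)" "(x, y)"] by (simp add: point_add_neg point_neg_curve)

end

section \<open>The kernel of reduction\<close>

context padic_edwards
begin

text \<open>For \<open>e = 1\<close> this is the kernel of reduction modulo \<open>p\<close>. For
  \<open>e = p\<close> the first coordinate is not constrained, but \<open>e x^2\<close> is still
  small, so that the same estimates serve both cases.\<close>

definition F :: "('k \<times> 'k) set" where
  "F = {P \<in> curve. v (snd P - 1) < 1}"

text \<open>This is the chart coordinate \<open>S\<close>, the second coordinate of the model
  \<open>S^2 = 1 - (e x^2)^2\<close>, in which the addition law makes \<open>x\<close> approximately
  additive.\<close>

definition lemniscate_S :: "'k \<times> 'k \<Rightarrow> 'k" where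
  "lemniscate_S P = snd P * (1 + e * (fst P)\<^sup>2)"

lemma F_subset: "F \<subseteq> curve" by (auto simp: F_def)

lemma lemniscate_S_square:
  assumes "(x, y) \<in> curve"
  shows "(lemniscate_S (x, y))\<^sup>2 = 1 - (e * x\<^sup>2)\<^sup>2"
  using curveD(1)[OF assms] unfolding lemniscate_S_def fst_conv snd_conv by Groebner_Basis.algebra

text \<open>The exponent 2 in the second bound arises because \<open>1 - S\<close> equals the square
  \<open>(e x^2)^2\<close> up to the unit \<open>1 + S\<close>.\<close>

lemma F_bounds:
  assumes F: "(x, y) \<in> F"
  shows "v (e * x\<^sup>2) < 1" "v (lemniscate_S (x, y) - 1) \<le> 1 / (real p)\<^sup>2"
proof -
  have c: "(x, y) \<in> curve" and y1: "v (y - 1) < 1" using F by (auto simp: F_def)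
  note cD = curveD[OF c]
  have "e * x\<^sup>2 * (1 + y\<^sup>2) = (1 - y) * (1 + y)" using cD(1) by (simp add: power2_eq_square algebra_simps)
  hence "v (e * x\<^sup>2) = v ((y - 1) * (1 + y))"
    using cD(5) by (metis mult_cancel_left2 v_diff_commute v_mult mult.right_neutral)
  also have "\<dots> < 1" using y1 cD(3) by (intro v_mult_less_1 v_add_le) auto
  finally show ex: "v (e * x\<^sup>2) < 1" .
  define S where "S = lemniscate_S (x, y)"
  have "S - 1 = (y - 1) * (1 + e * x\<^sup>2) + e * x\<^sup>2" by (simp add: S_def lemniscate_S_def algebra_simps)
  hence S1: "v (S - 1) < 1" using ex y1 cD(4) by (auto intro!: v_add_less v_mult_less_1)
  hence "v (2 + (S - 1)) = v 2" using v_two by (intro v_add_eq) simp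
  hence S2: "v (1 + S) = 1" using v_two by simp
  have "(1 - S) * (1 + S) = (e * x\<^sup>2)\<^sup>2"
    using lemniscate_S_square[OF c] by (simp add: S_def power2_eq_square algebra_simps)
  hence "v (1 - S) * v (1 + S) = (v (e * x\<^sup>2))\<^sup>2" by (metis v_mult v_power)
  hence "v (S - 1) = (v (e * x\<^sup>2))\<^sup>2" using S2 by (simp add: v_diff_commute)
  also have "\<dots> \<le> (1 / real p)\<^sup>2" using v_less_1_imp[OF ex] v_nonneg by (intro power_mono)
  finally show "v (lemniscate_S (x, y) - 1) \<le> 1 / (real p)\<^sup>2" by (simp add: S_def power_divide)
qed

lemma fst_point_add:
  assumes P: "(x1, y1) \<in> curve" and Q: "(x2, y2) \<in> curve"
  shows "fst (point_add (x1, y1) (x2, y2)) =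
    (x1 * lemniscate_S (x2, y2) + x2 * lemniscate_S (x1, y1)) / (1 + (e * x1 * x2)\<^sup>2)"
proof -
  have "(x1 * y2 + x2 * y1) * (1 + (e * x1 * x2)\<^sup>2)
     = (x1 * lemniscate_S (x2, y2) + x2 * lemniscate_S (x1, y1)) * (1 - e * x1 * x2 * y1 * y2)"
    using edwards_add_lemniscate[OF curveD(1)[OF P] curveD(1)[OF Q]]
    by (simp add: lemniscate_S_def power_mult_distrib mult_ac)
  thus ?thesis
    using denominators_nonzero(1)[OF P Q] one_plus_square_nonzero[of "e * x1 * x2"]
    by (simp add: point_add_def frac_eq_eq)
qed

text \<open>On \<open>F\<close> the coordinate \<open>x\<close> takes the place of the formal
  logarithm: it is additive up to a relative error \<open>p^-2\<close>, which is smaller than the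
  factor \<open>1 / p\<close> contributed by multiplication by \<open>p\<close>.\<close>

lemma fst_point_add_F:
  assumes P: "P \<in> F" and Q: "Q \<in> F"
  shows "v (fst (point_add P Q) - (fst P + fst Q)) \<le> max (v (fst P)) (v (fst Q)) / (real p)\<^sup>2"
proof -
  obtain x1 y1 where P1: "P = (x1, y1)" by (cases P)
  obtain x2 y2 where Q1: "Q = (x2, y2)" by (cases Q)
  have PF: "(x1, y1) \<in> F" and QF: "(x2, y2) \<in> F" using P Q by (simp_all add: P1 Q1)
  hence Pc: "(x1, y1) \<in> curve" and Qc: "(x2, y2) \<in> curve" using F_subset by auto
  define S1 S2 where "S1 = lemniscate_S (x1, y1)" and "S2 = lemniscate_S (x2, y2)"
  define q where "q = (e * x1 * x2)\<^sup>2"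
  define M where "M = max (v x1) (v x2)"
  define c where "c = 1 / (real p)\<^sup>2"
  have M: "v x1 \<le> M" "v x2 \<le> M" "0 \<le> M" using v_nonneg[of x1] by (auto simp: M_def)
  have c: "0 \<le> c" by (simp add: c_def)
  have "q = (e * x1\<^sup>2) * (e * x2\<^sup>2)" by (simp add: q_def power2_eq_square mult_ac)
  hence "v q = v (e * x1\<^sup>2) * v (e * x2\<^sup>2)" by (simp only: v_mult)
  also have "\<dots> \<le> (1 / real p) * (1 / real p)"
    using v_less_1_imp[OF F_bounds(1)[OF PF]] v_less_1_imp[OF F_bounds(1)[OF QF]] v_nonneg
    by (intro mult_mono) auto
  finally have q: "v q \<le> c" by (simp add: c_def power2_eq_square)
  have qc: "c < 1" using p_gt_1 by (simp add: c_def power_gt1_lemma one_less_power)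
  have "v (1 + q) = v 1" using q qc by (intro v_add_eq) simp
  hence d1: "v (1 + q) = 1" by simp
  hence d0: "1 + q \<noteq> 0" by auto
  have "fst (point_add P Q) - (fst P + fst Q) =
     (x1 * (S2 - 1) + x2 * (S1 - 1) - (x1 + x2) * q) / (1 + q)"
    unfolding P1 Q1 fst_point_add[OF Pc Qc] S1_def[symmetric] S2_def[symmetric] q_def[symmetric] fst_conv
    using d0 by (simp add: field_simps)
  hence "v (fst (point_add P Q) - (fst P + fst Q)) = v (x1 * (S2 - 1) + x2 * (S1 - 1) - (x1 + x2) * q)"
    by (simp add: v_divide d1)
  also have "\<dots> \<le> M * c"
  proof (intro v_diff_le v_add_le)
    have s: "v (S1 - 1) \<le> c" "v (S2 - 1) \<le> c"
      using F_bounds(2)[OF PF] F_bounds(2)[OF QF] by (simp_all add: S1_def S2_def c_def)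
    have "v x1 * v (S2 - 1) \<le> M * c" "v x2 * v (S1 - 1) \<le> M * c"
      using M s v_nonneg by (auto intro!: mult_mono)
    thus "v (x1 * (S2 - 1)) \<le> M * c" "v (x2 * (S1 - 1)) \<le> M * c" by (simp_all add: v_mult)
    have "v (x1 + x2) \<le> M" using M by (intro v_add_le)
    hence "v (x1 + x2) * v q \<le> M * c" using M q v_nonneg by (intro mult_mono) auto
    thus "v ((x1 + x2) * q) \<le> M * c" by (simp add: v_mult)
  qed
  finally show ?thesis by (simp add: M_def c_def P1 Q1)
qed

lemma F_add:
  assumes P: "P \<in> F" and Q: "Q \<in> F"
  shows "point_add P Q \<in> F"
proof -
  obtain x1 y1 where P1: "P = (x1, y1)" by (cases P)
  obtain x2 y2 where Q1: "Q = (x2, y2)" by (cases Q)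
  have PF: "(x1, y1) \<in> F" and QF: "(x2, y2) \<in> F" using P Q by (simp_all add: P1 Q1)
  hence Pc: "(x1, y1) \<in> curve" and Qc: "(x2, y2) \<in> curve" using F_subset by auto
  have y: "v (y1 - 1) < 1" "v (y2 - 1) < 1" using PF QF by (auto simp: F_def)
  have "v ((e * x1 * x2)\<^sup>2) = v (e * x1\<^sup>2) * v (e * x2\<^sup>2)"
    by (simp add: power2_eq_square v_mult mult_ac)
  also have "\<dots> < 1"
    using F_bounds(1)[OF PF] F_bounds(1)[OF QF] v_nonneg
    by (metis less_imp_le v_mult v_mult_less_1)
  finally have "(v (e * x1 * x2))\<^sup>2 < 1" by (simp add: v_power)
  hence ex: "v (e * x1 * x2) < 1" using v_nonneg by (simp add: power2_less_1_iff)
  have d: "v (1 + e * x1 * x2 * y1 * y2) = 1" by (rule denominator_unit'[OF Pc Qc])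
  hence d0: "1 + e * x1 * x2 * y1 * y2 \<noteq> 0" by auto
  have "snd (point_add P Q) - 1 =
    ((y1 - 1) * y2 + (y2 - 1) - (e * x1 * x2) * (1 + y1 * y2)) / (1 + e * x1 * x2 * y1 * y2)"
    using d0 by (simp add: P1 Q1 point_add_def field_simps)
  hence "v (snd (point_add P Q) - 1) = v ((y1 - 1) * y2 + (y2 - 1) - (e * x1 * x2) * (1 + y1 * y2))"
    by (simp add: v_divide d)
  also have "\<dots> < 1"
  proof (rule v_diff_less[OF v_add_less[OF _ y(2)]])
    show "v ((y1 - 1) * y2) < 1" by (rule v_mult_less_1[OF y(1) curveD(3)[OF Qc]])
    have "v (1 + y1 * y2) \<le> 1"
      by (rule v_add_le[OF _ v_mult_le_1[OF curveD(3)[OF Pc] curveD(3)[OF Qc]]]) simp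
    thus "v (e * x1 * x2 * (1 + y1 * y2)) < 1" by (rule v_mult_less_1[OF ex])
  qed
  finally show ?thesis
    using point_add_closed[OF Pc Qc] by (simp add: F_def P1 Q1)
qed

lemma F_neg: "P \<in> F \<Longrightarrow> inv\<^bsub>E\<^esub> P \<in> F"
  by (cases P) (auto simp: F_def inv_E point_neg_curve)

lemma F_zero: "(0, 1) \<in> F"
  by (simp add: F_def zero_curve)

lemma subgroup_F: "subgroup F E"
  by (rule E.subgroupI) (use F_subset F_zero F_add F_neg in auto)

lemma fst_inv: "P \<in> curve \<Longrightarrow> fst (inv\<^bsub>E\<^esub> P) = - fst P"
  by (cases P) (simp add: inv_E)

lemma F_eq_zero:
  assumes P: "P \<in> F" and x: "fst P = 0"
  shows "P = (0, 1)"
proof -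
  obtain y where Py: "P = (0, y)" using x by (cases P) auto
  have "y\<^sup>2 = 1" using P by (simp add: Py F_def curve_def)
  moreover have "y \<noteq> - 1"
  proof
    assume "y = - 1"
    hence "v (- 2) < 1" using P by (simp add: Py F_def)
    thus False using v_two by (simp add: v_minus)
  qed
  ultimately show ?thesis by (simp add: Py power2_eq_1_iff)
qed

lemma fst_sub_F:
  assumes P: "P \<in> F" and Q: "Q \<in> F"
  shows "v (fst (point_add P (inv\<^bsub>E\<^esub> Q)) - (fst P - fst Q)) \<le> max (v (fst P)) (v (fst Q)) / (real p)\<^sup>2"
  using fst_point_add_F[OF P F_neg[OF Q]] Q F_subset by (auto simp: fst_inv v_minus)

lemma F_pow: "P \<in> F \<Longrightarrow> P [^]\<^bsub>E\<^esub> (n::nat) \<in> F"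
proof (induction n)
  case 0
  then show ?case using F_zero by simp
next
  case (Suc n)
  then show ?case using F_add by (simp add: E.nat_pow_Suc)
qed

lemma inverse_p2_less: "1 / (real p)\<^sup>2 < 1 / real p" "1 / (real p)\<^sup>2 \<le> 1"
  using p_gt_1 one_le_power[of "real p" 2] by (simp_all add: power2_eq_square field_simps)

lemma fst_pow_F:
  assumes P: "P \<in> F"
  shows "v (fst (P [^]\<^bsub>E\<^esub> (n::nat)) - of_nat n * fst P) \<le> v (fst P) / (real p)\<^sup>2"
    and "v (fst (P [^]\<^bsub>E\<^esub> n)) \<le> v (fst P)"
proof -
  have le: "v (fst P) / (real p)\<^sup>2 \<le> v (fst P)"
    using mult_left_le[OF inverse_p2_less(2) v_nonneg[of "fst P"]] by simp
  have "v (fst (P [^]\<^bsub>E\<^esub> n) - of_nat n * fst P) \<le> v (fst P) / (real p)\<^sup>2 \<and> v (fst (P [^]\<^bsub>E\<^esub> n)) \<le> v (fst P)"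
  proof (induction n)
    case 0
    then show ?case using v_nonneg by simp
  next
    case (Suc n)
    let ?Q = "P [^]\<^bsub>E\<^esub> n"
    have "v (fst (point_add ?Q P) - (fst ?Q + fst P)) \<le> max (v (fst ?Q)) (v (fst P)) / (real p)\<^sup>2"
      by (rule fst_point_add_F[OF F_pow[OF P] P])
    also have "max (v (fst ?Q)) (v (fst P)) = v (fst P)" using Suc by simp
    finally have 1: "v (fst (point_add ?Q P) - (fst ?Q + fst P)) \<le> v (fst P) / (real p)\<^sup>2" .
    have "v ((fst (point_add ?Q P) - (fst ?Q + fst P)) + (fst ?Q - of_nat n * fst P)) \<le> v (fst P) / (real p)\<^sup>2"
      using 1 Suc by (intro v_add_le) auto
    hence a: "v (fst (P [^]\<^bsub>E\<^esub> Suc n) - of_nat (Suc n) * fst P) \<le> v (fst P) / (real p)\<^sup>2"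
      by (simp add: E.nat_pow_Suc algebra_simps)
    have "v (of_nat (Suc n) * fst P) \<le> v (fst P)"
      unfolding v_mult using v_of_nat_le[of "Suc n"] v_nonneg[of "fst P"] by (intro mult_left_le_one_le v_nonneg)
    hence "v ((fst (P [^]\<^bsub>E\<^esub> Suc n) - of_nat (Suc n) * fst P) + of_nat (Suc n) * fst P) \<le> v (fst P)"
      using a le by (intro v_add_le) auto
    with a show ?case by simp
  qed
  thus "v (fst (P [^]\<^bsub>E\<^esub> n) - of_nat n * fst P) \<le> v (fst P) / (real p)\<^sup>2"
    and "v (fst (P [^]\<^bsub>E\<^esub> n)) \<le> v (fst P)" by auto
qed

text \<open>Since the relative error \<open>p^-2\<close> lies strictly below
  \<open>v p = 1 / p\<close>, the term \<open>p x\<close> dominates and multiplication by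
  \<open>p\<close> scales \<open>v (fst P)\<close> exactly.\<close>

lemma fst_pow_p_F:
  assumes P: "P \<in> F"
  shows "v (fst (P [^]\<^bsub>E\<^esub> (p ^ k))) = v (fst P) / real p ^ k"
proof (induction k)
  case 0
  then show ?case using P F_subset by (auto simp: E.nat_pow_eone point_add_zero)
next
  case (Suc k)
  let ?Q = "P [^]\<^bsub>E\<^esub> (p ^ k)"
  have Q: "?Q \<in> F" by (rule F_pow[OF P])
  have "v (fst (?Q [^]\<^bsub>E\<^esub> p)) = v (fst ?Q) / real p"
  proof (cases "fst ?Q = 0")
    case True
    hence "?Q = (0, 1)" by (rule F_eq_zero[OF Q])
    then show ?thesis using E.nat_pow_one[of p] by simp
  next
    case False
    have "v (of_nat p * fst ?Q) = v (fst ?Q) / real p" by (simp add: v_mult v_p)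
    moreover have "v (fst (?Q [^]\<^bsub>E\<^esub> p) - of_nat p * fst ?Q) < v (fst ?Q) / real p"
    proof -
      have "v (fst ?Q) * (1 / (real p)\<^sup>2) < v (fst ?Q) * (1 / real p)"
        by (rule mult_strict_left_mono[OF inverse_p2_less(1) v_pos[OF False]])
      thus ?thesis using fst_pow_F(1)[OF Q, of p] by simp
    qed
    ultimately have "v (of_nat p * fst ?Q + (fst (?Q [^]\<^bsub>E\<^esub> p) - of_nat p * fst ?Q)) = v (fst ?Q) / real p"
      by (subst v_add_eq) auto
    thus ?thesis by simp
  qed
  moreover have "?Q [^]\<^bsub>E\<^esub> p = P [^]\<^bsub>E\<^esub> (p ^ Suc k)"
    using P F_subset by (subst E.nat_pow_pow) (auto simp: mult.commute)
  ultimately show ?case using Suc by simp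
qed

text \<open>The nonzero values of \<open>x\<close> on \<open>F\<close> are powers of
  \<open>1 / p\<close>, so the least exponent gives a maximum; if \<open>x\<close> vanishes on
  \<open>F\<close>, the zero point qualifies.\<close>

lemma F_maximal:
  obtains G where "G \<in> F" "\<And>P. P \<in> F \<Longrightarrow> v (fst P) \<le> v (fst G)"
proof (cases "\<exists>P\<in>F. fst P \<noteq> 0")
  case False
  then show ?thesis using that[OF F_zero] by auto
next
  case True
  have val: "\<exists>k::nat. v (fst P) = (1 / real p) ^ k" if P: "P \<in> F" "fst P \<noteq> 0" for P
  proof -
    obtain j where j: "v (fst P) = v (of_nat p) powi j" using value_group[OF P(2)] by blast
    have "v (fst P) \<le> 1" using P(1) F_subset curveD(2)[of "fst P" "snd P"] by auto
    have "0 \<le> j"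
    proof (rule ccontr)
      assume "\<not> 0 \<le> j"
      hence "1 < real p powi (- j)" using p_gt_1 by (intro one_less_power_int) auto
      thus False using \<open>v (fst P) \<le> 1\<close> j by (simp add: v_p divide_inverse power_int_inverse power_int_minus)
    qed
    thus ?thesis using j by (intro exI[of _ "nat j"]) (simp add: v_p power_int_def)
  qed
  let ?A = "\<lambda>k::nat. \<exists>P\<in>F. fst P \<noteq> 0 \<and> v (fst P) = (1 / real p) ^ k"
  define m where "m = (LEAST k. ?A k)"
  have "\<exists>k. ?A k" using True val by blast
  hence "?A m" unfolding m_def by (rule LeastI_ex)
  then obtain G where G: "G \<in> F" "v (fst G) = (1 / real p) ^ m" by blast
  have "v (fst P) \<le> v (fst G)" if P: "P \<in> F" for P
  proof (cases "fst P = 0")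
    case True
    then show ?thesis using v_nonneg by simp
  next
    case False
    then obtain k where k: "v (fst P) = (1 / real p) ^ k" using val[OF P] by blast
    hence "m \<le> k" unfolding m_def using P False by (intro Least_le) blast
    thus ?thesis unfolding k G(2) using p_gt_1 by (intro power_decreasing) auto
  qed
  with G(1) show ?thesis by (rule that)
qed

text \<open>Expansion in p-adic digits: \<open>H\<close>, the multiple of \<open>G\<close> by
  \<open>p^k\<close>, has size \<open>v (fst G) / p^k\<close>, and the residue of
  \<open>fst Q / fst H\<close> is the next digit of \<open>n\<close>.\<close>

lemma F_generator_dense:
  assumes G: "G \<in> F" and max: "\<And>P. P \<in> F \<Longrightarrow> v (fst P) \<le> v (fst G)" and P: "P \<in> F"
  shows "\<exists>n::nat. v (fst (point_add P (inv\<^bsub>E\<^esub> (G [^]\<^bsub>E\<^esub> n)))) \<le> v (fst G) / real p ^ k"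
proof (induction k)
  case 0
  have "point_add P (inv\<^bsub>E\<^esub> (G [^]\<^bsub>E\<^esub> (0::nat))) \<in> F"
    using P F_neg[OF F_zero] by (simp add: F_add)
  from max[OF this] show ?case by (intro exI[of _ 0]) simp
next
  case (Suc k)
  then obtain n :: nat where n: "v (fst (point_add P (inv\<^bsub>E\<^esub> (G [^]\<^bsub>E\<^esub> n)))) \<le> v (fst G) / real p ^ k" by blast
  define Q H where "Q = point_add P (inv\<^bsub>E\<^esub> (G [^]\<^bsub>E\<^esub> n))" and "H = G [^]\<^bsub>E\<^esub> (p ^ k)"
  have Q: "Q \<in> F" unfolding Q_def by (intro F_add P F_neg F_pow G)
  have H: "H \<in> F" unfolding H_def by (intro F_pow G)
  have vH: "v (fst H) = v (fst G) / real p ^ k" unfolding H_def by (rule fst_pow_p_F[OF G])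
  have QH: "v (fst Q) \<le> v (fst H)" using n by (simp add: Q_def vH)
  show ?case
  proof (cases "fst H = 0")
    case True
    hence "v (fst G) = 0" using vH p_gt_1 by simp
    moreover have "v (fst Q) \<le> 0" using QH True by simp
    ultimately show ?thesis by (intro exI[of _ n]) (simp add: Q_def)
  next
    case False
    have "v (fst Q / fst H) \<le> 1" using QH v_pos[OF False] by (simp add: v_divide)
    then obtain m where m: "0 \<le> m" "v (fst Q / fst H - of_int m) < 1" using residue by metis
    define m' where "m' = nat m"
    have "v (fst Q / fst H - of_nat m') \<le> 1 / real p" using v_less_1_imp[OF m(2)] m(1) by (simp add: m'_def)
    hence "v (fst H) * v (fst Q / fst H - of_nat m') \<le> v (fst H) * (1 / real p)"
      using v_nonneg by (rule mult_left_mono)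
    moreover have "fst H * (fst Q / fst H - of_nat m') = fst Q - of_nat m' * fst H"
      using False by (simp add: field_simps)
    ultimately have 1: "v (fst Q - of_nat m' * fst H) \<le> v (fst H) / real p" by (simp flip: v_mult)
    define H' where "H' = H [^]\<^bsub>E\<^esub> m'"
    have H': "H' \<in> F" unfolding H'_def by (rule F_pow[OF H])
    have le: "v (fst H) / (real p)\<^sup>2 \<le> v (fst H) / real p"
      using mult_left_mono[OF less_imp_le[OF inverse_p2_less(1)] v_nonneg[of "fst H"]] by simp
    have 2: "v (fst H' - of_nat m' * fst H) \<le> v (fst H) / real p" and H'H: "v (fst H') \<le> v (fst H)"
      using fst_pow_F[OF H, of m'] le by (auto simp: H'_def)
    have "v (fst (point_add Q (inv\<^bsub>E\<^esub> H')) - (fst Q - fst H')) \<le> max (v (fst Q)) (v (fst H')) / (real p)\<^sup>2"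
      by (rule fst_sub_F[OF Q H'])
    also have "\<dots> \<le> v (fst H) / (real p)\<^sup>2" using QH H'H by (intro divide_right_mono) auto
    finally have 3: "v (fst (point_add Q (inv\<^bsub>E\<^esub> H')) - (fst Q - fst H')) \<le> v (fst H) / real p" using le by simp
    have "v ((fst (point_add Q (inv\<^bsub>E\<^esub> H')) - (fst Q - fst H')) + ((fst Q - of_nat m' * fst H) - (fst H' - of_nat m' * fst H)))
       \<le> v (fst H) / real p"
      by (rule v_add_le[OF 3 v_diff_le[OF 1 2]])
    hence 4: "v (fst (point_add Q (inv\<^bsub>E\<^esub> H'))) \<le> v (fst H) / real p" by simp
    have GE: "G \<in> carrier E" using G F_subset by auto
    have "inv\<^bsub>E\<^esub> (G [^]\<^bsub>E\<^esub> (n + p ^ k * m')) = inv\<^bsub>E\<^esub> (G [^]\<^bsub>E\<^esub> n) \<otimes>\<^bsub>E\<^esub> inv\<^bsub>E\<^esub> H'"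
      unfolding H'_def H_def using GE
      by (simp add: E.nat_pow_pow E.inv_mult flip: E.nat_pow_mult del: E_simps)
    hence "point_add P (inv\<^bsub>E\<^esub> (G [^]\<^bsub>E\<^esub> (n + p ^ k * m'))) = point_add Q (inv\<^bsub>E\<^esub> H')"
      unfolding Q_def
      using point_add_assoc[OF subsetD[OF F_subset P] subsetD[OF F_subset F_neg[OF F_pow[OF G, of n]]]
          subsetD[OF F_subset F_neg[OF H']]] by simp
    with 4 show ?thesis by (intro exI[of _ "n + p ^ k * m'"]) (simp add: vH mult.commute)
  qed
qed

end

section \<open>Integral polynomials and their roots modulo \<open>p\<close>\<close>

context padic_field
begin

definition integral_poly :: "'k poly \<Rightarrow> bool" where
  "integral_poly f \<longleftrightarrow> (\<forall>i. v (Polynomial.coeff f i) \<le> 1)"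

lemma integral_poly_pCons: "integral_poly (pCons a f) \<longleftrightarrow> v a \<le> 1 \<and> integral_poly f"
  unfolding integral_poly_def by (auto simp: Polynomial.coeff_pCons split: nat.splits)

lemma integral_poly_zero: "integral_poly 0" and integral_poly_one: "integral_poly 1"
  by (simp_all add: integral_poly_def Polynomial.coeff_1)

lemma integral_poly_add: "integral_poly f \<Longrightarrow> integral_poly g \<Longrightarrow> integral_poly (f + g)"
  unfolding integral_poly_def by (simp add: v_add_le)

lemma integral_poly_diff: "integral_poly f \<Longrightarrow> integral_poly g \<Longrightarrow> integral_poly (f - g)"
  unfolding integral_poly_def by (simp add: v_diff_le)

lemma integral_poly_smult: "v c \<le> 1 \<Longrightarrow> integral_poly f \<Longrightarrow> integral_poly (Polynomial.smult c f)"
  unfolding integral_poly_def by (simp add: v_mult_le_1)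

lemma integral_poly_mult: "integral_poly f \<Longrightarrow> integral_poly g \<Longrightarrow> integral_poly (f * g)"
proof (induction f)
  case (pCons a f)
  then show ?case
    by (auto simp: integral_poly_pCons mult_pCons_left intro!: integral_poly_add integral_poly_smult)
qed (simp add: integral_poly_zero)

lemma integral_poly_power: "integral_poly f \<Longrightarrow> integral_poly (f ^ n)"
  by (induction n) (auto simp: integral_poly_one integral_poly_mult)

lemma v_poly_le:
  assumes "integral_poly f" "v x \<le> 1"
  shows "v (poly f x) \<le> 1"
  using assms(1)
proof (induction f)
  case (pCons a f)
  then show ?case using assms(2) by (auto simp: integral_poly_pCons intro!: v_add_le v_mult_le_1)
qed simp

lemma integral_synthetic_div:
  assumes "integral_poly f" "v c \<le> 1"
  shows "integral_poly (synthetic_div f c)"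
  using assms(1)
proof (induction f)
  case (pCons a f)
  then show ?case
    using v_poly_le[OF _ assms(2)] by (auto simp: integral_poly_pCons)
qed (simp add: integral_poly_zero)

lemma poly_synthetic_div:
  fixes f :: "'k poly"
  shows "poly f x = (x - c) * poly (synthetic_div f c) x + poly f c"
  using arg_cong[OF synthetic_div_correct'[of c f], of "\<lambda>g. poly g x"] by (simp add: algebra_simps)

lemma v_poly_diff:
  assumes "integral_poly f" "v x \<le> 1" "v c \<le> 1"
  shows "v (poly f x - poly f c) \<le> v (x - c)"
proof -
  have "v (poly f x - poly f c) = v (x - c) * v (poly (synthetic_div f c) x)"
    unfolding poly_synthetic_div[of f x c] by (simp add: v_mult)
  also have "\<dots> \<le> v (x - c)"
    by (rule mult_left_le[OF v_poly_le[OF integral_synthetic_div[OF assms(1,3)] assms(2)] v_nonneg])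
  finally show ?thesis .
qed

text \<open>A nonzero polynomial over a field has no more roots than its degree. The residue field
  is avoided by taking pairwise incongruent elements and dividing out one approximate root at a
  time.\<close>

lemma roots_mod_p:
  assumes "integral_poly f" "finite A" "degree f < card A"
    and "\<And>a. a \<in> A \<Longrightarrow> v a \<le> 1 \<and> v (poly f a) < 1"
    and "\<And>a b. a \<in> A \<Longrightarrow> b \<in> A \<Longrightarrow> a \<noteq> b \<Longrightarrow> v (a - b) = 1"
    and x: "v x \<le> 1"
  shows "v (poly f x) < 1"
  using assms(1-5)
proof (induction "degree f" arbitrary: f A)
  case 0
  then obtain c where f: "f = [:c:]" using degree_eq_zeroE by metis
  from 0 obtain a where "a \<in> A" by (metis card.empty ex_in_conv less_zeroE)
  with 0 have "v (poly f a) < 1" by blast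
  thus ?case by (simp add: f)
next
  case (Suc d)
  then obtain a where a: "a \<in> A" by (metis card.empty ex_in_conv less_zeroE)
  have ai: "v a \<le> 1" "v (poly f a) < 1" using Suc.prems(4)[OF a] by auto
  define g where "g = synthetic_div f a"
  have g: "integral_poly g" "degree g = d"
    unfolding g_def using integral_synthetic_div[OF Suc.prems(1) ai(1)] Suc.hyps(2)
    by (simp_all add: degree_synthetic_div)
  have gb: "v b \<le> 1 \<and> v (poly g b) < 1" if b: "b \<in> A - {a}" for b
  proof -
    have bA: "b \<in> A" "b \<noteq> a" using b by auto
    have "(b - a) * poly g b = poly f b - poly f a"
      using poly_synthetic_div[of f b a] by (simp add: g_def)
    hence "v (b - a) * v (poly g b) < 1"
      using Suc.prems(4)[OF bA(1)] ai by (metis v_diff_less v_mult)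
    thus ?thesis using Suc.prems(4)[OF bA(1)] Suc.prems(5)[OF bA(1) a bA(2)] by simp
  qed
  have "v (poly g x) < 1"
  proof (rule Suc.hyps(1)[of g "A - {a}"])
    show "degree g < card (A - {a})" using Suc.prems(2,3) a g(2) Suc.hyps(2) by simp
  qed (use g gb Suc.prems(2,5) in auto)
  moreover have "v (x - a) \<le> 1" by (rule v_diff_le[OF x ai(1)])
  ultimately have "v ((x - a) * poly g x) < 1"
    unfolding v_mult
    using mult_left_le_one_le[OF v_nonneg[of "poly g x"] v_nonneg[of "x - a"]] by linarith
  hence "v ((x - a) * poly g x + poly f a) < 1" by (rule v_add_less[OF _ ai(2)])
  thus ?case using poly_synthetic_div[of f x a] by (simp add: g_def)
qed

end


section \<open>Division polynomials\<close>

context padic_edwards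
begin

lemma fst_double:
  assumes e: "e = 1" and P: "(a, b) \<in> curve"
  shows "(fst (point_add (a, b) (a, b)))\<^sup>2 * (1 + a ^ 4)\<^sup>2 = 4 * a\<^sup>2 * (1 - a ^ 4)"
proof -
  have a4: "(a * a)\<^sup>2 = a ^ 4" by (simp add: power2_eq_square power4_eq_xxxx)
  have S: "(lemniscate_S (a, b))\<^sup>2 = 1 - a ^ 4"
    using lemniscate_S_square[OF P] by (simp add: e a4 flip: power2_eq_square)
  have "1 + a ^ 4 \<noteq> 0" using one_plus_square_nonzero[of "a * a"] by (simp add: a4)
  hence "(fst (point_add (a, b) (a, b)))\<^sup>2 * (1 + a ^ 4)\<^sup>2 = (2 * (a * lemniscate_S (a, b)))\<^sup>2"
    unfolding fst_point_add[OF P P] by (simp add: e a4 power_divide)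
  also have "\<dots> = 4 * a\<^sup>2 * (1 - a ^ 4)" by (simp add: power_mult_distrib S)
  finally show ?thesis .
qed

text \<open>Each factor contains the square roots \<open>S\<close> and \<open>T\<close>, but the
  product of the conjugate numerators depends only on their squares. For multiples
  \<open>(m+1)P\<close> and \<open>mP\<close> the difference is \<open>P\<close> itself, which gives
  access to \<open>(2m+1)P\<close>.\<close>

lemma fst_add_sub:
  assumes e: "e = 1" and P: "(a, b) \<in> curve" and Q: "(c, d) \<in> curve"
  shows "fst (point_add (a, b) (c, d)) * fst (point_add (a, b) (inv\<^bsub>E\<^esub> (c, d))) * (1 + (a * c)\<^sup>2) = a\<^sup>2 - c\<^sup>2"
proof -
  define S T where "S = lemniscate_S (a, b)" and "T = lemniscate_S (c, d)"
  have S: "S\<^sup>2 = 1 - a ^ 4" and T: "T\<^sup>2 = 1 - c ^ 4"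
    using lemniscate_S_square[OF P] lemniscate_S_square[OF Q] by (simp_all add: e S_def T_def flip: power_mult)
  have Tn: "lemniscate_S (- c, d) = T" by (simp add: T_def lemniscate_S_def)
  have nz: "1 + (a * c)\<^sup>2 \<noteq> 0" by (rule one_plus_square_nonzero)
  have "(a * T + c * S) * (a * T + - c * S) = a\<^sup>2 * T\<^sup>2 - c\<^sup>2 * S\<^sup>2"
    by (simp add: power2_eq_square algebra_simps)
  also have "\<dots> = (a\<^sup>2 - c\<^sup>2) * (1 + (a * c)\<^sup>2)"
    unfolding S T by (simp add: power2_eq_square power4_eq_xxxx algebra_simps)
  finally have num: "(a * T + c * S) * (a * T + - c * S) = (a\<^sup>2 - c\<^sup>2) * (1 + (a * c)\<^sup>2)" .
  have "fst (point_add (a, b) (c, d)) = (a * T + c * S) / (1 + (a * c)\<^sup>2)"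
    unfolding fst_point_add[OF P Q] by (simp add: e S_def T_def)
  moreover have "fst (point_add (a, b) (inv\<^bsub>E\<^esub> (c, d))) = (a * T + - c * S) / (1 + (a * c)\<^sup>2)"
    unfolding inv_E[OF Q] fst_point_add[OF P point_neg_curve[OF Q]] Tn by (simp add: e S_def)
  ultimately have "fst (point_add (a, b) (c, d)) * fst (point_add (a, b) (inv\<^bsub>E\<^esub> (c, d))) * (1 + (a * c)\<^sup>2)
     = ((a * T + c * S) * (a * T + - c * S)) / (1 + (a * c)\<^sup>2)" using nz by simp
  thus ?thesis unfolding num using nz by simp
qed

text \<open>The polynomials express \<open>x(nP)^2 / x^2\<close> as a fraction in
  \<open>x^4\<close>. The fourth power reflects the automorphism \<open>x \<mapsto> i x\<close>;
  squaring is needed for even \<open>n\<close>, where \<open>x(nP)\<close> contains the factor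
  \<open>S\<close>. The values at 0 reflect that \<open>x(nP)\<close> is \<open>n x\<close> to first
  order, and denominators are required to be units so that everything can be reduced modulo
  \<open>p\<close>.\<close>

definition division_polys :: "nat \<Rightarrow> 'k poly \<Rightarrow> 'k poly \<Rightarrow> bool" where
  "division_polys n A B \<longleftrightarrow> integral_poly A \<and> integral_poly B \<and>
     2 * degree A + 1 \<le> n\<^sup>2 \<and> 2 * degree B \<le> n\<^sup>2 \<and> poly A 0 = of_nat (n\<^sup>2) \<and> poly B 0 = 1 \<and>
     (\<forall>x y. (x, y) \<in> curve \<longrightarrow> x \<noteq> 0 \<longrightarrow> v (poly B (x ^ 4)) = 1 \<and>
        (fst ((x, y) [^]\<^bsub>E\<^esub> n))\<^sup>2 * poly B (x ^ 4) = x\<^sup>2 * poly A (x ^ 4))"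

lemma division_polysD:
  assumes "division_polys n A B" "(x, y) \<in> curve" "x \<noteq> 0"
  shows "v (poly B (x ^ 4)) = 1"
    and "(fst ((x, y) [^]\<^bsub>E\<^esub> n))\<^sup>2 * poly B (x ^ 4) = x\<^sup>2 * poly A (x ^ 4)"
  using assms unfolding division_polys_def by blast+

abbreviation "X \<equiv> [:0, 1 :: 'k:]"

lemma integral_X: "integral_poly X"
  by (simp add: integral_poly_pCons integral_poly_zero)

lemma pow_curve: "P \<in> curve \<Longrightarrow> P [^]\<^bsub>E\<^esub> (n::nat) \<in> curve"
  using E.nat_pow_closed[of P n] by simp

text \<open>With \<open>q = x(mP)\<close> one has \<open>q^2 = x^2 A / B\<close> and
  \<open>q^4 = X A^2 / B^2\<close> for \<open>X = x^4\<close>; these are substituted into the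
  duplication formula \<open>fst_double\<close> and denominators are cleared.\<close>

lemma division_polys_double:
  assumes e: "e = 1" and AB: "division_polys m A B"
  shows "division_polys (2 * m) (Polynomial.smult 4 (A * B * (B\<^sup>2 - X * A\<^sup>2))) ((B\<^sup>2 + X * A\<^sup>2)\<^sup>2)"
  unfolding division_polys_def
proof (intro conjI allI impI)
  have iA: "integral_poly A" and iB: "integral_poly B" and dA: "2 * degree A + 1 \<le> m\<^sup>2"
    and dB: "2 * degree B \<le> m\<^sup>2" and A0: "poly A 0 = of_nat (m\<^sup>2)" and B0: "poly B 0 = 1"
    using AB by (auto simp: division_polys_def)
  have iB2: "integral_poly (B\<^sup>2)" and iXA: "integral_poly (X * A\<^sup>2)"
    by (intro integral_poly_power integral_poly_mult integral_X iA iB)+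
  show "integral_poly (Polynomial.smult 4 (A * B * (B\<^sup>2 - X * A\<^sup>2)))"
    using v_of_nat_le[of 4]
    by (intro integral_poly_smult integral_poly_mult integral_poly_diff iA iB iB2 iXA) simp
  show "integral_poly ((B\<^sup>2 + X * A\<^sup>2)\<^sup>2)"
    by (intro integral_poly_power integral_poly_add iB2 iXA)
  have d1: "degree (B\<^sup>2) \<le> 2 * degree B" by (metis degree_power_le mult.commute)
  have "degree (A\<^sup>2) \<le> 2 * degree A" by (metis degree_power_le mult.commute)
  hence d2: "degree (X * A\<^sup>2) \<le> 1 + 2 * degree A"
    using degree_mult_le[of X "A\<^sup>2"] by simp
  have d3: "degree (B\<^sup>2 - X * A\<^sup>2) \<le> m\<^sup>2" "degree (B\<^sup>2 + X * A\<^sup>2) \<le> m\<^sup>2"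
    using d1 d2 dA dB by (auto intro!: degree_diff_le degree_add_le)
  have m4: "(2 * m)\<^sup>2 = 4 * m\<^sup>2" by (simp add: power_mult_distrib)
  have "degree (Polynomial.smult 4 (A * B * (B\<^sup>2 - X * A\<^sup>2))) \<le> degree (A * B * (B\<^sup>2 - X * A\<^sup>2))"
    by (rule degree_smult_le)
  also have "\<dots> \<le> degree A + degree B + m\<^sup>2"
    using degree_mult_le[of "A * B" "B\<^sup>2 - X * A\<^sup>2"] degree_mult_le[of A B] d3(1) by linarith
  finally show "2 * degree (Polynomial.smult 4 (A * B * (B\<^sup>2 - X * A\<^sup>2))) + 1 \<le> (2 * m)\<^sup>2"
    unfolding m4 using dA dB by linarith
  have "degree ((B\<^sup>2 + X * A\<^sup>2)\<^sup>2) \<le> m\<^sup>2 * 2"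
    by (rule order.trans[OF degree_power_le mult_right_mono[OF d3(2)]]) simp
  thus "2 * degree ((B\<^sup>2 + X * A\<^sup>2)\<^sup>2) \<le> (2 * m)\<^sup>2" unfolding m4 by linarith
  show "poly (Polynomial.smult 4 (A * B * (B\<^sup>2 - X * A\<^sup>2))) 0 = of_nat ((2 * m)\<^sup>2)"
    by (simp add: A0 B0)
  show "poly ((B\<^sup>2 + X * A\<^sup>2)\<^sup>2) 0 = 1" by (simp add: B0)
  fix x y assume P: "(x, y) \<in> curve" and x: "x \<noteq> 0"
  define \<alpha> \<beta> where "\<alpha> = poly A (x ^ 4)" and "\<beta> = poly B (x ^ 4)"
  obtain a b where ab: "(x, y) [^]\<^bsub>E\<^esub> m = (a, b)" by fastforce
  have abc: "(a, b) \<in> curve" using pow_curve[OF P, of m] ab by simp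
  have v\<beta>: "v \<beta> = 1" and rel: "a\<^sup>2 * \<beta> = x\<^sup>2 * \<alpha>"
    using division_polysD[OF AB P x] unfolding ab \<alpha>_def \<beta>_def by simp_all
  have \<beta>0: "\<beta> \<noteq> 0" using v\<beta> by auto
  have a4: "a ^ 4 * \<beta>\<^sup>2 = x ^ 4 * \<alpha>\<^sup>2"
  proof -
    have "a ^ 4 * \<beta>\<^sup>2 = (a\<^sup>2 * \<beta>)\<^sup>2" by (simp add: power_mult_distrib flip: power_mult)
    thus ?thesis unfolding rel by (simp add: power_mult_distrib flip: power_mult)
  qed
  have den: "\<beta>\<^sup>2 + x ^ 4 * \<alpha>\<^sup>2 = \<beta>\<^sup>2 * (1 + (a\<^sup>2)\<^sup>2)"
    using a4 by (simp add: algebra_simps flip: power_mult)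
  have va: "v (a\<^sup>2) \<le> 1" using curveD(2)[OF abc] v_nonneg by (simp add: v_power power_le_one)
  show "v (poly ((B\<^sup>2 + X * A\<^sup>2)\<^sup>2) (x ^ 4)) = 1"
    using v_one_plus_square[OF va] v\<beta> den by (simp add: \<alpha>_def \<beta>_def v_power v_mult)
  have "(x, y) [^]\<^bsub>E\<^esub> (2 * m) = point_add (a, b) (a, b)"
    using P ab by (simp add: mult_2 flip: E.nat_pow_mult)
  hence d: "(fst ((x, y) [^]\<^bsub>E\<^esub> (2 * m)))\<^sup>2 * (1 + a ^ 4)\<^sup>2 = 4 * a\<^sup>2 * (1 - a ^ 4)"
    using fst_double[OF e abc] by simp
  define f where "f = fst ((x, y) [^]\<^bsub>E\<^esub> (2 * m))"
  have "f\<^sup>2 * (\<beta>\<^sup>2 + x ^ 4 * \<alpha>\<^sup>2)\<^sup>2 = f\<^sup>2 * (1 + a ^ 4)\<^sup>2 * \<beta> ^ 4"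
    unfolding den by (simp add: power_mult_distrib mult_ac flip: power_mult)
  also have "\<dots> = 4 * (a\<^sup>2 * \<beta>) * \<beta> * (\<beta>\<^sup>2 - a ^ 4 * \<beta>\<^sup>2)"
    unfolding d f_def by (simp add: power2_eq_square power4_eq_xxxx algebra_simps)
  also have "\<dots> = x\<^sup>2 * (4 * (\<alpha> * \<beta> * (\<beta>\<^sup>2 - x ^ 4 * \<alpha>\<^sup>2)))" unfolding rel a4 by (simp add: mult_ac)
  finally show "(fst ((x, y) [^]\<^bsub>E\<^esub> (2 * m)))\<^sup>2 * poly ((B\<^sup>2 + X * A\<^sup>2)\<^sup>2) (x ^ 4)
      = x\<^sup>2 * poly (Polynomial.smult 4 (A * B * (B\<^sup>2 - X * A\<^sup>2))) (x ^ 4)"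
    by (simp add: f_def \<alpha>_def \<beta>_def)
qed

text \<open>For odd index \<open>x((2m+1)P) / x\<close> is itself a fraction in \<open>x^4\<close>.
  Leaving it unsquared halves the degree of the numerator to at most \<open>m^2 + m\<close>, and the
  count of torsion points depends on this saving.\<close>

lemma division_polys_odd_relation:
  assumes e: "e = 1" and AB: "division_polys m A B" and AB': "division_polys (Suc m) A' B'"
    and P: "(x, y) \<in> curve" and x: "x \<noteq> 0"
  defines "g \<equiv> x ^ 4"
  shows "fst ((x, y) [^]\<^bsub>E\<^esub> (2 * m + 1)) * (poly B g * poly B' g + g * (poly A g * poly A' g))
     = x * (poly A' g * poly B g - poly A g * poly B' g)"
    and "v (poly B g * poly B' g + g * (poly A g * poly A' g)) = 1"
proof -
  define \<alpha> \<beta> \<alpha>' \<beta>' where ab_defs: "\<alpha> = poly A g" "\<beta> = poly B g" "\<alpha>' = poly A' g" "\<beta>' = poly B' g"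
  obtain a b where ab: "(x, y) [^]\<^bsub>E\<^esub> m = (a, b)" by fastforce
  obtain c d where cd: "(x, y) [^]\<^bsub>E\<^esub> Suc m = (c, d)" by fastforce
  have abc: "(a, b) \<in> curve" using pow_curve[OF P, of m] ab by simp
  have cdc: "(c, d) \<in> curve" using pow_curve[OF P, of "Suc m"] cd by simp
  have v\<beta>: "v \<beta> = 1" and rel: "a\<^sup>2 * \<beta> = x\<^sup>2 * \<alpha>"
    using division_polysD[OF AB P x] unfolding ab ab_defs g_def by simp_all
  have v\<beta>': "v \<beta>' = 1" and rel': "c\<^sup>2 * \<beta>' = x\<^sup>2 * \<alpha>'"
    using division_polysD[OF AB' P x] unfolding cd ab_defs g_def by simp_all
  have g: "g * (\<alpha> * \<alpha>') = (a * c)\<^sup>2 * (\<beta> * \<beta>')"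
  proof -
    have "g * (\<alpha> * \<alpha>') = (x\<^sup>2 * \<alpha>) * (x\<^sup>2 * \<alpha>')"
      by (simp add: g_def power2_eq_square power4_eq_xxxx mult_ac)
    also have "\<dots> = (a * c)\<^sup>2 * (\<beta> * \<beta>')"
      unfolding rel[symmetric] rel'[symmetric] by (simp add: power_mult_distrib mult_ac)
    finally show ?thesis .
  qed
  have den: "\<beta> * \<beta>' + g * (\<alpha> * \<alpha>') = \<beta> * \<beta>' * (1 + (c * a)\<^sup>2)"
    unfolding g by (simp add: algebra_simps)
  have "v (c * a) \<le> 1" by (rule v_mult_le_1[OF curveD(2)[OF cdc] curveD(2)[OF abc]])
  thus "v (poly B g * poly B' g + g * (poly A g * poly A' g)) = 1"
    using v\<beta> v\<beta>' den by (simp add: v_mult v_one_plus_square flip: ab_defs)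
  define f where "f = fst ((x, y) [^]\<^bsub>E\<^esub> (2 * m + 1))"
  have PE: "(x, y) \<in> carrier E" using P by simp
  have s: "point_add (c, d) (a, b) = (x, y) [^]\<^bsub>E\<^esub> (2 * m + 1)"
  proof -
    have m: "Suc m + m = 2 * m + 1" by simp
    show ?thesis
      using E.nat_pow_mult[OF PE, of "Suc m" m] unfolding ab cd m by (simp only: E_simps)
  qed
  have t: "point_add (c, d) (inv\<^bsub>E\<^esub> (a, b)) = (x, y)"
  proof -
    have "(x, y) [^]\<^bsub>E\<^esub> Suc m = (x, y) \<otimes>\<^bsub>E\<^esub> (x, y) [^]\<^bsub>E\<^esub> m" by (rule E.nat_pow_Suc2[OF PE])
    hence "(c, d) = (x, y) \<otimes>\<^bsub>E\<^esub> (a, b)" unfolding cd ab .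
    hence "(c, d) \<otimes>\<^bsub>E\<^esub> inv\<^bsub>E\<^esub> (a, b) = (x, y)"
      using E.inv_solve_right'[of "(x, y)" "(c, d)" "(a, b)"] PE abc cdc by auto
    thus ?thesis by simp
  qed
  have "f * x * (1 + (c * a)\<^sup>2) = c\<^sup>2 - a\<^sup>2"
    using fst_add_sub[OF e cdc abc] unfolding s t f_def by simp
  hence "f * x * (\<beta> * \<beta>' * (1 + (c * a)\<^sup>2)) = (c\<^sup>2 * \<beta>') * \<beta> - (a\<^sup>2 * \<beta>) * \<beta>'"
    by (simp add: algebra_simps) (metis (no_types, opaque_lifting) mult.assoc mult.commute distrib_left right_diff_distrib)
  also have "\<dots> = x\<^sup>2 * (\<alpha>' * \<beta> - \<alpha> * \<beta>')" unfolding rel rel' by (simp add: algebra_simps)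
  finally have "x * (f * (\<beta> * \<beta>' * (1 + (c * a)\<^sup>2))) = x * (x * (\<alpha>' * \<beta> - \<alpha> * \<beta>'))"
    by (simp add: power2_eq_square mult_ac)
  hence "f * (\<beta> * \<beta>' + g * (\<alpha> * \<alpha>')) = x * (\<alpha>' * \<beta> - \<alpha> * \<beta>')" unfolding den using x by simp
  thus "fst ((x, y) [^]\<^bsub>E\<^esub> (2 * m + 1)) * (poly B g * poly B' g + g * (poly A g * poly A' g))
     = x * (poly A' g * poly B g - poly A g * poly B' g)"
    by (simp add: f_def ab_defs)
qed

lemma odd_poly_degree:
  assumes "division_polys m A B" "division_polys (Suc m) A' B'"
  shows "degree (A' * B - A * B') \<le> m\<^sup>2 + m" "degree (B * B' + X * (A * A')) \<le> m\<^sup>2 + m"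
proof -
  have s: "(Suc m)\<^sup>2 = m\<^sup>2 + 2 * m + 1" by (simp add: power2_eq_square)
  have d: "2 * degree A + 1 \<le> m\<^sup>2" "2 * degree B \<le> m\<^sup>2" "2 * degree A' + 1 \<le> m\<^sup>2 + 2 * m + 1"
    "2 * degree B' \<le> m\<^sup>2 + 2 * m + 1"
    using assms unfolding division_polys_def s by auto
  have "degree (A' * B) \<le> m\<^sup>2 + m" using degree_mult_le[of A' B] d by linarith
  moreover have "degree (A * B') \<le> m\<^sup>2 + m" using degree_mult_le[of A B'] d by linarith
  ultimately show "degree (A' * B - A * B') \<le> m\<^sup>2 + m" by (rule degree_diff_le)
  have "degree (B * B') \<le> m\<^sup>2 + m" using degree_mult_le[of B B'] d by linarith
  moreover have "degree (X * (A * A')) \<le> m\<^sup>2 + m"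
    using degree_mult_le[of X "A * A'"] degree_mult_le[of A A'] d by simp
  ultimately show "degree (B * B' + X * (A * A')) \<le> m\<^sup>2 + m" by (rule degree_add_le)
qed

lemma odd_poly_integral:
  assumes "division_polys m A B" "division_polys (Suc m) A' B'"
  shows "integral_poly (A' * B - A * B')" "integral_poly (B * B' + X * (A * A'))"
proof -
  have i: "integral_poly A" "integral_poly B" "integral_poly A'" "integral_poly B'"
    using assms by (auto simp: division_polys_def)
  show "integral_poly (A' * B - A * B')" "integral_poly (B * B' + X * (A * A'))"
    by (intro integral_poly_diff integral_poly_add integral_poly_mult integral_X i)+
qed

lemma odd_poly_0:
  assumes "division_polys m A B" "division_polys (Suc m) A' B'"
  shows "poly (A' * B - A * B') 0 = of_nat (2 * m + 1)" "poly (B * B' + X * (A * A')) 0 = 1"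
  using assms unfolding division_polys_def by (auto simp: power2_eq_square algebra_simps)

lemma division_polys_odd:
  assumes e: "e = 1" and AB: "division_polys m A B" and AB': "division_polys (Suc m) A' B'"
  shows "division_polys (2 * m + 1) ((A' * B - A * B')\<^sup>2) ((B * B' + X * (A * A'))\<^sup>2)"
  unfolding division_polys_def
proof (intro conjI allI impI)
  note d = odd_poly_degree[OF AB AB'] and i = odd_poly_integral[OF AB AB'] and z = odd_poly_0[OF AB AB']
  have s: "(2 * m + 1)\<^sup>2 = 4 * (m\<^sup>2 + m) + 1" by (simp add: power2_eq_square algebra_simps)
  show "integral_poly ((A' * B - A * B')\<^sup>2)" "integral_poly ((B * B' + X * (A * A'))\<^sup>2)"
    by (intro integral_poly_power i)+
  have "degree ((A' * B - A * B')\<^sup>2) \<le> (m\<^sup>2 + m) * 2"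
    by (rule order.trans[OF degree_power_le mult_right_mono[OF d(1)]]) simp
  thus "2 * degree ((A' * B - A * B')\<^sup>2) + 1 \<le> (2 * m + 1)\<^sup>2" unfolding s by simp
  have "degree ((B * B' + X * (A * A'))\<^sup>2) \<le> (m\<^sup>2 + m) * 2"
    by (rule order.trans[OF degree_power_le mult_right_mono[OF d(2)]]) simp
  thus "2 * degree ((B * B' + X * (A * A'))\<^sup>2) \<le> (2 * m + 1)\<^sup>2" unfolding s by simp
  show "poly ((A' * B - A * B')\<^sup>2) 0 = of_nat ((2 * m + 1)\<^sup>2)" unfolding poly_power z by simp
  show "poly ((B * B' + X * (A * A'))\<^sup>2) 0 = 1" unfolding poly_power z by simp
  fix x y assume P: "(x, y) \<in> curve" and x: "x \<noteq> 0"
  note r = division_polys_odd_relation[OF e AB AB' P x]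
  show "v (poly ((B * B' + X * (A * A'))\<^sup>2) (x ^ 4)) = 1" using r(2) by (simp add: v_power)
  show "(fst ((x, y) [^]\<^bsub>E\<^esub> (2 * m + 1)))\<^sup>2 * poly ((B * B' + X * (A * A'))\<^sup>2) (x ^ 4)
     = x\<^sup>2 * poly ((A' * B - A * B')\<^sup>2) (x ^ 4)"
    using arg_cong[OF r(1), of "\<lambda>t. t\<^sup>2"] by (simp only: power_mult_distrib poly_power poly_add poly_mult poly_diff) simp
qed

lemma ex_division_polys:
  assumes e: "e = 1" and n: "0 < n"
  shows "\<exists>A B. division_polys n A B"
  using n
proof (induction n rule: less_induct)
  case (less n)
  consider "n = 1" | m where "n = 2 * m" "0 < m" | m where "n = 2 * m + 1" "0 < m"
    using less.prems by (metis One_nat_def Suc_eq_plus1 evenE gr0I mult_0_right oddE add_0)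
  then show ?case
  proof cases
    case 1
    have "division_polys 1 1 1"
      unfolding division_polys_def
      by (auto simp: integral_poly_one E.nat_pow_eone simp del: E_simps) (auto simp: point_add_zero)
    then show ?thesis using 1 by blast
  next
    case 2
    then obtain A B where "division_polys m A B" using less.IH[of m] by auto
    from division_polys_double[OF e this] show ?thesis using 2 by blast
  next
    case 3
    then obtain A B A' B' where "division_polys m A B" "division_polys (Suc m) A' B'"
      using less.IH[of m] less.IH[of "Suc m"] by auto
    from division_polys_odd[OF e this] show ?thesis using 3 by blast
  qed
qed

end

section \<open>The group of points modulo \<open>p\<close>\<close>

context padic_edwards
begin

lemma normal_F: "F \<lhd> E"
  using E.subgroup_imp_normal[OF subgroup_F] .

sublocale EF: comm_group "E Mod F"
  by (rule E.abelian_FactGroup[OF subgroup_F])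

abbreviation cls :: "'k \<times> 'k \<Rightarrow> ('k \<times> 'k) set" where
  "cls P \<equiv> F #>\<^bsub>E\<^esub> P"

lemma carrier_EF: "carrier (E Mod F) = cls ` curve"
  by (simp add: carrier_FactGroup)

lemma cls_eq_iff:
  assumes P: "P \<in> curve" and Q: "Q \<in> curve"
  shows "cls P = cls Q \<longleftrightarrow> point_add P (inv\<^bsub>E\<^esub> Q) \<in> F"
proof
  assume "cls P = cls Q"
  hence "P \<in> cls Q" using E.rcos_self[of P F] P subgroup_F by simp
  thus "point_add P (inv\<^bsub>E\<^esub> Q) \<in> F"
    using subgroup.rcos_module_imp[OF subgroup_F E.is_group, of Q P] Q by simp
next
  assume "point_add P (inv\<^bsub>E\<^esub> Q) \<in> F"
  hence "P \<in> cls Q"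
    using subgroup.rcos_module_rev[OF subgroup_F E.is_group, of Q P] P Q by simp
  thus "cls P = cls Q" using E.repr_independence[of P F Q] Q subgroup_F by simp
qed

lemma cls_eq_F_iff: "P \<in> curve \<Longrightarrow> cls P = F \<longleftrightarrow> P \<in> F"
  using E.coset_join1[of F P] E.coset_join2[of P F] subgroup_F by auto

lemma cls_pow: "P \<in> curve \<Longrightarrow> cls P [^]\<^bsub>E Mod F\<^esub> (n::nat) = cls (P [^]\<^bsub>E\<^esub> n)"
  using normal.FactGroup_pow[OF normal_F, of P n] by simp

lemma cls_inv: "P \<in> curve \<Longrightarrow> inv\<^bsub>E Mod F\<^esub> (cls P) = cls (inv\<^bsub>E\<^esub> P)"
proof -
  assume P: "P \<in> curve"
  have "cls P \<in> carrier (E Mod F)" using P by (simp add: carrier_EF)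
  hence "inv\<^bsub>E Mod F\<^esub> (cls P) = set_inv\<^bsub>E\<^esub> (cls P)" by (rule normal.inv_FactGroup[OF normal_F])
  thus ?thesis using normal.rcos_inv[OF normal_F, of P] P by simp
qed

lemma cls_congruent:
  assumes P: "(x, y) \<in> curve" and Q: "(x', y') \<in> curve" and cong: "v (x - x') < 1" "v (y - y') < 1"
  shows "cls (x, y) = cls (x', y')"
proof -
  note c = curveD[OF P] and c' = curveD[OF Q]
  have i: "inv\<^bsub>E\<^esub> (x', y') = (- x', y')" by (rule inv_E[OF Q])
  have d: "v (1 + e * x * (- x') * y * y') = 1" by (rule denominator_unit'[OF P point_neg_curve[OF Q]])
  hence d0: "1 + e * x * (- x') * y * y' \<noteq> 0" by auto
  have "snd (point_add (x, y) (- x', y')) - 1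
     = (y * y' + e * x * x' - 1 + e * x * x' * y * y') / (1 + e * x * (- x') * y * y')"
    using d0 by (simp add: point_add_def field_simps)
  \<comment> \<open>Subtracting the curve equation of the first point eliminates the 1, and every
    remaining term contains a difference of coordinates.\<close>
  also have "y * y' + e * x * x' - 1 + e * x * x' * y * y'
     = (y' - y) * y + (x' - x) * (e * x) * (1 + y * y') + (y' - y) * (e * x * x * y)"
    using c(1) by (simp add: power2_eq_square algebra_simps)
  finally have "v (snd (point_add (x, y) (- x', y')) - 1) =
      v ((y' - y) * y + (x' - x) * (e * x) * (1 + y * y') + (y' - y) * (e * x * x * y))"
    by (simp only: v_divide d div_by_1)
  also have "\<dots> < 1"
  proof (rule v_add_less[OF v_add_less])
    have s: "v (x' - x) < 1" "v (y' - y) < 1" using cong by (simp_all add: v_diff_commute)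
    have ex: "v (e * x) \<le> 1" by (rule v_mult_le_1[OF v_e(1) c(2)])
    show "v ((y' - y) * y) < 1" by (rule v_mult_less_1[OF s(2) c(3)])
    have "v (1 + y * y') \<le> 1" by (rule v_add_le[OF _ v_mult_le_1[OF c(3) c'(3)]]) simp
    thus "v ((x' - x) * (e * x) * (1 + y * y')) < 1"
      by (rule v_mult_less_1[OF v_mult_less_1[OF s(1) ex]])
    show "v ((y' - y) * (e * x * x * y)) < 1"
      by (rule v_mult_less_1[OF s(2) v_mult_le_1[OF v_mult_le_1[OF ex c(2)] c(3)]])
  qed
  finally have "point_add (x, y) (- x', y') \<in> F"
    using point_add_closed[OF P point_neg_curve[OF Q]] by (simp add: F_def)
  thus ?thesis using cls_eq_iff[OF P Q] by (simp add: i)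
qed

lemma minus_one_curve: "(0, - 1) \<in> curve" by (simp add: curve_def)

lemma minus_one_add: "point_add (0, - 1) (a, b) = (- a, - b)"
  by (simp add: point_add_def)

lemma minus_one_notin_F: "(0, - 1) \<notin> F"
proof
  assume "(0, - 1) \<in> F"
  hence "v (- 2) < 1" by (simp add: F_def)
  thus False using v_two by (simp add: v_minus)
qed

lemma minus_one_pow: "odd n \<Longrightarrow> (0, - 1) [^]\<^bsub>E\<^esub> (n::nat) = (0, - 1)"
proof -
  assume "odd n"
  then obtain m where n: "n = 2 * m + 1" by (rule oddE)
  have "(0, - 1) [^]\<^bsub>E\<^esub> (2 * m) = (0, 1)" for m :: nat
  proof (induction m)
    case (Suc m)
    have "(0, - 1) [^]\<^bsub>E\<^esub> (2 * Suc m) = point_add (point_add ((0, - 1) [^]\<^bsub>E\<^esub> (2 * m)) (0, - 1)) (0, - 1)"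
      by (simp add: E.nat_pow_Suc)
    thus ?case unfolding Suc by (simp add: point_add_zero minus_one_add)
  qed simp
  thus ?thesis unfolding n by (simp add: E.nat_pow_Suc point_add_zero)
qed

text \<open>The point \<open>(0, -1)\<close> equals its own odd multiples and lies outside
  \<open>F\<close>, so adding it destroys torsion of odd order. This later settles which of two
  opposite signs occurs.\<close>

lemma minus_one_shift_torsion:
  assumes P: "P \<in> curve" and n: "odd n" and t: "P [^]\<^bsub>E\<^esub> (n::nat) \<in> F"
  shows "point_add (0, - 1) P [^]\<^bsub>E\<^esub> n \<notin> F"
proof
  assume a: "point_add (0, - 1) P [^]\<^bsub>E\<^esub> n \<in> F"
  have "((0, - 1) \<otimes>\<^bsub>E\<^esub> P) [^]\<^bsub>E\<^esub> n = (0, - 1) [^]\<^bsub>E\<^esub> n \<otimes>\<^bsub>E\<^esub> P [^]\<^bsub>E\<^esub> n"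
    using E.pow_mult_distrib[OF E.m_comm, of "(0, - 1)" P n] P minus_one_curve by simp
  hence e1: "point_add (0, - 1) P [^]\<^bsub>E\<^esub> n = point_add (0, - 1) (P [^]\<^bsub>E\<^esub> n)"
    by (simp add: minus_one_pow[OF n])
  have Pn: "P [^]\<^bsub>E\<^esub> n \<in> curve" by (rule pow_curve[OF P])
  have "point_add (point_add (0, - 1) (P [^]\<^bsub>E\<^esub> n)) (inv\<^bsub>E\<^esub> (P [^]\<^bsub>E\<^esub> n)) \<in> F"
    using F_add[OF a F_neg[OF t]] unfolding e1 .
  moreover have "point_add (point_add (0, - 1) (P [^]\<^bsub>E\<^esub> n)) (inv\<^bsub>E\<^esub> (P [^]\<^bsub>E\<^esub> n)) = (0, - 1)"
    using E.inv_solve_right'[of "(0, - 1)" "point_add (0, - 1) (P [^]\<^bsub>E\<^esub> n)" "P [^]\<^bsub>E\<^esub> n"]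
      Pn minus_one_curve point_add_closed by auto
  ultimately show False using minus_one_notin_F by simp
qed

lemma product_small: "v (a * b) < 1 \<Longrightarrow> v a < 1 \<or> v b < 1"
proof (rule ccontr)
  assume ab: "v (a * b) < 1" and "\<not> (v a < 1 \<or> v b < 1)"
  hence "1 * 1 \<le> v a * v b" by (intro mult_mono) auto
  with ab show False by (simp add: v_mult)
qed

lemma v_minus_minus_one: "v (- y - 1) = v (1 + y)"
proof -
  have "- y - 1 = - (1 + y)" by simp
  thus ?thesis by (simp only: v_minus)
qed

text \<open>As \<open>(1 - y) (1 + y)\<close> is a multiple of \<open>x\<close>, one has
  \<open>y\<close> congruent to 1 or to -1; in the second case translation by
  \<open>(0, -1)\<close>, which negates both coordinates, leads into \<open>F\<close>.\<close>

lemma cases_small_x: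
  assumes P: "(x, y) \<in> curve" and x: "v x < 1"
  shows "(x, y) \<in> F \<or> (- x, - y) \<in> F"
proof -
  note c = curveD[OF P]
  have "(1 - y) * (1 + y) = x * (e * x * (1 + y\<^sup>2))"
    using c(1) by (simp add: power2_eq_square algebra_simps)
  moreover have "v (x * (e * x * (1 + y\<^sup>2))) < 1"
    by (rule v_mult_less_1[OF x v_mult_le_1[OF v_mult_le_1[OF v_e(1) c(2)]]]) (simp add: c(5))
  ultimately have "v (1 - y) < 1 \<or> v (1 + y) < 1" using product_small by metis
  moreover have "(- x, - y) \<in> curve" using P by (simp add: curve_def)
  ultimately show ?thesis
    using P v_minus_minus_one[of y] v_diff_commute[of 1 y] by (auto simp: F_def)
qed

definition rep :: "('k \<times> 'k) set \<Rightarrow> 'k \<times> 'k" where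
  "rep c = (SOME P. P \<in> curve \<and> cls P = c)"

lemma rep: "c \<in> carrier (E Mod F) \<Longrightarrow> rep c \<in> curve \<and> cls (rep c) = c"
  unfolding rep_def carrier_EF by (rule someI_ex) blast

definition res :: "'k \<Rightarrow> int" where
  "res x = (SOME n. 0 \<le> n \<and> n < int p \<and> v (x - of_int n) < 1)"

lemma res:
  assumes "v x \<le> 1"
  shows "0 \<le> res x" "res x < int p" "v (x - of_int (res x)) < 1"
proof -
  have "\<exists>n. 0 \<le> n \<and> n < int p \<and> v (x - of_int n) < 1" using residue[OF assms] by metis
  from someI_ex[OF this] show "0 \<le> res x" "res x < int p" "v (x - of_int (res x)) < 1"
    unfolding res_def by auto
qed

lemma res_eqD:
  assumes "v x \<le> 1" "v y \<le> 1" "res x = res y"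
  shows "v (x - y) < 1"
proof -
  have "v ((x - of_int (res x)) - (y - of_int (res y))) < 1"
    by (rule v_diff_less[OF res(3)[OF assms(1)] res(3)[OF assms(2)]])
  thus ?thesis using assms(3) by simp
qed

lemma v_int_diff:
  assumes "0 \<le> n" "n < int p" "0 \<le> m" "m < int p" "n \<noteq> m"
  shows "v (of_int n - of_int m) = 1"
proof -
  have "\<not> int p dvd n - m"
  proof
    assume "int p dvd n - m"
    hence "n mod int p = m mod int p" by (simp add: mod_eq_dvd_iff)
    thus False using assms by simp
  qed
  hence "v (of_int (n - m)) = 1" unfolding v_of_int_eq_1_iff .
  thus ?thesis by simp
qed

section \<open>Torsion and cyclicity modulo \<open>p\<close> in the case
  \<open>e = 1\<close>\<close>

context
  assumes e1: "e = 1"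
begin

lemma curve_e1: "(x, y) \<in> curve \<Longrightarrow> (1 + x\<^sup>2) * (1 + y\<^sup>2) = 2"
  using curveD(1)[of x y] by (simp add: e1 algebra_simps)

text \<open>By \<open>(1 + x^2) (1 + y^2) = 2\<close> the square of either coordinate is a
  fractional linear function of the square of the other, with unit denominators; so congruent
  squares stay congruent.\<close>

lemma square_diff_small:
  assumes a: "v (1 + a\<^sup>2) = 1" and b: "v (1 + b\<^sup>2) = 1"
    and ac: "(1 + a\<^sup>2) * (1 + c\<^sup>2) = 2" and bd: "(1 + b\<^sup>2) * (1 + d\<^sup>2) = 2" and ab: "v (a\<^sup>2 - b\<^sup>2) < 1"
  shows "v (c - d) < 1 \<or> v (c + d) < 1"
proof -
  have "(1 + a\<^sup>2) * (1 + b\<^sup>2) * (c\<^sup>2 - d\<^sup>2) = (1 + b\<^sup>2) * ((1 + a\<^sup>2) * (1 + c\<^sup>2)) - (1 + a\<^sup>2) * ((1 + b\<^sup>2) * (1 + d\<^sup>2))"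
    by (simp add: algebra_simps)
  also have "\<dots> = - (2 * (a\<^sup>2 - b\<^sup>2))" unfolding ac bd by (simp add: algebra_simps)
  finally have "v (1 + a\<^sup>2) * v (1 + b\<^sup>2) * v (c\<^sup>2 - d\<^sup>2) = v 2 * v (a\<^sup>2 - b\<^sup>2)" by (metis v_minus v_mult)
  hence "v (c\<^sup>2 - d\<^sup>2) < 1" using ab by (simp only: a b v_two mult_1)
  moreover have "c\<^sup>2 - d\<^sup>2 = (c - d) * (c + d)" by (simp add: power2_eq_square algebra_simps)
  ultimately show ?thesis using product_small by simp
qed

text \<open>A class is determined by the residue of \<open>y\<close>, which fixes that of
  \<open>x\<close> up to sign, and by the half of the residue system that contains
  \<open>x\<close>.\<close>

lemma finite_EF: "finite (carrier (E Mod F))" and card_EF: "card (carrier (E Mod F)) \<le> 2 * p"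
proof -
  let ?f = "\<lambda>c. (res (snd (rep c)), 2 * res (fst (rep c)) < int p)"
  let ?B = "{0..<int p} \<times> (UNIV :: bool set)"
  have inj: "inj_on ?f (carrier (E Mod F))"
  proof (rule inj_onI)
    fix c c' assume c: "c \<in> carrier (E Mod F)" "c' \<in> carrier (E Mod F)" and eq: "?f c = ?f c'"
    obtain x y where xy: "rep c = (x, y)" by (cases "rep c")
    obtain x' y' where xy': "rep c' = (x', y')" by (cases "rep c'")
    have P: "(x, y) \<in> curve" "cls (x, y) = c" and P': "(x', y') \<in> curve" "cls (x', y') = c'"
      using rep[OF c(1)] rep[OF c(2)] xy xy' by auto
    note cP = curveD[OF P(1)] and cP' = curveD[OF P'(1)]
    have ry: "res y = res y'" and rx: "2 * res x < int p \<longleftrightarrow> 2 * res x' < int p" using eq xy xy' by auto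
    have y: "v (y - y') < 1" by (rule res_eqD[OF cP(3) cP'(3) ry])
    have "v (y\<^sup>2 - y'\<^sup>2) < 1"
    proof -
      have "y\<^sup>2 - y'\<^sup>2 = (y - y') * (y + y')" by (simp add: power2_eq_square algebra_simps)
      thus ?thesis using v_mult_less_1[OF y v_add_le[OF cP(3) cP'(3)]] by simp
    qed
    hence "v (x - x') < 1 \<or> v (x + x') < 1"
      using square_diff_small[OF cP(5) cP'(5)] curve_e1[OF P(1)] curve_e1[OF P'(1)]
      by (simp add: mult.commute)
    moreover have "v (x - x') < 1" if xx: "v (x + x') < 1"
    proof -
      note r = res[OF cP(2)] and r' = res[OF cP'(2)]
      have "v ((x + x') - ((x - of_int (res x)) + (x' - of_int (res x')))) < 1"
        by (rule v_diff_less[OF xx v_add_less[OF r(3) r'(3)]])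
      hence "v (of_int (res x + res x')) < 1" by simp
      hence "int p dvd res x + res x'" unfolding v_of_int_less_iff .
      then obtain k where k: "res x + res x' = int p * k" by blast
      have "k = 0 \<or> k = 1"
      proof -
        have "int p * k < int p * 2" using r(2) r'(2) unfolding k[symmetric] by linarith
        hence "k < 2" using prime_gt_0_nat[OF prime_p] by simp
        moreover have "0 \<le> int p * k" using r(1) r'(1) unfolding k[symmetric] by linarith
        hence "0 \<le> k" using prime_gt_0_nat[OF prime_p] by (simp add: zero_le_mult_iff)
        ultimately show ?thesis by linarith
      qed
      thus ?thesis
      proof
        assume "k = 0"
        hence "res x = res x'" using k r(1) r'(1) by simp
        thus ?thesis by (rule res_eqD[OF cP(2) cP'(2)])
      next
        assume "k = 1"
        hence s: "res x + res x' = int p" using k by simp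
        \<comment> \<open>Both residues lie on the same side of \<open>p / 2\<close>, so their sum
          is \<open>p\<close> only if both equal \<open>p / 2\<close>.\<close>
        hence "2 * res x = int p" using rx by linarith
        hence "even (int p)" by (metis dvd_triv_left)
        hence "even p" by simp
        thus ?thesis using p_mod_4 by presburger
      qed
    qed
    ultimately have "v (x - x') < 1" by blast
    from cls_congruent[OF P(1) P'(1) this y] show "c = c'" using P P' by simp
  qed
  have sub: "?f ` carrier (E Mod F) \<subseteq> ?B"
  proof (rule image_subsetI)
    fix c assume c: "c \<in> carrier (E Mod F)"
    obtain x y where xy: "rep c = (x, y)" by (cases "rep c")
    have "v y \<le> 1" using curveD(3)[of x y] rep[OF c] xy by simp
    from res(1,2)[OF this] show "?f c \<in> ?B" by (simp add: xy)
  qed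
  have fin: "finite ?B" by simp
  show "finite (carrier (E Mod F))" by (rule inj_on_finite[OF inj sub fin])
  have "card (carrier (E Mod F)) \<le> card ?B" by (rule card_inj_on_le[OF inj sub fin])
  also have "card ?B = 2 * p" by (simp add: card_cartesian_product)
  finally show "card (carrier (E Mod F)) \<le> 2 * p" .
qed

text \<open>The class of \<open>(1, 0)\<close> has order 4. A multiple of \<open>p\<close> that is
  at most \<open>2 p\<close> and divisible by 4 would be \<open>p\<close> or \<open>2 p\<close>, but
  \<open>p\<close> is odd.\<close>

lemma order_EF: "4 dvd order (E Mod F)" "\<not> p dvd order (E Mod F)" "0 < order (E Mod F)"
proof -
  have c: "(1, 0) \<in> curve" unfolding curve_def by (simp add: e1)
  have two: "(1, 0) [^]\<^bsub>E\<^esub> (2::nat) = (0, - 1)"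
  proof -
    have "(1, 0) [^]\<^bsub>E\<^esub> (2::nat) = point_add (1, 0) (1, 0)"
      by (simp add: numeral_2_eq_2 E.nat_pow_Suc point_add_zero)
    thus ?thesis unfolding point_add_def by (simp add: e1)
  qed
  have four: "(1, 0) [^]\<^bsub>E\<^esub> (4::nat) = (0, 1)"
  proof -
    have "(1, 0) [^]\<^bsub>E\<^esub> (2 + 2 :: nat) = (1, 0) [^]\<^bsub>E\<^esub> (2::nat) \<otimes>\<^bsub>E\<^esub> (1, 0) [^]\<^bsub>E\<^esub> (2::nat)"
      using E.nat_pow_mult[of "(1, 0)" 2 2] c by simp
    thus ?thesis unfolding two by (simp add: minus_one_add)
  qed
  let ?c = "cls (1, 0)"
  have cc: "?c \<in> carrier (E Mod F)" using c by (simp add: carrier_EF)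
  have "?c [^]\<^bsub>E Mod F\<^esub> (4::nat) = \<one>\<^bsub>E Mod F\<^esub>"
    using cls_eq_F_iff[OF zero_curve] F_zero by (simp add: cls_pow[OF c] four)
  hence "EF.ord ?c dvd 4" using EF.pow_eq_id[OF cc] by simp
  moreover have "?c [^]\<^bsub>E Mod F\<^esub> (2::nat) \<noteq> \<one>\<^bsub>E Mod F\<^esub>"
    using cls_eq_F_iff[OF minus_one_curve] minus_one_notin_F by (simp add: cls_pow[OF c] two)
  hence "\<not> EF.ord ?c dvd 2" using EF.pow_eq_id[OF cc] by simp
  ultimately have "EF.ord ?c = 4"
  proof -
    assume d: "EF.ord ?c dvd 4" and nd: "\<not> EF.ord ?c dvd 2"
    have "EF.ord ?c \<le> 4" using d by (rule dvd_imp_le) simp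
    hence "EF.ord ?c \<in> {0, 1, 2, 3, 4}" by auto
    thus ?thesis using d nd by auto
  qed
  thus 4: "4 dvd order (E Mod F)" using EF.ord_dvd_group_order[OF cc] by simp
  show pos: "0 < order (E Mod F)" using finite_EF cc by (auto simp: order_def card_gt_0_iff)
  show "\<not> p dvd order (E Mod F)"
  proof
    assume "p dvd order (E Mod F)"
    then obtain k where k: "order (E Mod F) = p * k" by blast
    have "p * k \<le> p * 2" using card_EF k by (simp add: order_def mult.commute)
    hence "k \<le> 2" using prime_gt_0_nat[OF prime_p] by simp
    hence "k = 0 \<or> k = 1 \<or> k = 2" by linarith
    hence "4 dvd p \<or> 4 dvd p * 2" using 4 k pos by auto
    thus False using p_mod_4 by presburger
  qed
qed

text \<open>If \<open>x\<close> were small, the point would be congruent to \<open>(0, 1)\<close> or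
  \<open>(0, -1)\<close>; the first is excluded by hypothesis, the second by odd order.\<close>

lemma torsion_unit_x:
  assumes P: "(x, y) \<in> curve" and nF: "(x, y) \<notin> F" and l: "odd l" and t: "(x, y) [^]\<^bsub>E\<^esub> (l::nat) \<in> F"
  shows "v x = 1"
proof (rule ccontr)
  assume "v x \<noteq> 1"
  hence "v x < 1" using curveD(2)[OF P] by simp
  hence Q: "(- x, - y) \<in> F" using cases_small_x[OF P] nF by blast
  have "(- x, - y) [^]\<^bsub>E\<^esub> l \<in> F" by (rule F_pow[OF Q])
  moreover have "(- x, - y) \<in> curve" using Q F_subset by blast
  ultimately have "point_add (0, - 1) (- x, - y) [^]\<^bsub>E\<^esub> l \<notin> F"
    using minus_one_shift_torsion[OF _ l] by blast
  thus False using t by (simp add: minus_one_add)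
qed

text \<open>The sum \<open>x^2 + x'^2\<close> is a unit, so congruent fourth powers give congruent
  squares, and then congruent coordinates up to two signs. A wrong sign of \<open>y\<close> would
  differ by \<open>(0, -1)\<close> from a point of odd torsion; the sign of \<open>x\<close>
  accounts for the inverse.\<close>

lemma torsion_fibre:
  assumes P: "(x, y) \<in> curve" "v x = 1" and P': "(x', y') \<in> curve" "v x' = 1" and l: "odd l"
    and t: "(x, y) [^]\<^bsub>E\<^esub> (l::nat) \<in> F" and t': "(x', y') [^]\<^bsub>E\<^esub> l \<in> F"
    and g: "v (x ^ 4 - x' ^ 4) < 1"
  shows "cls (x', y') = cls (x, y) \<or> cls (x', y') = cls (inv\<^bsub>E\<^esub> (x, y))"
proof -
  note c = curveD[OF P(1)] and c' = curveD[OF P'(1)]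
  have "x ^ 4 - x' ^ 4 = (x\<^sup>2 - x'\<^sup>2) * (x\<^sup>2 + x'\<^sup>2)" by (simp add: power2_eq_square power4_eq_xxxx algebra_simps)
  moreover have "v (x\<^sup>2 + x'\<^sup>2) = 1" using v_sum_squares[of x x'] P P' by simp
  ultimately have x2: "v (x\<^sup>2 - x'\<^sup>2) < 1" using g by (simp add: v_mult)
  have u: "v (1 + x\<^sup>2) = 1" "v (1 + x'\<^sup>2) = 1" using c(4) c'(4) by (simp_all add: e1)
  have y: "v (y - y') < 1 \<or> v (y + y') < 1"
    by (rule square_diff_small[OF u curve_e1[OF P(1)] curve_e1[OF P'(1)] x2])
  have x: "v (x - x') < 1 \<or> v (x + x') < 1"
  proof -
    have "x\<^sup>2 - x'\<^sup>2 = (x - x') * (x + x')" by (simp add: power2_eq_square algebra_simps)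
    thus ?thesis using product_small x2 by simp
  qed
  have iP: "inv\<^bsub>E\<^esub> (x, y) = (- x, y)" by (rule inv_E[OF P(1)])
  have ti: "(- x, y) [^]\<^bsub>E\<^esub> l \<in> F"
    using F_neg[OF t] E.nat_pow_inv[of "(x, y)" l] P(1) by (simp add: iP)
  have neg: "(- x, y) \<in> curve" by (rule point_neg_curve[OF P(1)])
  have bad: False if Q: "(a, b) \<in> curve" "(a, b) [^]\<^bsub>E\<^esub> l \<in> F" and s: "v (x' - - a) < 1" "v (y' - - b) < 1" for a b
  proof -
    have nQ: "(- a, - b) \<in> curve" using Q(1) by (simp add: curve_def)
    have "cls (x', y') = cls (- a, - b)" by (rule cls_congruent[OF P'(1) nQ s])
    hence "cls ((x', y') [^]\<^bsub>E\<^esub> l) = cls ((- a, - b) [^]\<^bsub>E\<^esub> l)"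
      using cls_pow[OF P'(1), of l] cls_pow[OF nQ, of l] by simp
    moreover have "cls ((x', y') [^]\<^bsub>E\<^esub> l) = F" using t' cls_eq_F_iff[OF pow_curve[OF P'(1)], of l] by blast
    ultimately have "cls ((- a, - b) [^]\<^bsub>E\<^esub> l) = F" by simp
    hence "(- a, - b) [^]\<^bsub>E\<^esub> l \<in> F" using cls_eq_F_iff[OF pow_curve[OF nQ], of l] by blast
    thus False using minus_one_shift_torsion[OF Q(1) l Q(2)] by (simp add: minus_one_add)
  qed
  have vx: "v (x' - x) < 1" if "v (x - x') < 1" for x x' :: 'k using that by (simp add: v_diff_commute)
  have vx': "v (x' - - x) < 1" if "v (x + x') < 1" for x x' :: 'k using that by (simp add: add.commute)
  from x y show ?thesis
  proof (elim disjE)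
    assume "v (x - x') < 1" "v (y - y') < 1"
    from cls_congruent[OF P'(1) P(1) vx[OF this(1)] vx[OF this(2)]] show ?thesis by blast
  next
    assume a: "v (x - x') < 1" "v (y + y') < 1"
    have "v (x' - - (- x)) < 1" using vx[OF a(1)] by simp
    from bad[OF neg ti this vx'[OF a(2)]] show ?thesis ..
  next
    assume a: "v (x + x') < 1" "v (y - y') < 1"
    from cls_congruent[OF P'(1) neg vx'[OF a(1)] vx[OF a(2)]] show ?thesis by (simp add: iP)
  next
    assume a: "v (x + x') < 1" "v (y + y') < 1"
    from bad[OF P(1) t vx'[OF a(1)] vx'[OF a(2)]] show ?thesis ..
  qed
qed

text \<open>For \<open>l = 2 m + 1\<close> the nontrivial classes map to roots \<open>x^4\<close>
  modulo \<open>p\<close> of a polynomial of degree at most \<open>m^2 + m\<close>, with fibres of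
  at most two classes. Together with the trivial class this gives at most
  \<open>2 (m^2 + m) + 1\<close>, which is less than \<open>l^2\<close>.\<close>

lemma odd_torsion_bound:
  assumes l: "prime l" "odd l" "l \<noteq> p"
  shows "card {c \<in> carrier (E Mod F). c [^]\<^bsub>E Mod F\<^esub> l = \<one>\<^bsub>E Mod F\<^esub>} < l ^ 2"
proof -
  obtain m where lm: "l = 2 * m + 1" using l(2) by (rule oddE)
  have m: "0 < m" using l(1) lm by (cases m) auto
  obtain A B where AB: "division_polys m A B" using ex_division_polys[OF e1 m] by blast
  obtain A' B' where AB': "division_polys (Suc m) A' B'" using ex_division_polys[OF e1, of "Suc m"] by blast
  define f where "f = A' * B - A * B'"
  have f: "integral_poly f" "degree f \<le> m\<^sup>2 + m" "poly f 0 = of_nat l"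
    unfolding f_def lm using odd_poly_integral[OF AB AB'] odd_poly_degree[OF AB AB'] odd_poly_0[OF AB AB'] by auto
  define T where "T = {c \<in> carrier (E Mod F). c [^]\<^bsub>E Mod F\<^esub> l = \<one>\<^bsub>E Mod F\<^esub>} - {F}"
  have finT: "finite T" using finite_EF by (simp add: T_def)
  define g where "g c = res (fst (rep c) ^ 4)" for c
  have T: "rep c \<in> curve \<and> cls (rep c) = c \<and> rep c [^]\<^bsub>E\<^esub> l \<in> F \<and> v (fst (rep c)) = 1" if c: "c \<in> T" for c
  proof -
    have cc: "c \<in> carrier (E Mod F)" and cl: "c [^]\<^bsub>E Mod F\<^esub> l = F" and cF: "c \<noteq> F" using c by (auto simp: T_def)
    have r: "rep c \<in> curve" "cls (rep c) = c" using rep[OF cc] by auto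
    have "cls (rep c [^]\<^bsub>E\<^esub> l) = F" using cl cls_pow[OF r(1), of l] unfolding r(2) by simp
    hence t: "rep c [^]\<^bsub>E\<^esub> l \<in> F" using cls_eq_F_iff[OF pow_curve[OF r(1)], of l] by blast
    have "rep c \<notin> F" using cF r cls_eq_F_iff[OF r(1)] by simp
    hence "v (fst (rep c)) = 1"
      using torsion_unit_x[of "fst (rep c)" "snd (rep c)", OF _ _ l(2)] r(1) t by simp
    with r t show ?thesis by blast
  qed
  have root: "v (poly f (of_int (g c))) < 1" if c: "c \<in> T" for c
  proof -
    obtain x y where xy: "rep c = (x, y)" by (cases "rep c")
    have P: "(x, y) \<in> curve" and t: "(x, y) [^]\<^bsub>E\<^esub> l \<in> F" and vx: "v x = 1" using T[OF c] xy by auto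
    have x0: "x \<noteq> 0" using vx by auto
    have x4: "v (x ^ 4) = 1" by (simp add: v_power vx)
    define h where "h = fst ((x, y) [^]\<^bsub>E\<^esub> (2 * m + 1))"
    have "(h, snd ((x, y) [^]\<^bsub>E\<^esub> l)) \<in> F" using t by (simp add: h_def lm)
    from F_bounds(1)[OF this] have "v h < 1"
      using v_nonneg[of h] by (simp add: e1 v_power power2_less_1_iff)
    note r = division_polys_odd_relation[OF e1 AB AB' P x0]
    define D where "D = poly B (x ^ 4) * poly B' (x ^ 4) + x ^ 4 * (poly A (x ^ 4) * poly A' (x ^ 4))"
    have D1: "v D = 1" using r(2) unfolding D_def .
    have D2: "h * D = x * (poly A' (x ^ 4) * poly B (x ^ 4) - poly A (x ^ 4) * poly B' (x ^ 4))"
      using r(1) unfolding D_def h_def .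
    have "x * poly f (x ^ 4) = h * D" unfolding D2 f_def by simp
    hence "v x * v (poly f (x ^ 4)) = v h * v D" by (metis v_mult)
    hence fx: "v (poly f (x ^ 4)) < 1" using vx D1 \<open>v h < 1\<close> by simp
    have rg: "v (x ^ 4 - of_int (g c)) < 1" using res(3)[of "x ^ 4"] x4 by (simp add: g_def xy)
    have "v (poly f (of_int (g c)) - poly f (x ^ 4)) \<le> v (of_int (g c) - x ^ 4)"
      by (rule v_poly_diff[OF f(1) v_of_int_le]) (simp add: x4)
    hence "v (poly f (of_int (g c)) - poly f (x ^ 4)) < 1" using rg by (simp add: v_diff_commute)
    hence "v ((poly f (of_int (g c)) - poly f (x ^ 4)) + poly f (x ^ 4)) < 1" using fx by (rule v_add_less)
    thus ?thesis by simp
  qed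
  have gr: "0 \<le> g c \<and> g c < int p" if c: "c \<in> T" for c
    using res[of "fst (rep c) ^ 4"] T[OF c] by (simp add: g_def v_power)
  have card_g: "card (g ` T) \<le> m\<^sup>2 + m"
  proof (rule ccontr)
    assume "\<not> card (g ` T) \<le> m\<^sup>2 + m"
    hence big: "degree f < card (g ` T)" using f(2) by linarith
    have ic: "card (of_int ` g ` T :: 'k set) = card (g ` T)"
      by (rule card_image) (simp add: inj_on_def)
    \<comment> \<open>Too many roots would make \<open>f\<close> vanish modulo \<open>p\<close>
      everywhere, in particular at 0, where its value is \<open>l\<close>.\<close>
    have "v (poly f 0) < 1"
    proof (rule roots_mod_p[OF f(1)])
      show "finite (of_int ` g ` T :: 'k set)" using finT by simp
      show "degree f < card (of_int ` g ` T :: 'k set)" using big ic by simp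
      show "v a \<le> 1 \<and> v (poly f a) < 1" if "a \<in> of_int ` g ` T" for a
        using that root v_of_int_le by auto
      show "v (a - b) = 1" if "a \<in> of_int ` g ` T" "b \<in> of_int ` g ` T" "a \<noteq> b" for a b
        using that gr by (auto intro!: v_int_diff)
    qed simp
    hence "int p dvd int l" using v_of_int_less_iff[of "int l"] f(3) by simp
    hence "p dvd l" by simp
    thus False using primes_dvd_imp_eq[OF prime_p l(1)] l(3) by blast
  qed
  have fibre: "card {c \<in> T. g c = n} \<le> 2" for n
  proof (cases "{c \<in> T. g c = n} = {}")
    case False
    then obtain d where d: "d \<in> T" "g d = n" by blast
    have "{c \<in> T. g c = n} \<subseteq> {d, inv\<^bsub>E Mod F\<^esub> d}"
    proof
      fix c assume "c \<in> {c \<in> T. g c = n}"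
      hence c: "c \<in> T" "g c = g d" using d by auto
      obtain x y where xy: "rep d = (x, y)" by (cases "rep d")
      obtain x' y' where xy': "rep c = (x', y')" by (cases "rep c")
      note Td = T[OF d(1), unfolded xy] and Tc = T[OF c(1), unfolded xy']
      have "v (x ^ 4 - x' ^ 4) < 1"
        using res_eqD[of "x ^ 4" "x' ^ 4"] c(2) Td Tc by (simp add: g_def xy xy' v_power)
      hence "cls (x', y') = cls (x, y) \<or> cls (x', y') = cls (inv\<^bsub>E\<^esub> (x, y))"
        using torsion_fibre[of x y x' y' l] Td Tc l(2) by simp
      thus "c \<in> {d, inv\<^bsub>E Mod F\<^esub> d}" using Td Tc cls_inv[of "(x, y)"] by auto
    qed
    hence "card {c \<in> T. g c = n} \<le> card {d, inv\<^bsub>E Mod F\<^esub> d}" by (intro card_mono) auto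
    also have "\<dots> \<le> 2" by (simp add: card_insert_if)
    finally show ?thesis .
  next
    case True
    show ?thesis unfolding True by simp
  qed
  have "T = (\<Union>n\<in>g ` T. {c \<in> T. g c = n})" by blast
  hence "card T = card (\<Union>n\<in>g ` T. {c \<in> T. g c = n})" by simp
  also have "\<dots> \<le> (\<Sum>n\<in>g ` T. card {c \<in> T. g c = n})" by (rule card_UN_le) (simp add: finT)
  also have "\<dots> \<le> (\<Sum>n\<in>g ` T. 2)" by (rule sum_mono[OF fibre])
  also have "\<dots> \<le> 2 * (m\<^sup>2 + m)" using card_g by simp
  finally have cT: "card T \<le> 2 * (m\<^sup>2 + m)" .
  have "card {c \<in> carrier (E Mod F). c [^]\<^bsub>E Mod F\<^esub> l = \<one>\<^bsub>E Mod F\<^esub>} \<le> card (insert F T)"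
    by (rule card_mono) (auto simp: T_def finite_EF)
  also have "\<dots> \<le> 2 * (m\<^sup>2 + m) + 1" using cT by (simp add: card_insert_if finT)
  also have "\<dots> < l ^ 2" unfolding lm using m by (simp add: power2_eq_square)
  finally show ?thesis .
qed

text \<open>The second coordinate of the double differs from 1 by \<open>2 x^2\<close> up to a unit.
  A 2-torsion class therefore has small \<open>x\<close>, which leaves the classes of
  \<open>(0, 1)\<close> and \<open>(0, -1)\<close>.\<close>

lemma two_torsion_bound:
  "card {c \<in> carrier (E Mod F). c [^]\<^bsub>E Mod F\<^esub> (2::nat) = \<one>\<^bsub>E Mod F\<^esub>} < 2 ^ 2"
proof -
  have "{c \<in> carrier (E Mod F). c [^]\<^bsub>E Mod F\<^esub> (2::nat) = \<one>\<^bsub>E Mod F\<^esub>} \<subseteq> {F, cls (0, - 1)}"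
  proof
    fix c assume "c \<in> {c \<in> carrier (E Mod F). c [^]\<^bsub>E Mod F\<^esub> (2::nat) = \<one>\<^bsub>E Mod F\<^esub>}"
    hence cc: "c \<in> carrier (E Mod F)" and c2: "c [^]\<^bsub>E Mod F\<^esub> (2::nat) = F" by auto
    obtain x y where xy: "rep c = (x, y)" by (cases "rep c")
    have P: "(x, y) \<in> curve" "cls (x, y) = c" using rep[OF cc] xy by auto
    have "(x, y) [^]\<^bsub>E\<^esub> (2::nat) = point_add (x, y) (x, y)"
      by (simp add: numeral_2_eq_2 E.nat_pow_Suc point_add_zero)
    hence "cls (point_add (x, y) (x, y)) = F" using c2 cls_pow[OF P(1), of 2] unfolding P(2) by simp
    hence "point_add (x, y) (x, y) \<in> F" using cls_eq_F_iff[OF point_add_closed[OF P(1) P(1)]] by blast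
    hence s: "v (snd (point_add (x, y) (x, y)) - 1) < 1" by (simp add: F_def)
    have d: "v (1 + e * x * x * y * y) = 1" by (rule denominator_unit'[OF P(1) P(1)])
    hence d0: "1 + e * x * x * y * y \<noteq> 0" by auto
    have "snd (point_add (x, y) (x, y)) - 1 = (y * y - x * x - 1 - x * x * y * y) / (1 + e * x * x * y * y)"
      using d0 unfolding point_add_def by (simp add: e1 field_simps)
    also have "y * y - x * x - 1 - x * x * y * y = - (2 * x\<^sup>2 * (1 + y\<^sup>2))"
      using curveD(1)[OF P(1)] by (simp add: e1 power2_eq_square algebra_simps)
    finally have "v (snd (point_add (x, y) (x, y)) - 1) = (v x)\<^sup>2"
      using curveD(5)[OF P(1)] v_two by (simp only: v_divide d v_minus v_mult v_power)
    hence "v x < 1" using s v_nonneg[of x] by (simp add: power2_less_1_iff)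
    from cases_small_x[OF P(1) this] show "c \<in> {F, cls (0, - 1)}"
    proof
      assume "(x, y) \<in> F"
      thus ?thesis using P cls_eq_F_iff[OF P(1)] by simp
    next
      assume "(- x, - y) \<in> F"
      hence "v (- y - 1) < 1" by (simp add: F_def)
      hence "v (y - - 1) < 1" by (simp add: v_minus_minus_one add.commute)
      hence "cls (x, y) = cls (0, - 1)"
        using \<open>v x < 1\<close> by (intro cls_congruent[OF P(1) minus_one_curve]) auto
      thus ?thesis using P by simp
    qed
  qed
  hence "card {c \<in> carrier (E Mod F). c [^]\<^bsub>E Mod F\<^esub> (2::nat) = \<one>\<^bsub>E Mod F\<^esub>} \<le> card {F, cls (0, - 1)}"
    by (intro card_mono) auto
  also have "\<dots> < 2 ^ 2" by (simp add: card_insert_if)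
  finally show ?thesis .
qed

lemma cyclic_mod_F_e1:
  "\<exists>g\<in>curve. \<exists>N. \<not> p dvd N \<and> g [^]\<^bsub>E\<^esub> (N::nat) \<in> F \<and>
     (\<forall>P\<in>curve. \<exists>i::nat. point_add P (inv\<^bsub>E\<^esub> (g [^]\<^bsub>E\<^esub> i)) \<in> F)"
proof -
  have "card {c \<in> carrier (E Mod F). c [^]\<^bsub>E Mod F\<^esub> l = \<one>\<^bsub>E Mod F\<^esub>} < l ^ 2" if l: "prime l" for l
  proof -
    consider "l = 2" | "l = p" | "odd l" "l \<noteq> p" using l prime_odd_nat[of l] prime_ge_2_nat[OF l] by linarith
    then show ?thesis
    proof cases
      case 1
      then show ?thesis using two_torsion_bound by simp
    next
      case 2
      \<comment> \<open>For \<open>l = p\<close> the value \<open>l\<close> of the polynomial at 0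
        vanishes modulo \<open>p\<close>, so the bound on the whole group takes over.\<close>
      have "card {c \<in> carrier (E Mod F). c [^]\<^bsub>E Mod F\<^esub> l = \<one>\<^bsub>E Mod F\<^esub>} \<le> card (carrier (E Mod F))"
        by (rule card_mono[OF finite_EF]) auto
      also have "\<dots> \<le> 2 * p" by (rule card_EF)
      also have "\<dots> < p * p" using prime_gt_1_nat[OF prime_p] p_ne_2 by simp
      finally show ?thesis using 2 by (simp add: power2_eq_square)
    next
      case 3
      then show ?thesis using odd_torsion_bound[OF l] by blast
    qed
  qed
  then obtain c where c: "c \<in> carrier (E Mod F)"
    and gen: "\<And>d. d \<in> carrier (E Mod F) \<Longrightarrow> \<exists>n::nat. d = c [^]\<^bsub>E Mod F\<^esub> n"
    by (rule EF.cyclic_of_small_torsion[OF finite_EF]) (assumption, rule that)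
  have g: "rep c \<in> curve" "cls (rep c) = c" using rep[OF c] by auto
  have "c [^]\<^bsub>E Mod F\<^esub> order (E Mod F) = F" using EF.pow_order_eq_1[OF c] by simp
  hence "cls (rep c [^]\<^bsub>E\<^esub> order (E Mod F)) = F"
    using cls_pow[OF g(1), of "order (E Mod F)"] unfolding g(2) by simp
  hence "rep c [^]\<^bsub>E\<^esub> order (E Mod F) \<in> F"
    using cls_eq_F_iff[OF pow_curve[OF g(1)], of "order (E Mod F)"] by blast
  moreover have "\<exists>i::nat. point_add P (inv\<^bsub>E\<^esub> (rep c [^]\<^bsub>E\<^esub> i)) \<in> F" if P: "P \<in> curve" for P
  proof -
    obtain i :: nat where "cls P = c [^]\<^bsub>E Mod F\<^esub> i" using gen[of "cls P"] P by (auto simp: carrier_EF)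
    hence "cls P = cls (rep c [^]\<^bsub>E\<^esub> i)" using cls_pow[OF g(1), of i] unfolding g(2) by simp
    thus ?thesis using cls_eq_iff[OF P pow_curve[OF g(1)]] by blast
  qed
  ultimately show ?thesis using g(1) order_EF(2) by blast
qed

end

text \<open>For \<open>e = p\<close> the curve degenerates modulo \<open>p\<close> to
  \<open>y^2 = 1\<close>; there are two classes, generated by \<open>(0, -1)\<close>, with
  \<open>N = 2\<close>.\<close>

lemma cyclic_mod_F:
  "\<exists>g\<in>curve. \<exists>N. \<not> p dvd N \<and> g [^]\<^bsub>E\<^esub> (N::nat) \<in> F \<and>
     (\<forall>P\<in>curve. \<exists>i::nat. point_add P (inv\<^bsub>E\<^esub> (g [^]\<^bsub>E\<^esub> i)) \<in> F)"
proof (cases "e = 1")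
  case True
  then show ?thesis by (rule cyclic_mod_F_e1)
next
  case False
  hence e: "e = of_nat p" using e_cases by simp
  have ve: "v e < 1" using p_gt_1 by (simp add: e v_p)
  have one: "(0, - 1) [^]\<^bsub>E\<^esub> (0::nat) = (0, 1)" "(0, - 1) [^]\<^bsub>E\<^esub> (1::nat) = (0, - 1)"
    "(0, - 1) [^]\<^bsub>E\<^esub> (2::nat) = (0, 1)"
    by (simp_all add: numeral_2_eq_2 E.nat_pow_Suc point_add_zero minus_one_add)
  have "\<exists>i::nat. point_add P (inv\<^bsub>E\<^esub> ((0, - 1) [^]\<^bsub>E\<^esub> i)) \<in> F" if P: "P \<in> curve" for P
  proof -
    obtain x y where xy: "P = (x, y)" by (cases P)
    note c = curveD[OF P[unfolded xy]]
    have "(1 - y) * (1 + y) = e * (x\<^sup>2 * (1 + y\<^sup>2))" using c(1) by (simp add: power2_eq_square algebra_simps)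
    moreover have "v (e * (x\<^sup>2 * (1 + y\<^sup>2))) < 1"
      using c(2,5) v_nonneg[of x] by (intro v_mult_less_1[OF ve]) (simp add: v_mult v_power power_le_one)
    ultimately have "v (1 - y) < 1 \<or> v (1 + y) < 1" using product_small by metis
    thus ?thesis
    proof
      assume "v (1 - y) < 1"
      hence "P \<in> F" using P by (simp add: xy F_def v_diff_commute)
      moreover have "point_add P (inv\<^bsub>E\<^esub> ((0, - 1) [^]\<^bsub>E\<^esub> (0::nat))) = P"
        unfolding one inv_E[OF zero_curve] by (subst point_add_commute) (simp add: point_add_zero)
      ultimately show ?thesis by (intro exI[of _ 0]) simp
    next
      assume "v (1 + y) < 1"
      moreover have "(- x, - y) \<in> curve" using P by (simp add: xy curve_def)
      ultimately have "(- x, - y) \<in> F" by (simp add: F_def v_minus_minus_one)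
      moreover have "point_add P (inv\<^bsub>E\<^esub> ((0, - 1) [^]\<^bsub>E\<^esub> (1::nat))) = (- x, - y)"
        unfolding one inv_E[OF minus_one_curve] by (subst point_add_commute) (simp add: minus_one_add xy)
      ultimately show ?thesis by (intro exI[of _ 1]) simp
    qed
  qed
  moreover have "\<not> p dvd 2" using p_ne_2 prime_p primes_dvd_imp_eq[OF prime_p two_is_prime_nat] by blast
  ultimately show ?thesis
    using minus_one_curve one(3) F_zero by (intro bexI[of _ "(0, - 1)"] exI[of _ 2]) auto
qed

end

section \<open>Approximation by rational points of the twists\<close>

context padic_edwards
begin

lemma sub_pow:
  assumes "P \<in> curve" "Q \<in> curve"
  shows "point_add (P [^]\<^bsub>E\<^esub> (n::nat)) (inv\<^bsub>E\<^esub> (Q [^]\<^bsub>E\<^esub> n)) = point_add P (inv\<^bsub>E\<^esub> Q) [^]\<^bsub>E\<^esub> n"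
proof -
  have PE: "P \<in> carrier E" and QE: "Q \<in> carrier E" using assms by simp_all
  have "(P \<otimes>\<^bsub>E\<^esub> inv\<^bsub>E\<^esub> Q) [^]\<^bsub>E\<^esub> n = P [^]\<^bsub>E\<^esub> n \<otimes>\<^bsub>E\<^esub> (inv\<^bsub>E\<^esub> Q) [^]\<^bsub>E\<^esub> n"
    by (rule E.pow_mult_distrib[OF E.m_comm]) (use PE QE in \<open>auto simp del: E_simps\<close>)
  also have "(inv\<^bsub>E\<^esub> Q) [^]\<^bsub>E\<^esub> n = inv\<^bsub>E\<^esub> (Q [^]\<^bsub>E\<^esub> n)" by (rule E.nat_pow_inv[OF QE])
  finally show ?thesis by simp
qed

lemma inv_closed_curve: "P \<in> curve \<Longrightarrow> inv\<^bsub>E\<^esub> P \<in> curve"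
  using E.inv_closed[of P] by simp

lemma sub_mult:
  assumes "P \<in> curve" "Q \<in> curve" "R \<in> curve"
  shows "point_add P (inv\<^bsub>E\<^esub> (point_add Q R)) = point_add (point_add P (inv\<^bsub>E\<^esub> Q)) (inv\<^bsub>E\<^esub> R)"
proof -
  have "inv\<^bsub>E\<^esub> (point_add Q R) = point_add (inv\<^bsub>E\<^esub> Q) (inv\<^bsub>E\<^esub> R)"
    using E.inv_mult[of Q R] assms by simp
  thus ?thesis using point_add_assoc[OF assms(1) inv_closed_curve[OF assms(2)] inv_closed_curve[OF assms(3)]] by simp
qed

text \<open>If the power \<open>g\<^sup>N\<close> of a generator modulo \<open>F\<close> does not generate \<open>F\<close> topologically, then
  \<open>(g + G\<^sub>0)\<^sup>N\<close> does for any topological generator \<open>G\<^sub>0\<close> of \<open>F\<close>, because \<open>p\<close> does not divide \<open>N\<close>.\<close>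

lemma ex_topological_generator:
  "\<exists>G\<in>curve. \<forall>P\<in>curve. \<forall>r>0. \<exists>n::nat. point_add P (inv\<^bsub>E\<^esub> (G [^]\<^bsub>E\<^esub> n)) \<in> F \<and>
     v (fst (point_add P (inv\<^bsub>E\<^esub> (G [^]\<^bsub>E\<^esub> n)))) < r"
proof -
  obtain g N where g: "g \<in> curve" "\<not> p dvd N" "g [^]\<^bsub>E\<^esub> (N::nat) \<in> F"
    and gen: "\<And>P. P \<in> curve \<Longrightarrow> \<exists>i::nat. point_add P (inv\<^bsub>E\<^esub> (g [^]\<^bsub>E\<^esub> i)) \<in> F"
    using cyclic_mod_F by metis
  obtain G0 where G0: "G0 \<in> F" and max: "\<And>P. P \<in> F \<Longrightarrow> v (fst P) \<le> v (fst G0)"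
    by (rule F_maximal) (rule that)
  have G0c: "G0 \<in> curve" using G0 F_subset by blast
  define H where "H = g [^]\<^bsub>E\<^esub> N"
  have H: "H \<in> F" using g(3) by (simp add: H_def)
  have "\<exists>G\<in>curve. G [^]\<^bsub>E\<^esub> N \<in> F \<and> v (fst (G [^]\<^bsub>E\<^esub> N)) = v (fst G0) \<and>
      (\<forall>P\<in>curve. \<exists>i::nat. point_add P (inv\<^bsub>E\<^esub> (G [^]\<^bsub>E\<^esub> i)) \<in> F)"
  proof (cases "v (fst H) = v (fst G0)")
    case True
    then show ?thesis using g(1) H gen unfolding H_def by blast
  next
    case False
    hence lt: "v (fst H) < v (fst G0)" using max[OF H] by simp
    hence nz: "0 < v (fst G0)" using v_nonneg[of "fst H"] by linarith
    define G where "G = point_add g G0"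
    have Gc: "G \<in> curve" unfolding G_def by (rule point_add_closed[OF g(1) G0c])
    have pw: "G [^]\<^bsub>E\<^esub> n = point_add (g [^]\<^bsub>E\<^esub> n) (G0 [^]\<^bsub>E\<^esub> n)" for n :: nat
      using E.pow_mult_distrib[OF E.m_comm, of g G0 n] g(1) G0c by (simp add: G_def)
    have K: "G0 [^]\<^bsub>E\<^esub> N \<in> F" by (rule F_pow[OF G0])
    have GN: "G [^]\<^bsub>E\<^esub> N = point_add H (G0 [^]\<^bsub>E\<^esub> N)" by (simp add: pw H_def)
    have small: "v (fst G0) / (real p)\<^sup>2 < v (fst G0)"
      using mult_strict_left_mono[OF less_le_trans[OF inverse_p2_less(1)] nz, of 1] p_gt_1 by simp
    \<comment> \<open>As \<open>N\<close> is a unit, the \<open>N\<close>-th multiple of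
      \<open>G0\<close> keeps maximal size, and adding the smaller \<open>H\<close> does not change
      it.\<close>
    have "v (of_nat N) = 1" using v_of_int_eq_1_iff[of "int N"] g(2) by simp
    hence "v (of_nat N * fst G0) = v (fst G0)" by (simp add: v_mult)
    hence "v (of_nat N * fst G0 + (fst (G0 [^]\<^bsub>E\<^esub> N) - of_nat N * fst G0)) = v (fst G0)"
      using fst_pow_F(1)[OF G0, of N] small by (subst v_add_eq) auto
    hence vK: "v (fst (G0 [^]\<^bsub>E\<^esub> N)) = v (fst G0)" by simp
    have "v (fst (point_add H (G0 [^]\<^bsub>E\<^esub> N)) - (fst H + fst (G0 [^]\<^bsub>E\<^esub> N))) \<le> v (fst G0) / (real p)\<^sup>2"
      using fst_point_add_F[OF H K] lt vK by simp
    hence "v ((fst (point_add H (G0 [^]\<^bsub>E\<^esub> N)) - (fst H + fst (G0 [^]\<^bsub>E\<^esub> N))) + fst H) < v (fst G0)"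
      using lt small by (intro v_add_less) auto
    hence "v (fst (G0 [^]\<^bsub>E\<^esub> N) + ((fst (point_add H (G0 [^]\<^bsub>E\<^esub> N)) - (fst H + fst (G0 [^]\<^bsub>E\<^esub> N))) + fst H)) = v (fst G0)"
      unfolding vK[symmetric] by (rule v_add_eq)
    hence "v (fst (G [^]\<^bsub>E\<^esub> N)) = v (fst G0)" by (simp add: GN)
    moreover have "G [^]\<^bsub>E\<^esub> N \<in> F" unfolding GN by (rule F_add[OF H K])
    moreover have "\<exists>i::nat. point_add P (inv\<^bsub>E\<^esub> (G [^]\<^bsub>E\<^esub> i)) \<in> F" if P: "P \<in> curve" for P
    proof -
      obtain i :: nat where "point_add P (inv\<^bsub>E\<^esub> (g [^]\<^bsub>E\<^esub> i)) \<in> F" using gen[OF P] by blast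
      hence "point_add (point_add P (inv\<^bsub>E\<^esub> (g [^]\<^bsub>E\<^esub> i))) (inv\<^bsub>E\<^esub> (G0 [^]\<^bsub>E\<^esub> i)) \<in> F"
        by (rule F_add[OF _ F_neg[OF F_pow[OF G0]]])
      thus ?thesis using sub_mult[OF P pow_curve[OF g(1)] pow_curve[OF G0c]] pw by metis
    qed
    ultimately show ?thesis using Gc by blast
  qed
  then obtain G where G: "G \<in> curve" "G [^]\<^bsub>E\<^esub> N \<in> F" "v (fst (G [^]\<^bsub>E\<^esub> N)) = v (fst G0)"
    and genG: "\<And>P. P \<in> curve \<Longrightarrow> \<exists>i::nat. point_add P (inv\<^bsub>E\<^esub> (G [^]\<^bsub>E\<^esub> i)) \<in> F" by blast
  have "\<exists>n::nat. point_add P (inv\<^bsub>E\<^esub> (G [^]\<^bsub>E\<^esub> n)) \<in> F \<and> v (fst (point_add P (inv\<^bsub>E\<^esub> (G [^]\<^bsub>E\<^esub> n)))) < r"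
    if P: "P \<in> curve" and r: "0 < r" for P r
  proof -
    obtain i :: nat where i: "point_add P (inv\<^bsub>E\<^esub> (G [^]\<^bsub>E\<^esub> i)) \<in> F" using genG[OF P] by blast
    have "1 / real p < 1" using p_gt_1 by simp
    moreover have "0 < r / (v (fst G0) + 1)" using r v_nonneg[of "fst G0"] by (simp add: add_nonneg_pos)
    ultimately obtain k where k: "(1 / real p) ^ k < r / (v (fst G0) + 1)"
      using real_arch_pow_inv by blast
    define K where "K = G [^]\<^bsub>E\<^esub> N"
    have "\<exists>m::nat. v (fst (point_add (point_add P (inv\<^bsub>E\<^esub> (G [^]\<^bsub>E\<^esub> i))) (inv\<^bsub>E\<^esub> (K [^]\<^bsub>E\<^esub> m)))) \<le> v (fst K) / real p ^ k"
      by (rule F_generator_dense[OF _ _ i]) (use G(2,3) max in \<open>auto simp: K_def\<close>)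
    then obtain m :: nat where m: "v (fst (point_add (point_add P (inv\<^bsub>E\<^esub> (G [^]\<^bsub>E\<^esub> i))) (inv\<^bsub>E\<^esub> (K [^]\<^bsub>E\<^esub> m)))) \<le> v (fst K) / real p ^ k"
      by blast
    have KF: "K \<in> F" using G(2) by (simp add: K_def)
    have GE: "G \<in> carrier E" using G(1) by simp
    have "point_add (G [^]\<^bsub>E\<^esub> i) (K [^]\<^bsub>E\<^esub> m) = G [^]\<^bsub>E\<^esub> (i + N * m)"
      using E.nat_pow_mult[OF GE, of i "N * m"] E.nat_pow_pow[OF GE, of N m] by (simp add: K_def)
    moreover have "K \<in> curve" using KF F_subset by blast
    ultimately have eq: "point_add P (inv\<^bsub>E\<^esub> (G [^]\<^bsub>E\<^esub> (i + N * m))) =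
        point_add (point_add P (inv\<^bsub>E\<^esub> (G [^]\<^bsub>E\<^esub> i))) (inv\<^bsub>E\<^esub> (K [^]\<^bsub>E\<^esub> m))"
      using sub_mult[OF P pow_curve[OF G(1)] pow_curve, of K i m] by simp
    have "v (fst K) / real p ^ k < r"
    proof -
      have "v (fst K) * (1 / real p) ^ k \<le> (v (fst G0) + 1) * (1 / real p) ^ k"
        using G(3) p_gt_1 by (intro mult_right_mono) (auto simp: K_def)
      also have "\<dots> < r" using k v_nonneg[of "fst G0"] by (simp add: pos_less_divide_eq mult.commute add_nonneg_pos)
      finally show ?thesis by (simp add: power_divide)
    qed
    with m have "v (fst (point_add P (inv\<^bsub>E\<^esub> (G [^]\<^bsub>E\<^esub> (i + N * m))))) < r" unfolding eq by linarith
    moreover have "point_add P (inv\<^bsub>E\<^esub> (G [^]\<^bsub>E\<^esub> (i + N * m))) \<in> F"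
      unfolding eq by (rule F_add[OF i F_neg[OF F_pow[OF KF]]])
    ultimately show ?thesis by blast
  qed
  with G(1) show ?thesis by blast
qed

text \<open>For the difference \<open>(a, b)\<close> in \<open>F\<close>, \<open>b + 1\<close> is a
  unit and \<open>(b - 1) (b + 1)\<close> is a multiple of \<open>a\<close>, so \<open>v a\<close>
  bounds \<open>v (b - 1)\<close> too. Hence the first coordinate of a difference controls both
  coordinates.\<close>

lemma coordinates_close:
  assumes P: "P \<in> curve" and Q: "Q \<in> curve" and R: "point_add P (inv\<^bsub>E\<^esub> Q) \<in> F"
  shows "v (fst P - fst Q) \<le> v (fst (point_add P (inv\<^bsub>E\<^esub> Q)))"
    and "v (snd P - snd Q) \<le> v (fst (point_add P (inv\<^bsub>E\<^esub> Q)))"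
proof -
  obtain a b where ab: "point_add P (inv\<^bsub>E\<^esub> Q) = (a, b)" by (cases "point_add P (inv\<^bsub>E\<^esub> Q)")
  obtain x y where xy: "Q = (x, y)" by (cases Q)
  have R': "(a, b) \<in> F" and Rc: "(a, b) \<in> curve" using R F_subset ab by auto
  have Qc: "(x, y) \<in> curve" using Q xy by simp
  note cQ = curveD[OF Qc] and cR = curveD[OF Rc]
  have PQR: "P = point_add (x, y) (a, b)"
  proof -
    have "P \<otimes>\<^bsub>E\<^esub> inv\<^bsub>E\<^esub> Q = (a, b)" using ab by simp
    hence "P = (a, b) \<otimes>\<^bsub>E\<^esub> Q" using E.inv_solve_right'[of "(a, b)" P Q] P Q Rc by auto
    thus ?thesis by (simp add: xy point_add_commute)
  qed
  have b1: "v (b - 1) < 1" using R' by (simp add: F_def)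
  have "v (2 + (b - 1)) = v 2" using b1 v_two by (intro v_add_eq) simp
  hence "v (b + 1) = 1" using v_two by (simp add: add.commute)
  moreover have "(b - 1) * (b + 1) = a * (- (e * a * (1 + b\<^sup>2)))"
    using cR(1) by (simp add: power2_eq_square algebra_simps)
  ultimately have "v (b - 1) = v a * v (- (e * a * (1 + b\<^sup>2)))" by (metis mult.right_neutral v_mult)
  also have "\<dots> \<le> v a"
    by (rule mult_left_le[OF _ v_nonneg])
       (use cR v_e(1) in \<open>auto simp: v_minus intro!: v_mult_le_1\<close>)
  finally have vb: "v (b - 1) \<le> v a" .
  have le: "v (c * d) \<le> v a" if "v c \<le> v a" "v d \<le> 1" for c d
    using mult_left_le[OF that(2) v_nonneg[of c]] that(1) by (simp add: v_mult)
  have d: "v (1 - e * x * a * y * b) = 1" "v (1 + e * x * a * y * b) = 1"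
    by (rule denominator_unit[OF Qc Rc] denominator_unit'[OF Qc Rc])+
  have d0: "1 - e * x * a * y * b \<noteq> 0" "1 + e * x * a * y * b \<noteq> 0" using d by auto
  have 1: "fst P - x = ((b - 1) * x + a * (y + e * x * x * y * b)) / (1 - e * x * a * y * b)"
    using d0 unfolding PQR point_add_def by (simp add: field_simps)
  have 2: "snd P - y = ((b - 1) * y - a * (e * x * (1 + y * y * b))) / (1 + e * x * a * y * b)"
    using d0 unfolding PQR point_add_def by (simp add: field_simps)
  have i: "v (y + e * x * x * y * b) \<le> 1" "v (e * x * (1 + y * y * b)) \<le> 1"
    by (intro v_add_le v_mult_le_1 cQ cR v_e(1) | simp)+
  have "v (fst P - x) \<le> v a"
    unfolding 1 v_divide d div_by_1 by (intro v_add_le le vb cQ(2) i(1) order_refl)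
  moreover have "v (snd P - y) \<le> v a"
    unfolding 2 v_divide d div_by_1 by (intro v_diff_le le vb cQ(3) i(2) order_refl)
  ultimately show "v (fst P - fst Q) \<le> v (fst (point_add P (inv\<^bsub>E\<^esub> Q)))"
    "v (snd P - snd Q) \<le> v (fst (point_add P (inv\<^bsub>E\<^esub> Q)))"
    unfolding ab unfolding xy fst_conv snd_conv by simp_all
qed

text \<open>The converse estimate to \<open>coordinates_close\<close>; the bound
  \<open>d \<le> 1\<close> ensures that the points are congruent.\<close>

lemma difference_small:
  assumes P: "(x, y) \<in> curve" and Q: "(x', y') \<in> curve"
    and d: "d \<le> 1" "v (x - x') < d" "v (y - y') < d"
  shows "point_add (x, y) (inv\<^bsub>E\<^esub> (x', y')) \<in> F" "v (fst (point_add (x, y) (inv\<^bsub>E\<^esub> (x', y')))) < d"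
proof -
  have "v (x - x') < 1" "v (y - y') < 1" using d by linarith+
  thus "point_add (x, y) (inv\<^bsub>E\<^esub> (x', y')) \<in> F"
    using cls_congruent[OF P Q] cls_eq_iff[OF P Q] by simp
  have le: "v (a * b) < d" if "v a < d" "v b \<le> 1" for a b
    using mult_left_le[OF that(2) v_nonneg[of a]] that(1) by (simp add: v_mult)
  have u: "v (1 - e * x * (- x') * y * y') = 1" by (rule denominator_unit[OF P point_neg_curve[OF Q]])
  have "fst (point_add (x, y) (inv\<^bsub>E\<^esub> (x', y'))) = ((x - x') * y' - (y - y') * x') / (1 - e * x * (- x') * y * y')"
    unfolding inv_E[OF Q] point_add_def by (simp add: algebra_simps)
  hence "v (fst (point_add (x, y) (inv\<^bsub>E\<^esub> (x', y')))) = v ((x - x') * y' - (y - y') * x')"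
    by (simp only: v_divide u div_by_1)
  also have "\<dots> < d"
    by (rule v_diff_less[OF le[OF d(2) curveD(3)[OF Q]] le[OF d(3) curveD(2)[OF Q]]])
  finally show "v (fst (point_add (x, y) (inv\<^bsub>E\<^esub> (x', y')))) < d" .
qed

text \<open>The points with \<open>e s\<^sup>2\<close> and \<open>t\<close> rational are the rational points of a twist of the curve.\<close>

lemma rational_multiples:
  assumes P: "(s, of_rat t) \<in> curve" and c: "e * s\<^sup>2 = of_rat c"
  shows "\<exists>\<xi> \<eta>. (s, of_rat t) [^]\<^bsub>E\<^esub> (n::nat) = (s * of_rat \<xi>, of_rat \<eta>)"
proof (induction n)
  case 0
  show ?case by (intro exI[of _ 0] exI[of _ 1]) simp
next
  case (Suc n)
  then obtain \<xi> \<eta> where IH: "(s, of_rat t) [^]\<^bsub>E\<^esub> n = (s * of_rat \<xi>, of_rat \<eta>)" by blast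
  have k: "e * (s * of_rat \<xi>) * s * of_rat \<eta> * of_rat t = (of_rat (c * \<xi> * \<eta> * t) :: 'k)"
    "e * (s * of_rat \<xi>) * s = (of_rat (c * \<xi>) :: 'k)"
    using c by (simp_all add: of_rat_mult power2_eq_square mult_ac)
  have "(s, of_rat t) [^]\<^bsub>E\<^esub> Suc n = point_add (s * of_rat \<xi>, of_rat \<eta>) (s, of_rat t)"
    by (simp add: E.nat_pow_Suc IH)
  also have "\<dots> = (s * of_rat ((\<xi> * t + \<eta>) / (1 - c * \<xi> * \<eta> * t)), of_rat ((\<eta> * t - c * \<xi>) / (1 + c * \<xi> * \<eta> * t)))"
    unfolding point_add_def prod.case k
    by (simp add: of_rat_divide of_rat_add of_rat_diff of_rat_mult algebra_simps)
  finally show ?case by blast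
qed

lemma fst_zero_pow: "fst P = 0 \<Longrightarrow> fst (P [^]\<^bsub>E\<^esub> (n::nat)) = 0"
proof (induction n)
  case (Suc n)
  then show ?case
    by (cases P; cases "P [^]\<^bsub>E\<^esub> n") (simp add: E.nat_pow_Suc point_add_def)
qed simp

text \<open>A rational \<open>t'\<close> near \<open>t\<close> determines
  \<open>c = (1 - t'^2) / (1 + t'^2)\<close>, and \<open>s\<close> is corrected by the square root
  of \<open>c / C\<close>. The error is uniform over all multiples, because the difference of the
  two generators lies in \<open>F\<close>, where taking multiples does not enlarge \<open>x\<close>.
  Thus one twist serves both points.\<close>

lemma rational_approximation:
  assumes P1: "(x1, y1) \<in> curve" and P2: "(x2, y2) \<in> curve" and x1: "x1 \<noteq> 0" and r: "0 < r"
  shows "\<exists>s c \<xi>1 \<eta>1 \<xi>2 \<eta>2. e * s\<^sup>2 = of_rat c \<and>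
    (s * of_rat \<xi>1, of_rat \<eta>1) \<in> curve \<and> v (x1 - s * of_rat \<xi>1) < r \<and> v (y1 - of_rat \<eta>1) < r \<and>
    (s * of_rat \<xi>2, of_rat \<eta>2) \<in> curve \<and> v (x2 - s * of_rat \<xi>2) < r \<and> v (y2 - of_rat \<eta>2) < r"
proof -
  obtain G where G: "G \<in> curve" and gen: "\<And>P r. P \<in> curve \<Longrightarrow> r > 0 \<Longrightarrow>
     \<exists>n::nat. point_add P (inv\<^bsub>E\<^esub> (G [^]\<^bsub>E\<^esub> n)) \<in> F \<and> v (fst (point_add P (inv\<^bsub>E\<^esub> (G [^]\<^bsub>E\<^esub> n)))) < r"
    using ex_topological_generator by blast
  \<comment> \<open>The bound \<open>v x1\<close> excludes \<open>s = 0\<close>: all multiples of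
    \<open>G\<close> would then have first coordinate 0 and could not come this close to
    \<open>x1\<close>.\<close>
  define d where "d = min r (min 1 (v x1))"
  have d: "0 < d" "d \<le> r" "d \<le> 1" "d \<le> v x1" using r v_pos[OF x1] by (auto simp: d_def)
  have near: "\<exists>n::nat. v (fst P - fst (G [^]\<^bsub>E\<^esub> n)) < d \<and> v (snd P - snd (G [^]\<^bsub>E\<^esub> n)) < d" if P: "P \<in> curve" for P
  proof -
    obtain n :: nat where n: "point_add P (inv\<^bsub>E\<^esub> (G [^]\<^bsub>E\<^esub> n)) \<in> F"
      "v (fst (point_add P (inv\<^bsub>E\<^esub> (G [^]\<^bsub>E\<^esub> n)))) < d" using gen[OF P d(1)] by blast
    from coordinates_close[OF P pow_curve[OF G] n(1)] n(2) show ?thesis by (intro exI[of _ n]) auto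
  qed
  obtain s t where st: "G = (s, t)" by (cases G)
  have Gc: "(s, t) \<in> curve" using G st by simp
  note cG = curveD[OF Gc]
  have s0: "s \<noteq> 0"
  proof
    assume "s = 0"
    obtain n :: nat where "v (x1 - fst (G [^]\<^bsub>E\<^esub> n)) < d" using near[OF P1] by auto
    hence "v x1 < d" using fst_zero_pow[of G n] \<open>s = 0\<close> st by simp
    with d(4) show False by simp
  qed
  define C where "C = e * s\<^sup>2"
  have C0: "C \<noteq> 0" using s0 v_e(2) by (simp add: C_def)
  have C1: "C * (1 + t\<^sup>2) = 1 - t\<^sup>2" using cG(1) by (simp add: C_def algebra_simps)
  \<comment> \<open>The factor \<open>v C\<close> provides relative precision: \<open>c / C\<close>
    will lie within \<open>d\<close> of 1, and so will its square root \<open>b\<close>.\<close>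
  have "0 < min d (d * v C)" using d(1) v_pos[OF C0] by simp
  then obtain t' where t': "v (t - of_rat t') < min d (d * v C)" by (rule rat_dense)
  have tt: "v (t - of_rat t') < d" using t' by simp
  define c where "c = (1 - t'\<^sup>2) / (1 + t'\<^sup>2)"
  have "v (of_rat t') \<le> 1"
    using v_diff_le[OF cG(3), of "t - of_rat t'"] tt d(3) by simp
  hence u': "v (1 + (of_rat t')\<^sup>2) = 1" by (rule v_one_plus_square)
  hence u0: "1 + (of_rat t')\<^sup>2 \<noteq> (0 :: 'k)" by auto
  have c': "(of_rat c :: 'k) = (1 - (of_rat t')\<^sup>2) / (1 + (of_rat t')\<^sup>2)"
    by (simp add: c_def of_rat_divide of_rat_diff of_rat_add of_rat_power)
  have "v (of_rat c - C) \<le> v (t - of_rat t')"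
  proof -
    have "(of_rat c - C) * ((1 + (of_rat t')\<^sup>2) * (1 + t\<^sup>2)) =
       (1 - (of_rat t')\<^sup>2) * (1 + t\<^sup>2) - (C * (1 + t\<^sup>2)) * (1 + (of_rat t')\<^sup>2)"
      unfolding c' using u0 by (simp add: field_simps)
    also have "\<dots> = (t - of_rat t') * (2 * (t + of_rat t'))"
      unfolding C1 by (simp add: power2_eq_square algebra_simps)
    finally have "v (of_rat c - C) = v (t - of_rat t') * v (2 * (t + of_rat t'))"
      using u' cG(5) by (metis mult.right_neutral v_mult)
    also have "\<dots> \<le> v (t - of_rat t')"
      using \<open>v (of_rat t') \<le> 1\<close> cG(3) v_two by (intro mult_left_le v_nonneg v_mult_le_1 v_add_le) auto
    finally show ?thesis .
  qed
  hence cC: "v (of_rat c - C) < d * v C" using t' by simp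
  have "of_rat c / C - 1\<^sup>2 = (of_rat c - C) / C" using C0 by (simp add: field_simps)
  hence "v (of_rat c / C - 1\<^sup>2) < d" using cC v_pos[OF C0] by (simp add: v_divide pos_divide_less_eq)
  moreover from this have "v (of_rat c / C - 1\<^sup>2) < 1" using d(3) by linarith
  ultimately obtain b where b: "b\<^sup>2 = of_rat c / C" "v (b - 1) < d"
    using square_root_of_unit[OF p_ne_2 v_one, of "of_rat c / C"] by (metis le_less_trans)
  define s' where "s' = s * b"
  have es': "e * s'\<^sup>2 = of_rat c"
  proof -
    have "e * s'\<^sup>2 = C * b\<^sup>2" by (simp add: s'_def C_def power_mult_distrib)
    thus ?thesis using C0 by (simp add: b)
  qed
  have G'c: "(s', of_rat t') \<in> curve"
  proof -
    have "of_rat c + (of_rat t')\<^sup>2 + of_rat c * (of_rat t')\<^sup>2 = (1 :: 'k)" 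
    proof -
      have "of_rat c * (1 + (of_rat t')\<^sup>2) = (1 - (of_rat t')\<^sup>2 :: 'k)" unfolding c' using u0 by simp
      thus ?thesis by (simp add: algebra_simps)
    qed
    thus ?thesis by (simp add: curve_def es')
  qed
  have "s' - s = (b - 1) * s" by (simp add: s'_def algebra_simps)
  hence ss: "v (s' - s) < d"
    using mult_left_le[OF cG(2) v_nonneg[of "b - 1"]] b(2) by (simp add: v_mult)
  have tt': "v (of_rat t' - t) < d" using tt by (simp add: v_diff_commute)
  note R = difference_small[OF G'c Gc d(3) ss tt']
  have close: "v (fst (G [^]\<^bsub>E\<^esub> n) - fst ((s', of_rat t') [^]\<^bsub>E\<^esub> n)) < d \<and>
      v (snd (G [^]\<^bsub>E\<^esub> n) - snd ((s', of_rat t') [^]\<^bsub>E\<^esub> n)) < d" for n :: nat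
  proof -
    note sp = sub_pow[OF G'c Gc, of n]
    have F: "point_add ((s', of_rat t') [^]\<^bsub>E\<^esub> n) (inv\<^bsub>E\<^esub> ((s, t) [^]\<^bsub>E\<^esub> n)) \<in> F"
      unfolding sp by (rule F_pow[OF R(1)])
    have "v (fst (point_add ((s', of_rat t') [^]\<^bsub>E\<^esub> n) (inv\<^bsub>E\<^esub> ((s, t) [^]\<^bsub>E\<^esub> n)))) < d"
      unfolding sp using fst_pow_F(2)[OF R(1), of n] R(2) by linarith
    thus ?thesis
      using coordinates_close[OF pow_curve[OF G'c] pow_curve[OF Gc] F]
      by (simp add: st v_diff_commute)
  qed
  have final: "\<exists>\<xi> \<eta>. (s' * of_rat \<xi>, of_rat \<eta>) \<in> curve \<and> v (x - s' * of_rat \<xi>) < r \<and> v (y - of_rat \<eta>) < r"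
    if P: "(x, y) \<in> curve" for x y
  proof -
    obtain n :: nat where n: "v (x - fst (G [^]\<^bsub>E\<^esub> n)) < d" "v (y - snd (G [^]\<^bsub>E\<^esub> n)) < d" using near[OF P] by auto
    obtain \<xi> \<eta> where \<xi>\<eta>: "(s', of_rat t') [^]\<^bsub>E\<^esub> n = (s' * of_rat \<xi>, of_rat \<eta>)"
      using rational_multiples[OF G'c es'] by blast
    have "v ((x - fst (G [^]\<^bsub>E\<^esub> n)) + (fst (G [^]\<^bsub>E\<^esub> n) - s' * of_rat \<xi>)) < d"
      using n(1) close[of n] \<xi>\<eta> by (intro v_add_less) auto
    moreover have "v ((y - snd (G [^]\<^bsub>E\<^esub> n)) + (snd (G [^]\<^bsub>E\<^esub> n) - of_rat \<eta>)) < d"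
      using n(2) close[of n] \<xi>\<eta> by (intro v_add_less) auto
    moreover have "(s' * of_rat \<xi>, of_rat \<eta>) \<in> curve" using pow_curve[OF G'c, of n] \<xi>\<eta> by simp
    ultimately show ?thesis using d(2) by (intro exI[of _ \<xi>] exI[of _ \<eta>]) auto
  qed
  from final[OF P1] final[OF P2] es' show ?thesis by blast
qed

end

section \<open>Approximation in the chart\<close>

context padic_3mod4
begin

text \<open>As \<open>C1 C2\<close> is the square of \<open>Om\<close>, one \<open>e\<close> and one
  sign serve both factors, and \<open>x2\<close> is forced to be \<open>Om / (e s)\<close>. The sign
  does no harm: the circles and the relation for \<open>Om\<close> are invariant under negating both
  \<open>C1\<close> and \<open>C2\<close>.\<close>

lemma chart_approximation:
  fixes x :: "chart \<Rightarrow> 'k"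
  assumes circ: "chart_circle x" and Om: "(x Om)\<^sup>2 = x C1 * x C2" and Om0: "x Om \<noteq> 0" and r: "0 < r"
  shows "\<exists>x' :: chart \<Rightarrow> rat. chart_circle x' \<and> (x' Om)\<^sup>2 = x' C1 * x' C2 \<and> (\<forall>i. v (x i - of_rat (x' i)) < r)"
proof -
  have C0: "x C1 \<noteq> 0" "x C2 \<noteq> 0" using Om Om0 by auto
  obtain e s where es: "e = 1 \<or> e = of_nat p" "s \<noteq> 0" "x C1 = e * s\<^sup>2 \<or> x C1 = - (e * s\<^sup>2)"
    using square_class[OF C0(1)] by metis
  interpret padic_edwards p v e by unfold_locales (rule es(1))
  define \<sigma> :: rat where "\<sigma> = (if x C1 = e * s\<^sup>2 then 1 else - 1)"
  have \<sigma>: "\<sigma> * \<sigma> = 1" by (simp add: \<sigma>_def)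
  hence \<sigma>k: "of_rat \<sigma> * of_rat \<sigma> = (1 :: 'k)" by (metis of_rat_1 of_rat_mult)
  have v\<sigma>: "v (of_rat \<sigma>) = 1" by (simp add: \<sigma>_def v_minus of_rat_minus)
  define x1 x2 where "x1 = s" and "x2 = x Om / (e * s)"
  have es0: "e * s \<noteq> 0" using es(2) v_e(2) by simp
  have Om': "x Om = e * x1 * x2" using es0 by (simp add: x1_def x2_def)
  have c1: "x C1 = of_rat \<sigma> * (e * x1\<^sup>2)" using es(3) by (auto simp: \<sigma>_def x1_def of_rat_minus)
  have "x C1 * (of_rat \<sigma> * (e * x2\<^sup>2)) = (of_rat \<sigma> * of_rat \<sigma>) * (e * x1 * x2)\<^sup>2"
    unfolding c1 by (simp add: power2_eq_square mult_ac)
  also have "\<dots> = x C1 * x C2" unfolding \<sigma>k Om'[symmetric] Om by simp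
  finally have c2: "x C2 = of_rat \<sigma> * (e * x2\<^sup>2)" using C0(1) by simp
  define y1 y2 where "y1 = x S1 / (1 + e * x1\<^sup>2)" and "y2 = x S2 / (1 + e * x2\<^sup>2)"
  have nz: "1 + e * z\<^sup>2 \<noteq> 0" for z using v_one_plus_e_ge(1)[of z] by auto
  have S: "x S1 = y1 * (1 + e * x1\<^sup>2)" "x S2 = y2 * (1 + e * x2\<^sup>2)" using nz by (simp_all add: y1_def y2_def)
  have on_curve: "(z, y) \<in> curve" if "(of_rat \<sigma> * (e * z\<^sup>2))\<^sup>2 + (y * (1 + e * z\<^sup>2))\<^sup>2 = 1" for z y
  proof -
    have "(of_rat \<sigma> * (e * z\<^sup>2))\<^sup>2 = (of_rat \<sigma> * of_rat \<sigma>) * (e * z\<^sup>2)\<^sup>2"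
      by (simp add: power2_eq_square mult_ac)
    hence "(e * z\<^sup>2)\<^sup>2 + (y * (1 + e * z\<^sup>2))\<^sup>2 = 1" using that unfolding \<sigma>k by simp
    hence "(1 + e * z\<^sup>2) * (e * z\<^sup>2 + y\<^sup>2 + e * z\<^sup>2 * y\<^sup>2) = (1 + e * z\<^sup>2) * 1"
      by (simp add: power2_eq_square algebra_simps)
    hence "e * z\<^sup>2 + y\<^sup>2 + e * z\<^sup>2 * y\<^sup>2 = 1" by (simp only: mult_left_cancel[OF nz])
    thus ?thesis by (simp add: curve_def)
  qed
  have P1: "(x1, y1) \<in> curve" and P2: "(x2, y2) \<in> curve"
    using circ unfolding chart_circle_def c1 c2 S by (auto intro: on_curve)
  have x10: "x1 \<noteq> 0" using es(2) by (simp add: x1_def)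
  obtain s' c \<xi>1 \<eta>1 \<xi>2 \<eta>2 where c: "e * s'\<^sup>2 = of_rat c"
    and Q1: "(s' * of_rat \<xi>1, of_rat \<eta>1) \<in> curve" "v (x1 - s' * of_rat \<xi>1) < r" "v (y1 - of_rat \<eta>1) < r"
    and Q2: "(s' * of_rat \<xi>2, of_rat \<eta>2) \<in> curve" "v (x2 - s' * of_rat \<xi>2) < r" "v (y2 - of_rat \<eta>2) < r"
    using rational_approximation[OF P1 P2 x10 r] by blast
  have k: "of_rat (c * \<xi> * \<xi>') = e * (s' * of_rat \<xi>) * (s' * of_rat \<xi>')" for \<xi> \<xi>'
    by (simp add: of_rat_mult power2_eq_square mult_ac flip: c)
  have k2: "of_rat (c * \<xi> * \<xi>) = e * (s' * of_rat \<xi>)\<^sup>2" for \<xi>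
    by (simp add: k power2_eq_square)
  define x' where "x' i = (case i of C1 \<Rightarrow> \<sigma> * (c * \<xi>1 * \<xi>1) | S1 \<Rightarrow> \<eta>1 * (1 + c * \<xi>1 * \<xi>1)
     | C2 \<Rightarrow> \<sigma> * (c * \<xi>2 * \<xi>2) | S2 \<Rightarrow> \<eta>2 * (1 + c * \<xi>2 * \<xi>2) | Om \<Rightarrow> c * \<xi>1 * \<xi>2)" for i
  have rat_circle: "(\<sigma> * (c * \<xi> * \<xi>))\<^sup>2 + (\<eta> * (1 + c * \<xi> * \<xi>))\<^sup>2 = 1"
    if Q: "(s' * of_rat \<xi>, of_rat \<eta>) \<in> curve" for \<xi> \<eta>
  proof -
    have "of_rat ((\<sigma> * (c * \<xi> * \<xi>))\<^sup>2 + (\<eta> * (1 + c * \<xi> * \<xi>))\<^sup>2) =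
        (of_rat \<sigma> * of_rat \<sigma>) * (e * (s' * of_rat \<xi>)\<^sup>2)\<^sup>2 + (lemniscate_S (s' * of_rat \<xi>, of_rat \<eta>))\<^sup>2"
      by (simp add: of_rat_add of_rat_power of_rat_mult[of \<sigma>] of_rat_mult[of \<eta>] k2 lemniscate_S_def
          power_mult_distrib[of "of_rat \<sigma>"] power2_eq_square[of "of_rat \<sigma>"])
    also have "\<dots> = of_rat 1" unfolding lemniscate_S_square[OF Q] \<sigma>k by simp
    finally show ?thesis by (simp only: of_rat_eq_iff)
  qed
  have le: "v (a * b) < r" if "v a < r" "v b \<le> 1" for a b
    using mult_left_le[OF that(2) v_nonneg[of a]] that(1) by (simp add: v_mult)
  have prod: "v (e * a * b - e * a' * b') < r"
    if "v (a - a') < r" "v (b - b') < r" "v a \<le> 1" "v b' \<le> 1" for a a' b b'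
  proof -
    have "e * a * b - e * a' * b' = (b - b') * (e * a) + (a - a') * (e * b')" by (simp add: algebra_simps)
    thus ?thesis using that v_e(1) by (auto intro!: v_add_less le v_mult_le_1)
  qed
  have sq: "v (e * a\<^sup>2 - e * a'\<^sup>2) < r" if "v (a - a') < r" "v a \<le> 1" "v a' \<le> 1" for a a'
    using prod[OF that(1,1,2,3)] by (simp add: power2_eq_square mult.assoc)
  have Cclose: "v (of_rat \<sigma> * (e * z\<^sup>2) - of_rat (\<sigma> * (c * \<xi> * \<xi>))) < r"
    and Sclose: "v (y * (1 + e * z\<^sup>2) - of_rat (\<eta> * (1 + c * \<xi> * \<xi>))) < r"
    if P: "(z, y) \<in> curve" and Q: "(s' * of_rat \<xi>, of_rat \<eta>) \<in> curve"
      and d: "v (z - s' * of_rat \<xi>) < r" "v (y - of_rat \<eta>) < r" for z y \<xi> \<eta>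
  proof -
    note s = sq[OF d(1) curveD(2)[OF P] curveD(2)[OF Q]]
    have "of_rat \<sigma> * (e * z\<^sup>2) - of_rat (\<sigma> * (c * \<xi> * \<xi>)) = of_rat \<sigma> * (e * z\<^sup>2 - e * (s' * of_rat \<xi>)\<^sup>2)"
      by (simp only: of_rat_mult[of \<sigma>] k2 right_diff_distrib)
    thus "v (of_rat \<sigma> * (e * z\<^sup>2) - of_rat (\<sigma> * (c * \<xi> * \<xi>))) < r" using s v\<sigma> by (simp only: v_mult mult_1)
    have "y * (1 + e * z\<^sup>2) - of_rat (\<eta> * (1 + c * \<xi> * \<xi>))
      = (y - of_rat \<eta>) * (1 + e * z\<^sup>2) + (e * z\<^sup>2 - e * (s' * of_rat \<xi>)\<^sup>2) * of_rat \<eta>"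
      by (simp only: of_rat_mult[of \<eta>] of_rat_add of_rat_1 k2) (simp add: algebra_simps)
    moreover have "v ((y - of_rat \<eta>) * (1 + e * z\<^sup>2)) < r" using le[OF d(2)] curveD(4)[OF P] by simp
    moreover have "v ((e * z\<^sup>2 - e * (s' * of_rat \<xi>)\<^sup>2) * of_rat \<eta>) < r" by (rule le[OF s curveD(3)[OF Q]])
    ultimately show "v (y * (1 + e * z\<^sup>2) - of_rat (\<eta> * (1 + c * \<xi> * \<xi>))) < r"
      using v_add_less by simp
  qed
  have "chart_circle x'"
    using rat_circle[OF Q1(1)] rat_circle[OF Q2(1)] by (simp add: chart_circle_def x'_def)
  moreover have "(x' Om)\<^sup>2 = x' C1 * x' C2"
  proof -
    have "x' C1 * x' C2 = (\<sigma> * \<sigma>) * (c * \<xi>1 * \<xi>2)\<^sup>2" by (simp add: x'_def power2_eq_square mult_ac)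
    thus ?thesis unfolding \<sigma> by (simp add: x'_def)
  qed
  moreover have "v (x i - of_rat (x' i)) < r" for i
  proof (cases i)
    case C1
    then show ?thesis using Cclose[OF P1 Q1(1) Q1(2,3)] by (simp add: c1 x'_def)
  next
    case S1
    then show ?thesis using Sclose[OF P1 Q1(1) Q1(2,3)] by (simp add: S x'_def)
  next
    case C2
    then show ?thesis using Cclose[OF P2 Q2(1) Q2(2,3)] by (simp add: c2 x'_def)
  next
    case S2
    then show ?thesis using Sclose[OF P2 Q2(1) Q2(2,3)] by (simp add: S x'_def)
  next
    case Om
    have "v (e * x1 * x2 - e * (s' * of_rat \<xi>1) * (s' * of_rat \<xi>2)) < r"
      by (rule prod[OF Q1(2) Q2(2) curveD(2)[OF P1] curveD(2)[OF Q2(1)]])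
    then show ?thesis using Om by (simp add: Om' x'_def k)
  qed
  ultimately show ?thesis by blast
qed

lemma ex_small:
  assumes "0 < r" "0 \<le> M"
  obtains q where "q \<noteq> 0" "v q < 1" "v q * M < r"
proof -
  have "1 / real p < 1" using p_gt_1 by simp
  moreover have "0 < r / (M + 1)" using assms by simp
  ultimately obtain k where k: "(1 / real p) ^ k < r / (M + 1)" using real_arch_pow_inv by blast
  let ?q = "of_nat p ^ Suc k :: 'k"
  have q: "v ?q = (1 / real p) * (1 / real p) ^ k" by (simp add: v_mult v_power v_p power_divide)
  have pos: "0 < (1 / real p) ^ k" using p_gt_1 by simp
  have le1: "(1 / real p) ^ k \<le> 1" using p_gt_1 by (intro power_le_one) auto
  have "v ?q < 1" unfolding q using le1 pos p_gt_1 by (smt (verit) divide_less_eq_1_pos mult_left_le zero_le_divide_1_iff)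
  moreover have "v ?q * M < r"
  proof -
    have "v ?q \<le> (1 / real p) ^ k" unfolding q using pos p_gt_1 by (intro mult_left_le_one_le) auto
    hence "v ?q * M \<le> (1 / real p) ^ k * (M + 1)" using assms pos by (intro mult_mono) auto
    also have "\<dots> < r" using k assms by (simp add: pos_less_divide_eq)
    finally show ?thesis .
  qed
  moreover have "?q \<noteq> 0" using prime_gt_0_nat[OF prime_p] by simp
  ultimately show ?thesis using that by blast
qed

text \<open>At a point with first coordinate 0 that coordinate is a local parameter of the circle;
  the other one is the root of \<open>1 - d^2\<close> near \<open>S\<close>.\<close>

lemma circle_near:
  assumes S: "S\<^sup>2 = 1" and d: "v d < 1"
  obtains S' where "d\<^sup>2 + S'\<^sup>2 = 1" "v (S' - S) \<le> v d"
proof -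
  have "(v S)\<^sup>2 = 1" using S by (metis v_power v_one)
  hence vS: "v S = 1" using v_nonneg[of S] by (simp add: power2_eq_1_iff)
  have d2: "v ((1 - d\<^sup>2) - S\<^sup>2) = (v d)\<^sup>2" using S by (simp add: v_minus v_power)
  have le: "(v d)\<^sup>2 \<le> v d" using d v_nonneg[of d] by (simp add: power2_eq_square mult_left_le)
  hence "v ((1 - d\<^sup>2) - S\<^sup>2) < 1" using d2 d by linarith
  from square_root_of_unit[OF p_ne_2 vS this] obtain b where "b\<^sup>2 = 1 - d\<^sup>2" "v (b - S) \<le> v ((1 - d\<^sup>2) - S\<^sup>2)" by metis
  with that[of b] d2 le show ?thesis by simp
qed

text \<open>A point with \<open>\<Omega> = 0\<close> is a limit of points with \<open>\<Omega> \<noteq> 0\<close>.  With \<open>m = g / a\<close> and \<open>\<sigma> = C\<^sub>1 / a\<close>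
  one has \<open>(C\<^sub>1, C\<^sub>2, \<Omega>) = \<sigma> a (1, m\<^sup>2, m)\<close> and \<open>(a, b, g) = a (1, m\<^sup>2, m)\<close>, and it suffices to
  replace whichever of \<open>m\<close> and \<open>\<sigma>\<close> vanishes by a small number.\<close>

lemma perturbation:
  fixes C S C' S' :: 'k
  assumes circ: "C\<^sup>2 + S\<^sup>2 = 1" "C'\<^sup>2 + S'\<^sup>2 = 1" and a0: "a \<noteq> 0" and ab: "a * b = g\<^sup>2"
    and aC: "a * C' = b * C" and Om: "g * C = 0" and r: "0 < r"
  obtains c s c' s' w t where "c\<^sup>2 + s\<^sup>2 = 1" "c'\<^sup>2 + s'\<^sup>2 = 1" "w\<^sup>2 = c * c'" "w \<noteq> 0" "t \<noteq> 0"
    "v (C - c) < r" "v (S - s) < r" "v (C' - c') < r" "v (S' - s') < r" "v w < r"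
    "v (a - t * c) < r" "v (b - t * c') < r" "v (g - t * w) < r"
proof -
  define m \<sigma> where "m = g / a" and "\<sigma> = C / a"
  have g: "g = a * m" and C: "C = a * \<sigma>" using a0 by (simp_all add: m_def \<sigma>_def)
  have b: "b = a * m\<^sup>2" using ab a0 unfolding g by (simp add: power2_eq_square)
  have m\<sigma>: "m = 0 \<or> \<sigma> = 0" using Om a0 unfolding g C by simp
  have "a * C' = 0" unfolding aC b C using m\<sigma> by auto
  hence C'0: "C' = 0" using a0 by simp
  hence S': "S'\<^sup>2 = 1" using circ(2) by simp
  \<comment> \<open>Every error below is \<open>q\<close> times a product of at most one
    \<open>a\<close>, one \<open>\<sigma>\<close> and two \<open>m\<close>, possibly perturbed;
    \<open>A\<close> bounds all of these at once.\<close>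
  define A where "A = max 1 (v a) * (max 1 (v \<sigma>) * (max 1 (v m) * max 1 (v m)))"
  have A1: "v x * (v y * (v z * v u)) \<le> A" if "v x \<le> max 1 (v a)" "v y \<le> max 1 (v \<sigma>)" "v z \<le> max 1 (v m)" "v u \<le> max 1 (v m)" for x y z u
    unfolding A_def using that v_nonneg by (intro mult_mono) (auto intro!: mult_nonneg_nonneg simp: max_def)
  have A0: "0 \<le> A" unfolding A_def by (simp add: max_def)
  obtain q where q: "q \<noteq> 0" "v q < 1" "v q * A < min r 1" using ex_small[of "min r 1" A] r A0 by auto
  define m' \<sigma>' where "m' = (if m = 0 then q else m)" and "\<sigma>' = (if \<sigma> = 0 then q else \<sigma>)"
  have nz: "m' \<noteq> 0" "\<sigma>' \<noteq> 0" using q(1) by (simp_all add: m'_def \<sigma>'_def)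
  have bd: "v m' \<le> max 1 (v m)" "v \<sigma>' \<le> max 1 (v \<sigma>)" "v a \<le> max 1 (v a)"
    using q(2) by (auto simp: m'_def \<sigma>'_def)
  have one: "v 1 \<le> max 1 (v \<sigma>)" "v 1 \<le> max 1 (v m)" by simp_all
  have small: "v (q * (x * (y * (z * u)))) < min r 1"
    if "v x \<le> max 1 (v a)" "v y \<le> max 1 (v \<sigma>)" "v z \<le> max 1 (v m)" "v u \<le> max 1 (v m)" for x y z u
  proof -
    have "v q * (v x * (v y * (v z * v u))) \<le> v q * A" by (rule mult_left_mono[OF A1[OF that] v_nonneg])
    thus ?thesis using q(3) by (simp add: v_mult)
  qed
  define c c' w t where "c = a * \<sigma>'" and "c' = \<sigma>' * a * m'\<^sup>2" and "w = \<sigma>' * a * m'" and "t = 1 / \<sigma>'"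
  have c'_small: "v c' < min r 1"
  proof (cases "\<sigma> = 0")
    case True
    hence "c' = q * (a * (1 * (m' * m')))" by (simp add: c'_def \<sigma>'_def power2_eq_square)
    thus ?thesis using small[OF bd(3) one(1) bd(1) bd(1)] by simp
  next
    case False
    hence "m' = q" using m\<sigma> by (simp add: m'_def)
    hence "c' = q * (a * (\<sigma>' * (m' * 1)))" by (simp add: c'_def power2_eq_square mult_ac)
    thus ?thesis using small[OF bd(3) bd(2) bd(1) one(2)] by simp
  qed
  have w_small: "v w < min r 1"
  proof (cases "\<sigma> = 0")
    case True
    hence "w = q * (a * (1 * (m' * 1)))" by (simp add: w_def \<sigma>'_def)
    thus ?thesis using small[OF bd(3) one(1) bd(1) one(2)] by simp
  next
    case False
    hence "m' = q" using m\<sigma> by (simp add: m'_def)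
    hence "w = q * (a * (\<sigma>' * (1 * 1)))" by (simp add: w_def mult_ac)
    thus ?thesis using small[OF bd(3) bd(2) one(2) one(2)] by simp
  qed
  have c_close: "v (C - c) < min r 1 \<and> (C \<noteq> 0 \<longrightarrow> c = C)"
  proof (cases "\<sigma> = 0")
    case True
    hence "C - c = - (q * (a * (1 * (1 * 1))))" by (simp add: C c_def \<sigma>'_def)
    thus ?thesis using small[OF bd(3) one(1) one(2) one(2)] True by (simp add: v_minus C)
  next
    case False
    thus ?thesis using r by (simp add: C c_def \<sigma>'_def)
  qed
  have "\<exists>s. c\<^sup>2 + s\<^sup>2 = 1 \<and> v (S - s) < r"
  proof (cases "C = 0")
    case True
    hence "v c < 1" "v c < r" using c_close by (auto simp: v_minus)
    moreover have "S\<^sup>2 = 1" using circ(1) True by simp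
    ultimately obtain s where "c\<^sup>2 + s\<^sup>2 = 1" "v (s - S) \<le> v c" using circle_near by metis
    thus ?thesis using \<open>v c < r\<close> by (intro exI[of _ s]) (simp add: v_diff_commute)
  next
    case False
    then show ?thesis using c_close circ(1) r by (intro exI[of _ S]) simp
  qed
  then obtain s where s: "c\<^sup>2 + s\<^sup>2 = 1" "v (S - s) < r" by blast
  have "v c' < 1" using c'_small by simp
  then obtain s' where s': "c'\<^sup>2 + s'\<^sup>2 = 1" "v (s' - S') \<le> v c'" using circle_near[OF S'] by metis
  show ?thesis
  proof (rule that[OF s(1) s'(1)])
    show "w\<^sup>2 = c * c'" by (simp add: w_def c_def c'_def power2_eq_square mult_ac)
    show "w \<noteq> 0" "t \<noteq> 0" using nz a0 by (simp_all add: w_def t_def)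
    show "v (C - c) < r" "v (S - s) < r" using c_close s(2) by auto
    show "v (C' - c') < r" using c'_small C'0 by (simp add: v_minus)
    show "v (S' - s') < r" using c'_small s'(2) by (simp add: v_diff_commute)
    show "v w < r" using w_small by simp
    show "v (a - t * c) < r" using nz r by (simp add: t_def c_def)
    have tc: "t * c' = a * m'\<^sup>2" "t * w = a * m'" using nz by (simp_all add: t_def c'_def w_def)
    show "v (b - t * c') < r"
    proof (cases "m = 0")
      case True
      hence "b - t * c' = - (q * (a * (1 * (m' * 1))))" by (simp add: tc b m'_def power2_eq_square)
      thus ?thesis using small[OF bd(3) one(1) bd(1) one(2)] by (simp add: v_minus)
    qed (use r in \<open>simp add: tc b m'_def\<close>)
    show "v (g - t * w) < r"
    proof (cases "m = 0")
      case True
      hence "g - t * w = - (q * (a * (1 * (1 * 1))))" by (simp add: tc g m'_def)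
      thus ?thesis using small[OF bd(3) one(1) one(2) one(2)] by (simp add: v_minus)
    qed (use r in \<open>simp add: tc g m'_def\<close>)
  qed
qed

text \<open>If \<open>Om\<close> is nonzero, \<open>(a, b, g)\<close> is already a multiple of
  \<open>(C1, C2, Om)\<close>. Otherwise \<open>a * b = g^2\<close> forces \<open>a\<close> or
  \<open>b\<close> to be nonzero, and the second case is the first with the factors
  exchanged.\<close>

lemma kummer_chart_perturbation:
  assumes chart: "kummer_chart a b g x" and r: "0 < r"
  shows "\<exists>x' t. chart_circle x' \<and> (x' Om)\<^sup>2 = x' C1 * x' C2 \<and> x' Om \<noteq> 0 \<and> t \<noteq> 0 \<and>
    (\<forall>i. v (x i - x' i) < r) \<and> v (a - t * x' C1) < r \<and> v (b - t * x' C2) < r \<and> v (g - t * x' Om) < r"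
proof -
  have circ: "(x C1)\<^sup>2 + (x S1)\<^sup>2 = 1" "(x C2)\<^sup>2 + (x S2)\<^sup>2 = 1" and Om: "(x Om)\<^sup>2 = x C1 * x C2"
    and nz: "a \<noteq> 0 \<or> b \<noteq> 0 \<or> g \<noteq> 0" and ab: "a * b = g\<^sup>2" and aC: "a * x C2 = b * x C1"
    and aO: "a * x Om = g * x C1" and bO: "b * x Om = g * x C2"
    using chart by (auto simp: kummer_chart_def chart_circle_def)
  let ?x = "\<lambda>c s c' s' w i. case i of C1 \<Rightarrow> c | S1 \<Rightarrow> s | C2 \<Rightarrow> c' | S2 \<Rightarrow> s' | Om \<Rightarrow> (w :: 'k)"
  have all: "(\<forall>i. P i) \<longleftrightarrow> P C1 \<and> P S1 \<and> P C2 \<and> P S2 \<and> P Om" for P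
    by (metis chart.exhaust)
  show ?thesis
  proof (cases "x Om = 0")
    case False
    have C0: "x C1 \<noteq> 0" "x C2 \<noteq> 0" using Om False by auto
    define t where "t = a / x C1"
    have t: "t * x C1 = a" "t * x C2 = b" "t * x Om = g" using C0 aC aO by (simp_all add: t_def field_simps)
    hence "t \<noteq> 0" using nz by auto
    then show ?thesis
      using False t Om r chart by (intro exI[of _ x] exI[of _ t]) (simp add: kummer_chart_def)
  next
    case True
    have gC: "g * x C1 = 0" "g * x C2 = 0" using aO bO True by auto
    show ?thesis
    proof (cases "a = 0")
      case False
      obtain c s c' s' w t where "c\<^sup>2 + s\<^sup>2 = 1" "c'\<^sup>2 + s'\<^sup>2 = 1" "w\<^sup>2 = c * c'" "w \<noteq> 0" "t \<noteq> 0"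
        "v (x C1 - c) < r" "v (x S1 - s) < r" "v (x C2 - c') < r" "v (x S2 - s') < r" "v w < r"
        "v (a - t * c) < r" "v (b - t * c') < r" "v (g - t * w) < r"
        by (rule perturbation[OF circ False ab aC gC(1) r])
      then show ?thesis
        by (intro exI[of _ "?x c s c' s' w"] exI[of _ t]) (simp add: chart_circle_def all True v_minus)
    next
      case a: True
      hence b: "b \<noteq> 0" using nz ab by auto
      obtain c s c' s' w t where "c\<^sup>2 + s\<^sup>2 = 1" "c'\<^sup>2 + s'\<^sup>2 = 1" "w\<^sup>2 = c * c'" "w \<noteq> 0" "t \<noteq> 0"
        "v (x C2 - c) < r" "v (x S2 - s) < r" "v (x C1 - c') < r" "v (x S1 - s') < r" "v w < r"
        "v (b - t * c) < r" "v (a - t * c') < r" "v (g - t * w) < r"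
      proof (rule perturbation[OF circ(2,1) b _ _ gC(2) r])
        show "b * a = g\<^sup>2" using ab by (simp add: mult.commute)
        show "b * x C1 = a * x C2" using aC by simp
      qed
      then show ?thesis
        by (intro exI[of _ "?x c' s' c s w"] exI[of _ t]) (simp add: chart_circle_def all True v_minus mult.commute)
    qed
  qed
qed

end

section \<open>Density of the rational points\<close>

context padic_field
begin

lemma mult_close:
  assumes r: "0 < r"
  obtains d where "0 < d" "\<And>x' y'. v (x - x') < d \<Longrightarrow> v (y - y') < d \<Longrightarrow> v (x * y - x' * y') < r"
proof -
  define M where "M = 1 + v x + v y"
  have M: "v x \<le> M" "v y \<le> M" "1 \<le> M" "0 < M" using v_nonneg[of x] v_nonneg[of y] by (simp_all add: M_def)
  define d where "d = min 1 (r / M)"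
  have d: "0 < d" "d \<le> 1" "d * M \<le> r" using r M by (auto simp: d_def min_def field_simps)
  have "v (x * y - x' * y') < r" if x: "v (x - x') < d" and y: "v (y - y') < d" for x' y'
  proof -
    have "v (y - (y - y')) \<le> M" by (rule v_diff_le[OF M(2)]) (use y d M in linarith)
    hence y': "v y' \<le> M" by simp
    have 1: "v ((y - y') * x) < r"
    proof -
      have "v (y - y') * v x \<le> v (y - y') * M" by (rule mult_left_mono[OF M(1) v_nonneg])
      also have "\<dots> < d * M" by (rule mult_strict_right_mono[OF y M(4)])
      finally show ?thesis using d(3) by (simp add: v_mult)
    qed
    have 2: "v ((x - x') * y') < r"
    proof -
      have "v (x - x') * v y' \<le> v (x - x') * M" by (rule mult_left_mono[OF y' v_nonneg])
      also have "\<dots> < d * M" by (rule mult_strict_right_mono[OF x M(4)])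
      finally show ?thesis using d(3) by (simp add: v_mult)
    qed
    have "x * y - x' * y' = (y - y') * x + (x - x') * y'" by (simp add: algebra_simps)
    thus ?thesis using v_add_less[OF 1 2] by simp
  qed
  with d(1) show ?thesis by (rule that)
qed

lemma evalp_close:
  assumes "0 < r"
  shows "\<exists>d>0. \<forall>x'. (\<forall>i. v (x i - x' i) < d) \<longrightarrow> v (evalp Q x - evalp Q x') < r"
  using assms
proof (induction Q arbitrary: r rule: qpoly_induct)
  case (const c)
  then show ?case by (intro exI[of _ 1]) simp
next
  case (var i)
  then show ?case by (intro exI[of _ r]) simp
next
  case (add f g)
  obtain d where d: "0 < d" "\<And>x'. (\<forall>i. v (x i - x' i) < d) \<Longrightarrow> v (evalp f x - evalp f x') < r"
    using add.IH(1)[OF add.prems] by blast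
  obtain d' where d': "0 < d'" "\<And>x'. (\<forall>i. v (x i - x' i) < d') \<Longrightarrow> v (evalp g x - evalp g x') < r"
    using add.IH(2)[OF add.prems] by blast
  have "v (evalp (f + g) x - evalp (f + g) x') < r" if "\<forall>i. v (x i - x' i) < min d d'" for x'
  proof -
    have "v ((evalp f x - evalp f x') + (evalp g x - evalp g x')) < r"
      by (rule v_add_less[OF d(2) d'(2)]) (use that in simp_all)
    thus ?thesis by (simp add: algebra_simps)
  qed
  with d(1) d'(1) show ?case by (intro exI[of _ "min d d'"]) simp
next
  case (mult f g)
  obtain s where s: "0 < s" "\<And>a b. v (evalp f x - a) < s \<Longrightarrow> v (evalp g x - b) < s \<Longrightarrow> v (evalp f x * evalp g x - a * b) < r"
    using mult_close[OF mult.prems, of "evalp f x" "evalp g x"] by metis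
  obtain d where d: "0 < d" "\<And>x'. (\<forall>i. v (x i - x' i) < d) \<Longrightarrow> v (evalp f x - evalp f x') < s"
    using mult.IH(1)[OF s(1)] by blast
  obtain d' where d': "0 < d'" "\<And>x'. (\<forall>i. v (x i - x' i) < d') \<Longrightarrow> v (evalp g x - evalp g x') < s"
    using mult.IH(2)[OF s(1)] by blast
  have "v (evalp (f * g) x - evalp (f * g) x') < r" if "\<forall>i. v (x i - x' i) < min d d'" for x'
    unfolding evalp_mult by (rule s(2)[OF d(2) d'(2)]) (use that in simp_all)
  with d(1) d'(1) show ?case by (intro exI[of _ "min d d'"]) simp
qed

end

text \<open>The coordinates of \<open>kummer_vec\<close> as polynomials; the variables \<open>Inr S1\<close>, \<open>Inr C1\<close>, \<open>Inr C2\<close>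
  and \<open>Inr Om\<close> stand for \<open>\<kappa>\<close>, \<open>a\<close>, \<open>b\<close> and \<open>g\<close>.\<close>

definition kummer_vec_poly :: "kummer_index \<Rightarrow> (chart + chart) qpoly" where
  "kummer_vec_poly = case_sum
     (\<lambda>P. var_poly (Inr S1) * substitute (form_ratio P) (\<lambda>i. var_poly (Inl i)))
     (\<lambda>H. var_poly (Inr C1) * substitute (linear_coeff C1 H) (\<lambda>i. var_poly (Inl i))
        + var_poly (Inr C2) * substitute (linear_coeff C2 H) (\<lambda>i. var_poly (Inl i))
        + var_poly (Inr Om) * substitute (linear_coeff Om H) (\<lambda>i. var_poly (Inl i)))"

definition kummer_vec_args :: "'k \<Rightarrow> 'k \<Rightarrow> 'k \<Rightarrow> 'k \<Rightarrow> (chart \<Rightarrow> 'k::field_char_0) \<Rightarrow> chart + chart \<Rightarrow> 'k" where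
  "kummer_vec_args \<kappa> a b g x =
     case_sum x (\<lambda>i. case i of C1 \<Rightarrow> a | S1 \<Rightarrow> \<kappa> | C2 \<Rightarrow> b | S2 \<Rightarrow> 0 | Om \<Rightarrow> g)"

lemma kummer_vec_eq: "kummer_vec \<kappa> a b g x j = evalp (kummer_vec_poly j) (kummer_vec_args \<kappa> a b g x)"
  by (cases j) (simp_all add: kummer_vec_def kummer_vec_poly_def kummer_vec_args_def)

lemma kummer_vec_of_rat:
  "of_rat (kummer_vec \<kappa> a b g x j) =
     (kummer_vec (of_rat \<kappa>) (of_rat a) (of_rat b) (of_rat g) (\<lambda>i. of_rat (x i)) j :: 'k::field_char_0)"
proof -
  have "kummer_vec_args (of_rat \<kappa>) (of_rat a) (of_rat b) (of_rat g) (\<lambda>i. of_rat (x i)) =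
      (\<lambda>i. of_rat (kummer_vec_args \<kappa> a b g x i) :: 'k)"
    by (rule ext) (simp add: kummer_vec_args_def split: sum.split chart.split)
  thus ?thesis by (simp add: kummer_vec_eq evalp_of_rat)
qed

lemma kummer_cone_of_rat:
  fixes w :: "kummer_index \<Rightarrow> rat"
  assumes w: "w \<in> kummer_cone 1 0"
  shows "(\<lambda>j. of_rat (w j) :: 'k::field_char_0) \<in> kummer_cone 1 0"
proof -
  have cl: "w \<in> rat_closure kummer_graph" and nz: "w \<circ> Inl \<noteq> (\<lambda>_. 0)" "w \<circ> Inr \<noteq> (\<lambda>_. 0)"
    using w by (auto simp: kummer_cone_def blowup_cone_def)
  have "(\<lambda>j. of_rat (w j) :: 'k) \<in> rat_closure kummer_graph"
    using cl unfolding rat_closure_def by (auto simp: evalp_of_rat)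
  thus ?thesis using nz by (auto simp: kummer_cone_def blowup_cone_def fun_eq_iff)
qed

text \<open>Continuity is needed for finitely many coordinates only, since a basic open set of the
  product topology constrains no more.\<close>

lemma (in padic_field) kummer_vec_close:
  assumes r: "0 < r" and J: "finite J"
  shows "\<exists>d>0. \<forall>\<kappa>' a' b' g' x'. v (\<kappa> - \<kappa>') < d \<longrightarrow> v (a - a') < d \<longrightarrow> v (b - b') < d \<longrightarrow> v (g - g') < d \<longrightarrow>
     (\<forall>i. v (x i - x' i) < d) \<longrightarrow> (\<forall>j\<in>J. v (kummer_vec \<kappa> a b g x j - kummer_vec \<kappa>' a' b' g' x' j) < r)"
  using J
proof (induction J)
  case empty
  show ?case by (intro exI[of _ 1]) simp
next
  case (insert j J)
  let ?c = "\<lambda>d \<kappa>' a' b' g' x'. v (\<kappa> - \<kappa>') < d \<and> v (a - a') < d \<and> v (b - b') < d \<and> v (g - g') < d \<and> (\<forall>i. v (x i - x' i) < d)"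
  obtain d where d: "0 < d" "\<And>\<kappa>' a' b' g' x'. ?c d \<kappa>' a' b' g' x' \<Longrightarrow>
      \<forall>j\<in>J. v (kummer_vec \<kappa> a b g x j - kummer_vec \<kappa>' a' b' g' x' j) < r"
    using insert.IH by blast
  obtain d' where d': "0 < d'" "\<And>y. (\<forall>i. v (kummer_vec_args \<kappa> a b g x i - y i) < d') \<Longrightarrow>
     v (evalp (kummer_vec_poly j) (kummer_vec_args \<kappa> a b g x) - evalp (kummer_vec_poly j) y) < r"
    using evalp_close[OF r, of "kummer_vec_args \<kappa> a b g x" "kummer_vec_poly j"] by blast
  have "\<forall>i\<in>insert j J. v (kummer_vec \<kappa> a b g x i - kummer_vec \<kappa>' a' b' g' x' i) < r"
    if c: "?c (min d d') \<kappa>' a' b' g' x'" for \<kappa>' a' b' g' x'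
  proof -
    have "v (kummer_vec_args \<kappa> a b g x i - kummer_vec_args \<kappa>' a' b' g' x' i) < d'" for i
      using c d'(1) by (cases i) (auto simp: kummer_vec_args_def split: chart.split)
    hence "v (kummer_vec \<kappa> a b g x j - kummer_vec \<kappa>' a' b' g' x' j) < r"
      unfolding kummer_vec_eq by (intro d'(2)) blast
    moreover have "\<forall>j\<in>J. v (kummer_vec \<kappa> a b g x j - kummer_vec \<kappa>' a' b' g' x' j) < r"
      by (rule d(2)) (use c in auto)
    ultimately show ?thesis by blast
  qed
  with d(1) d'(1) show ?case by (intro exI[of _ "min d d'"]) simp
qed

text \<open>The point is first moved to \<open>Om \<noteq> 0\<close>, where chart coordinates and a
  scalar \<open>t\<close> determine the blow-up coordinates. The scalars \<open>t\<close> and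
  \<open>\<kappa>\<close> are subject to no equation and can be approximated by arbitrary
  rationals.\<close>

lemma (in padic_3mod4) kummer_rational_approximation:
  fixes w :: "kummer_index \<Rightarrow> 'k"
  assumes w: "w \<in> kummer_cone 1 0" and J: "finite J" and r: "0 < r"
  obtains w' :: "kummer_index \<Rightarrow> rat" where "w' \<in> kummer_cone 1 0" "\<And>j. j \<in> J \<Longrightarrow> v (w j - of_rat (w' j)) < r"
proof -
  obtain \<kappa> a b g x where \<kappa>: "\<kappa> \<noteq> 0" and chart: "kummer_chart a b g x" and wv: "w = kummer_vec \<kappa> a b g x"
    by (rule kummer_cone_chart[OF w one_plus_square_nonzero])
  obtain d where d: "0 < d" and close: "\<And>\<kappa>' a' b' g' x'. v (\<kappa> - \<kappa>') < d \<Longrightarrow> v (a - a') < d \<Longrightarrow> v (b - b') < d \<Longrightarrow>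
     v (g - g') < d \<Longrightarrow> (\<And>i. v (x i - x' i) < d) \<Longrightarrow> \<forall>j\<in>J. v (kummer_vec \<kappa> a b g x j - kummer_vec \<kappa>' a' b' g' x' j) < r"
    using kummer_vec_close[OF r J, of \<kappa> a b g x] by blast
  obtain y t where y: "chart_circle y" "(y Om)\<^sup>2 = y C1 * y C2" "y Om \<noteq> 0" "t \<noteq> 0"
    and xy: "\<And>i. v (x i - y i) < d" and ty: "v (a - t * y C1) < d" "v (b - t * y C2) < d" "v (g - t * y Om) < d"
    using kummer_chart_perturbation[OF chart d] by blast
  have "\<exists>s>0. \<forall>t' z. v (t - t') < s \<longrightarrow> v (y i - z) < s \<longrightarrow> v (t * y i - t' * z) < d" for i
    using mult_close[OF d, of t "y i"] by metis
  then obtain s where s: "\<And>i. 0 < s i" "\<And>i t' z. v (t - t') < s i \<Longrightarrow> v (y i - z) < s i \<Longrightarrow> v (t * y i - t' * z) < d"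
    by metis
  \<comment> \<open>The bounds \<open>v t\<close> and \<open>v (y Om)\<close> keep the rational
    approximations of \<open>t\<close> and \<open>y Om\<close> nonzero, as
    \<open>kummer_vec_rational\<close> requires.\<close>
  define m where "m = min (min d (min (v t) (v (y Om)))) (min (s C1) (min (s C2) (s Om)))"
  have m: "0 < m" "m \<le> d" "m \<le> v t" "m \<le> v (y Om)" "m \<le> s C1" "m \<le> s C2" "m \<le> s Om"
    using d s(1) v_pos[OF y(3)] v_pos[OF y(4)] by (auto simp: m_def)
  obtain x' :: "chart \<Rightarrow> rat" where x': "chart_circle x'" "(x' Om)\<^sup>2 = x' C1 * x' C2"
    and yx: "\<And>i. v (y i - of_rat (x' i)) < m"
    using chart_approximation[OF y(1-3) m(1)] by blast
  obtain t' where t': "v (t - of_rat t') < m" using rat_dense[OF m(1)] by blast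
  have "0 < min d (v \<kappa>)" using d v_pos[OF \<kappa>] by simp
  then obtain \<kappa>' where \<kappa>': "v (\<kappa> - of_rat \<kappa>') < min d (v \<kappa>)" by (rule rat_dense)
  have nz: "q \<noteq> 0" if "v (z - of_rat q) < v z" for q z using that by auto
  have n1: "\<kappa>' \<noteq> 0" by (rule nz[of \<kappa>]) (use \<kappa>' in simp)
  have n2: "t' \<noteq> 0" by (rule nz[of t]) (use t' m(3) in simp)
  have n3: "x' Om \<noteq> 0" by (rule nz[of "y Om"]) (use yx[of Om] m(4) in simp)
  define w' where "w' = kummer_vec \<kappa>' (t' * x' C1) (t' * x' C2) (t' * x' Om) x'"
  have cone: "w' \<in> kummer_cone 1 0"
    unfolding w'_def by (rule kummer_vec_rational[OF x' n3 n1 n2])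
  have prod: "v (z - of_rat (t' * x' i)) < d" if z: "v (z - t * y i) < d" and i: "m \<le> s i" for z i
  proof -
    have "v (t * y i - of_rat t' * of_rat (x' i)) < d"
      by (rule s(2)[of _ i]) (use t' yx[of i] i in simp_all)
    from v_add_less[OF z this] show ?thesis by (simp add: of_rat_mult)
  qed
  have xx: "v (x i - of_rat (x' i)) < d" for i
    using v_add_less[OF xy[of i], of "y i - of_rat (x' i)"] yx[of i] m(2) by simp
  have "\<forall>j\<in>J. v (w j - of_rat (w' j)) < r"
    unfolding wv w'_def kummer_vec_of_rat
    by (rule close) (use \<kappa>' prod[OF ty(1) m(5)] prod[OF ty(2) m(6)] prod[OF ty(3) m(7)] xx in simp_all)
  with cone show ?thesis using that by blast
qed

theorem theorem3p3:
  fixes p :: nat and v :: "'k::field_char_0 \<Rightarrow> real"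
  assumes "prime p" and "[p = 3] (mod 4)" and "p > 7"
    and "padic_field p v"
  shows "kummer_topology v 1 0 closure_of kummer_rat_points 1 0 = kummer_points 1 0"
proof -
  interpret padic_field p v by (rule assms(4))
  interpret padic_3mod4 p v
    by unfold_locales (use assms(2) in \<open>simp add: cong_def\<close>)
  show ?thesis
  proof
    show "kummer_topology v 1 0 closure_of kummer_rat_points 1 0 \<subseteq> kummer_points 1 0"
      using closure_of_subset_topspace[of "kummer_topology v 1 0"] by (simp add: topspace_kummer_topology)
    show "kummer_points 1 0 \<subseteq> kummer_topology v 1 0 closure_of kummer_rat_points 1 0"
    proof
      fix P :: "(kummer_index \<Rightarrow> 'k) set"
      assume P: "P \<in> kummer_points 1 0"
      then obtain w :: "kummer_index \<Rightarrow> 'k" where w: "w \<in> kummer_cone 1 0" "P = biproj_point w"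
        by (auto simp: kummer_points_def)
      have "\<exists>Q\<in>kummer_rat_points 1 0. Q \<in> U" if PU: "P \<in> U" and U: "openin (kummer_topology v 1 0) U" for U
      proof -
        let ?X = "product_topology (\<lambda>_ :: kummer_index. mtopology) UNIV"
        have top: "topspace (subtopology ?X (kummer_cone 1 0)) = kummer_cone 1 0" by simp
        have "openin (subtopology ?X (kummer_cone 1 0))
                {w \<in> topspace (subtopology ?X (kummer_cone 1 0)). biproj_point w \<in> U}"
          using U unfolding kummer_topology_def openin_quotient_topology by blast
        then obtain V where V: "openin ?X V" and UV: "{w \<in> kummer_cone 1 0. biproj_point w \<in> U} = V \<inter> kummer_cone 1 0"
          unfolding top openin_subtopology by blast
        have "w \<in> V" using UV w PU by blast
        from bspec[OF V[unfolded openin_product_topology_alt] this]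
        obtain B where B: "finite {i \<in> UNIV. B i \<noteq> topspace mtopology} \<and>
            (\<forall>i\<in>UNIV. openin mtopology (B i)) \<and> w \<in> Pi\<^sub>E UNIV B \<and> Pi\<^sub>E UNIV B \<subseteq> V" by (rule exE)
        have fin: "finite {i \<in> UNIV. B i \<noteq> topspace mtopology}" and op: "\<And>i. openin mtopology (B i)"
          and wB: "\<And>i. w i \<in> B i" and BV: "Pi\<^sub>E UNIV B \<subseteq> V"
          using B by (simp_all add: PiE_iff)
        define J where "J = {i. B i \<noteq> UNIV}"
        have J: "finite J" using fin by (simp add: J_def)
        have "\<exists>r>0. mball (w j) r \<subseteq> B j" for j
          using op[of j] wB[of j] unfolding openin_mtopology by blast
        then obtain r where r: "\<And>j. 0 < r j" "\<And>j. mball (w j) (r j) \<subseteq> B j" by metis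
        \<comment> \<open>Finitely many constrained coordinates admit a common radius; the inserted
          1 covers the case that there are none.\<close>
        define r0 where "r0 = Min (insert 1 (r ` J))"
        have r0: "0 < r0" "\<And>j. j \<in> J \<Longrightarrow> r0 \<le> r j" using J r(1) by (auto simp: r0_def)
        obtain w' :: "kummer_index \<Rightarrow> rat" where w': "w' \<in> kummer_cone 1 0"
          and near: "\<And>j. j \<in> J \<Longrightarrow> v (w j - of_rat (w' j)) < r0"
          by (rule kummer_rational_approximation[OF w(1) J r0(1)]) (rule that)
        let ?q = "\<lambda>j. of_rat (w' j) :: 'k"
        have "?q j \<in> B j" for j
        proof (cases "j \<in> J")
          case True
          hence "?q j \<in> mball (w j) (r j)" using near[OF True] r0(2)[OF True] by (simp add: abs_dist_def)
          thus ?thesis using r(2) by blast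
        qed (simp add: J_def)
        hence "?q \<in> V" using BV by auto
        hence "biproj_point ?q \<in> U" using UV kummer_cone_of_rat[OF w'] by blast
        moreover have "biproj_point ?q \<in> kummer_rat_points 1 0" using w' unfolding kummer_rat_points_def by blast
        ultimately show ?thesis by blast
      qed
      with P show "P \<in> kummer_topology v 1 0 closure_of kummer_rat_points 1 0"
        by (auto simp: in_closure_of topspace_kummer_topology)
    qed
  qed
qed

end
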